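(* Let $\Gamma_0=\mathrm{Aut}(F_2)$ and let $X_0$ be the Brady complex. For $p\ge2$ let $A_p\triangleleft F_2$ be a characteristic subgroup and let $B_p\triangleleft F_2$ be a normal subgroup such that $F_2/B_p$ is isomorphic to the group $S_p$ of permutations of a set with $p$ elements. Suppose that $[F_2:A_p]\le e^{O(p)}$. Let $\Gamma_1=\mathrm{IA}_2\rtimes\langle\alpha,\beta\rangle$ (a subgroup of index 24 in $\Gamma_0$), and for $p\ge2$ let $\Gamma_p:=A_p\rtimes B_p$, where $A_p$ is viewed as a subgroup of $\mathrm{IA}_2\cong F_2$ and $B_p$ as a subgroup of $\langle\bar\alpha,\bar\beta\rangle\cong F_2$. Then for every $\delta\in(0,1)$, with overwhelming probability $\mathbb{Z}^2$ embeds in the random group $\Gamma$ at density $\delta$ in the density model over $(\Gamma_0,\{\Gamma_p\},X_0)$.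
   Context: Write $F_2=\langle x,y\rangle$. Define $\alpha,\beta\in\mathrm{Aut}(F_2)$ by $\alpha\colon x\mapsto x,\ y\mapsto x^2y$ and $\beta\colon x\mapsto xy^2,\ y\mapsto y$; their images under $\mathrm{Aut}(F_2)\twoheadrightarrow \mathrm{GL}_2(\mathbb{Z})$ are $\bar\alpha=\begin{pmatrix}1&2\\0&1\end{pmatrix}$, $\bar\beta=\begin{pmatrix}1&0\\2&1\end{pmatrix}$, which generate a free group of rank 2, so $\langle\alpha,\beta\rangle\cong\langle\bar\alpha,\bar\beta\rangle\cong F_2$. $\mathrm{IA}_2=\mathrm{Inn}(F_2)\cong F_2$ is the kernel of $\mathrm{Aut}(F_2)\to\mathrm{GL}_2(\mathbb{Z})$, and is generated by the inner automorphisms $\alpha_0\colon x\mapsto x,\ y\mapsto xyx^{-1}$ and $\beta_0\colon x\mapsto yxy^{-1},\ y\mapsto y$. In $\Gamma_p=A_p\rtimes B_p$, $B_p$ is a subgroup of $\langle\alpha,\beta\rangle$ via $\langle\alpha,\beta\rangle\cong\langle\bar\alpha,\bar\beta\rangle$. Brady complex $X_0$. Let $B_4$ be the braid group on 4 strands in its dual (Birman--Ko--Lee) presentation, generated by six atoms lifting the transpositions of $S_4$, with Garside element $\delta_B$ lifting the 4-cycle $(1\,2\,3\,4)$; factorizations $\delta_B=t_1t_2t_3$ into atoms correspond to the 16 factorizations of the 4-cycle into three transpositions. Take the simplicial 2-complex with vertex set $B_4/\langle\delta_B\rangle$ and an equilateral triangle of side 1 with vertices $g\langle\delta_B\rangle,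 gt_1\langle\delta_B\rangle, gt_1t_2\langle\delta_B\rangle$ for every $g\in B_4$ and every such factorization. Edges corresponding to the atoms $(13)$, $(24)$ lie in exactly two triangles; erase them, merging the two triangles into a lozenge. The result $X_0$, with triangles and lozenges as 2-faces, is a CAT(0) 2-complex on which $\mathrm{Aut}(F_2)\cong\mathrm{Aut}(B_4)\supset B_4/Z(B_4)$ (index 2) is known to act properly with compact quotient by cellular isometries, extending left translation by $B_4/Z(B_4)$. Density model. Let $\mathcal{C}_p$ be the finite set of $\Gamma_p$-orbits of 2-faces of $X_0$. At density $\delta$, choose $|\mathcal{C}_p|^\delta$ (up to rounding) elements of $\mathcal{C}_p$ uniformly and independently at random, giving a random set $A\subset\mathcal{C}_p$; let $X_A=X_0-\bigcup_{C\in A}\mathring C$ and let $\tilde X_A$ be its universal cover. The random group $\Gamma$ is the group of all lifts to $\tilde X_A$ of the elements of $\Gamma_p$ acting on $X_A$, so $1\to\pi_1(X_A)\to\Gamma\to\Gamma_p\to1$ (if $\Gamma_p$ acts freely, $\Gamma=\pi_1(X_A/\Gamma_p)$). "With overwhelming probability" means with probability tending to 1 as $p\to\infty$. *)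

theory Defs
  imports "HOL-Algebra.Algebra" "HOL-Probability.Probability"
begin

section \<open>Groups given by generators and relations\<close>

text \<open>A letter \<open>(a, True)\<close> stands for \<open>a\<close> and \<open>(a, False)\<close> for its inverse.\<close>

type_synonym 'g word = "('g \<times> bool) list"

inductive_set pres_rel :: "'g set \<Rightarrow> ('g word \<times> 'g word) set \<Rightarrow> ('g word \<times> 'g word) set"
  for S R where
  refl: "w \<in> lists (S \<times> UNIV) \<Longrightarrow> (w, w) \<in> pres_rel S R"
| sym: "(v, w) \<in> pres_rel S R \<Longrightarrow> (w, v) \<in> pres_rel S R"
| trans: "(u, v) \<in> pres_rel S R \<Longrightarrow> (v, w) \<in> pres_rel S R \<Longrightarrow> (u, w) \<in> pres_rel S R"
| cancel: "u @ v \<in> lists (S \<times> UNIV) \<Longrightarrow> a \<in> S \<Longrightarrow>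
    (u @ [(a, s), (a, \<not> s)] @ v, u @ v) \<in> pres_rel S R"
| relator: "(l, r) \<in> R \<Longrightarrow> u @ l @ v \<in> lists (S \<times> UNIV) \<Longrightarrow> u @ r @ v \<in> lists (S \<times> UNIV) \<Longrightarrow>
    (u @ l @ v, u @ r @ v) \<in> pres_rel S R"

definition pres_group :: "'g set \<Rightarrow> ('g word \<times> 'g word) set \<Rightarrow> 'g word set monoid" where
  "pres_group S R =
     \<lparr>carrier = lists (S \<times> UNIV) // pres_rel S R,
      monoid.mult = (\<lambda>A B. \<Union>a\<in>A. \<Union>b\<in>B. pres_rel S R `` {a @ b}),
      one = pres_rel S R `` {[]}\<rparr>"

definition pres_gen :: "'g set \<Rightarrow> ('g word \<times> 'g word) set \<Rightarrow> 'g \<Rightarrow> 'g word set" where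
  "pres_gen S R a = pres_rel S R `` {[(a, True)]}"

fun word_val :: "('b, 'm) monoid_scheme \<Rightarrow> ('g \<Rightarrow> 'b) \<Rightarrow> 'g word \<Rightarrow> 'b" where
  "word_val G f [] = \<one>\<^bsub>G\<^esub>"
| "word_val G f ((a, s) # w) = (if s then f a else inv\<^bsub>G\<^esub> (f a)) \<otimes>\<^bsub>G\<^esub> word_val G f w"

definition inner_aut :: "('a, 'm) monoid_scheme \<Rightarrow> 'a \<Rightarrow> 'a \<Rightarrow> 'a" where
  "inner_aut G w = (\<lambda>u\<in>carrier G. w \<otimes>\<^bsub>G\<^esub> u \<otimes>\<^bsub>G\<^esub> inv\<^bsub>G\<^esub> w)"

definition characteristic_subgroup :: "'a set \<Rightarrow> ('a, 'm) monoid_scheme \<Rightarrow> bool" where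
  "characteristic_subgroup H G \<longleftrightarrow> subgroup H G \<and> (\<forall>\<phi>\<in>auto G. \<phi> ` H = H)"


section \<open>The free group of rank two and its automorphisms\<close>

datatype gen2 = GenX | GenY

type_synonym F2_elt = "gen2 word set"

definition F2 :: "F2_elt monoid" where
  "F2 = pres_group UNIV {}"

definition F2_x :: F2_elt where "F2_x = pres_gen UNIV {} GenX"
definition F2_y :: F2_elt where "F2_y = pres_gen UNIV {} GenY"

text \<open>The homomorphism from \<open>F2\<close> to \<open>G\<close> that sends \<open>x\<close> to \<open>a\<close> and \<open>y\<close> to \<open>b\<close>; the words in a class
  all have the same value.\<close>

definition F2_hom :: "('b, 'm) monoid_scheme \<Rightarrow> 'b \<Rightarrow> 'b \<Rightarrow> F2_elt \<Rightarrow> 'b" where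
  "F2_hom G a b = (\<lambda>A\<in>carrier F2. the_elem (word_val G (case_gen2 a b) ` A))"

abbreviation AutF2 :: "(F2_elt \<Rightarrow> F2_elt) monoid" where
  "AutF2 \<equiv> AutoGroup F2"

definition alpha :: "F2_elt \<Rightarrow> F2_elt" where
  "alpha = F2_hom F2 F2_x (F2_x \<otimes>\<^bsub>F2\<^esub> F2_x \<otimes>\<^bsub>F2\<^esub> F2_y)"

definition beta :: "F2_elt \<Rightarrow> F2_elt" where
  "beta = F2_hom F2 (F2_x \<otimes>\<^bsub>F2\<^esub> F2_y \<otimes>\<^bsub>F2\<^esub> F2_y) F2_y"

text \<open>The internal semidirect product \<open>A \<rtimes> B\<close> inside \<open>Aut(F2)\<close>: \<open>A\<close> is viewed in
  \<open>IA2 = Inn(F2)\<close> by letting \<open>w\<close> act by conjugation, and \<open>B\<close> in the free group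
  \<open>\<langle>alpha, beta\<rangle>\<close> through \<open>x \<mapsto> alpha\<close>, \<open>y \<mapsto> beta\<close>.\<close>

definition semidirect_Aut :: "F2_elt set \<Rightarrow> F2_elt set \<Rightarrow> (F2_elt \<Rightarrow> F2_elt) set" where
  "semidirect_Aut A B = (inner_aut F2 ` A) <#>\<^bsub>AutF2\<^esub> (F2_hom AutF2 alpha beta ` B)"


section \<open>The braid group on four strands, dual presentation\<close>

definition atom_idx :: "(int \<times> int) set" where
  "atom_idx = {(t, s). 1 \<le> s \<and> s < t \<and> t \<le> 4}"

text \<open>The Birman--Ko--Lee relations: \<open>(t, s)\<close> names the band generator lifting the transposition
  of \<open>t\<close> and \<open>s\<close>.\<close>

definition BKL_rel :: "((int \<times> int) word \<times> (int \<times> int) word) set" where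
  "BKL_rel =
     {([((t, s), True), ((r, q), True)], [((r, q), True), ((t, s), True)]) | t s r q.
        (t, s) \<in> atom_idx \<and> (r, q) \<in> atom_idx \<and> (t - r) * (t - q) * (s - r) * (s - q) > 0}
   \<union> {([((t, s), True), ((s, r), True)], [((t, r), True), ((t, s), True)]) | t s r.
        (t, s) \<in> atom_idx \<and> (s, r) \<in> atom_idx}
   \<union> {([((t, s), True), ((s, r), True)], [((s, r), True), ((t, r), True)]) | t s r.
        (t, s) \<in> atom_idx \<and> (s, r) \<in> atom_idx}"

type_synonym B4_elt = "(int \<times> int) word set"

definition B4 :: "B4_elt monoid" where
  "B4 = pres_group atom_idx BKL_rel"

definition atom :: "int \<times> int \<Rightarrow> B4_elt" where
  "atom = pres_gen atom_idx BKL_rel"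

definition atoms :: "B4_elt set" where
  "atoms = atom ` atom_idx"

definition delta_B :: B4_elt where
  "delta_B = atom (4, 3) \<otimes>\<^bsub>B4\<^esub> atom (3, 2) \<otimes>\<^bsub>B4\<^esub> atom (2, 1)"

definition Delta_B :: "B4_elt set" where
  "Delta_B = generate B4 {delta_B}"

text \<open>The isomorphism between \<open>Aut(B4)\<close> and \<open>Aut(F2)\<close> of Dyer, Formanek and Grossman restricts
  automorphisms to the kernel of the map from \<open>B4\<close> to \<open>B3\<close> that sends the standard generators
  \<open>\<sigma>1, \<sigma>2, \<sigma>3\<close> to \<open>\<sigma>1, \<sigma>2, \<sigma>1\<close>. This kernel is characteristic, and is free on \<open>\<sigma>1 \<sigma>3\<inverse>\<close> and
  \<open>\<sigma>2 \<sigma>1 \<sigma>3\<inverse> \<sigma>2\<inverse>\<close>, where \<open>\<sigma>i\<close> is the atom \<open>(i + 1, i)\<close>; \<open>F2_in_B4\<close> identifies \<open>F2\<close> with it, and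
  \<open>Aut_corr\<close> is the graph of the isomorphism.\<close>

definition F2_in_B4 :: "F2_elt \<Rightarrow> B4_elt" where
  "F2_in_B4 = F2_hom B4
     (atom (2, 1) \<otimes>\<^bsub>B4\<^esub> inv\<^bsub>B4\<^esub> atom (4, 3))
     (atom (3, 2) \<otimes>\<^bsub>B4\<^esub> atom (2, 1) \<otimes>\<^bsub>B4\<^esub> inv\<^bsub>B4\<^esub> atom (4, 3) \<otimes>\<^bsub>B4\<^esub> inv\<^bsub>B4\<^esub> atom (3, 2))"

definition Aut_corr :: "(F2_elt \<Rightarrow> F2_elt) \<Rightarrow> (B4_elt \<Rightarrow> B4_elt) \<Rightarrow> bool" where
  "Aut_corr \<phi> \<psi> \<longleftrightarrow> \<phi> \<in> auto F2 \<and> \<psi> \<in> auto B4 \<and>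
     (\<forall>w\<in>carrier F2. \<psi> (F2_in_B4 w) = F2_in_B4 (\<phi> w))"


section \<open>Polygonal complexes and universal covers\<close>

text \<open>Two-dimensional complexes whose graph is simple and whose 2-faces are determined by their
  vertex sets; the boundary of a 2-face \<open>C\<close> is the closed edge path running once through each
  vertex of \<open>C\<close>. Cellular maps are given by their effect on vertices.\<close>

record 'v poly_complex =
  verts :: "'v set"
  edges :: "'v set set"
  faces :: "'v set set"

definition cell_auto :: "'v poly_complex \<Rightarrow> ('v \<Rightarrow> 'v) \<Rightarrow> bool" where
  "cell_auto K f \<longleftrightarrow> f \<in> Bij (verts K) \<and>
     (\<lambda>e. f ` e) ` edges K = edges K \<and> (\<lambda>C. f ` C) ` faces K = faces K"

definition edge_path :: "'v poly_complex \<Rightarrow> 'v list \<Rightarrow> bool" where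
  "edge_path K p \<longleftrightarrow> p \<noteq> [] \<and> set p \<subseteq> verts K \<and>
     successively (\<lambda>a b. {a, b} \<in> edges K) p"

definition boundary_cycle :: "'v poly_complex \<Rightarrow> 'v set \<Rightarrow> 'v list \<Rightarrow> bool" where
  "boundary_cycle K C c \<longleftrightarrow> C \<in> faces K \<and> edge_path K c \<and>
     hd c = last c \<and> distinct (tl c) \<and> set (tl c) = C"

inductive path_step :: "'v poly_complex \<Rightarrow> 'v list \<Rightarrow> 'v list \<Rightarrow> bool" for K where
  backtrack: "{a, b} \<in> edges K \<Longrightarrow> path_step K (p @ [a] @ q) (p @ [a, b, a] @ q)"
| face: "boundary_cycle K C c \<Longrightarrow> path_step K (p @ [hd c] @ q) (p @ c @ q)"

definition path_class :: "'v poly_complex \<Rightarrow> 'v list \<Rightarrow> 'v list set" where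
  "path_class K p = {q. equivclp (path_step K) p q}"

definition paths_from :: "'v poly_complex \<Rightarrow> 'v \<Rightarrow> 'v list set" where
  "paths_from K v = {p. edge_path K p \<and> hd p = v}"

text \<open>The universal cover of a connected complex, realized on homotopy classes of edge paths
  issuing from a base vertex. A face lies over \<open>C\<close> and is swept out by following a boundary cycle
  of \<open>C\<close> from the end of a path.\<close>

definition univ_cover :: "'v poly_complex \<Rightarrow> 'v \<Rightarrow> 'v list set poly_complex" where
  "univ_cover K v =
     \<lparr>verts = path_class K ` paths_from K v,
      edges = {{path_class K p, path_class K (p @ [w])} | p w.
                 p \<in> paths_from K v \<and> {last p, w} \<in> edges K},
      faces = {{path_class K (p @ take k (tl c)) | k. k \<le> length (tl c)} | p C c.
                 p \<in> paths_from K v \<and> boundary_cycle K C c \<and> hd c = last p}\<rparr>"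

definition cover_proj :: "'v list set \<Rightarrow> 'v" where
  "cover_proj P = the_elem (last ` P)"

text \<open>The group of all lifts to the universal cover of the elements of \<open>G\<close>. A lift is recorded
  together with the element of \<open>G\<close> that it covers, so that the projection to \<open>G\<close> is part of the
  structure.\<close>

definition lift_group ::
  "'v poly_complex \<Rightarrow> 'v \<Rightarrow> 'g monoid \<Rightarrow> ('g \<Rightarrow> 'v \<Rightarrow> 'v) \<Rightarrow> ('g \<times> ('v list set \<Rightarrow> 'v list set)) monoid" where
  "lift_group K v G act =
     (G \<times>\<times> BijGroup (verts (univ_cover K v)))
       \<lparr>carrier := {(g, f). g \<in> carrier G \<and> cell_auto (univ_cover K v) f \<and>
          (\<forall>u\<in>verts (univ_cover K v). cover_proj (f u) = act g (cover_proj u))}\<rparr>"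


section \<open>The Brady complex\<close>

type_synonym brady_vertex = "B4_elt set"

definition brady_verts :: "brady_vertex set" where
  "brady_verts = {g <#\<^bsub>B4\<^esub> Delta_B | g. g \<in> carrier B4}"

definition brady_triangles :: "brady_vertex set set" where
  "brady_triangles =
     {{g <#\<^bsub>B4\<^esub> Delta_B, (g \<otimes>\<^bsub>B4\<^esub> t1) <#\<^bsub>B4\<^esub> Delta_B,
       (g \<otimes>\<^bsub>B4\<^esub> t1 \<otimes>\<^bsub>B4\<^esub> t2) <#\<^bsub>B4\<^esub> Delta_B} | g t1 t2 t3.
        g \<in> carrier B4 \<and> t1 \<in> atoms \<and> t2 \<in> atoms \<and> t3 \<in> atoms \<and>
        t1 \<otimes>\<^bsub>B4\<^esub> t2 \<otimes>\<^bsub>B4\<^esub> t3 = delta_B}"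

definition brady_erased :: "brady_vertex set set" where
  "brady_erased =
     {{g <#\<^bsub>B4\<^esub> Delta_B, (g \<otimes>\<^bsub>B4\<^esub> a) <#\<^bsub>B4\<^esub> Delta_B} | g a.
        g \<in> carrier B4 \<and> a \<in> {atom (3, 1), atom (4, 2)}}"

text \<open>The faces are the triangles without erased edge, and the lozenges made of two triangles
  that share one.\<close>

definition brady_complex :: "brady_vertex poly_complex" where
  "brady_complex =
     \<lparr>verts = brady_verts,
      edges = {e. card e = 2 \<and> (\<exists>T\<in>brady_triangles. e \<subseteq> T)} - brady_erased,
      faces = {T \<in> brady_triangles. \<not> (\<exists>e\<in>brady_erased. e \<subseteq> T)} \<union>
              {T \<union> T' | T T'. T \<in> brady_triangles \<and> T' \<in> brady_triangles \<and> T \<noteq> T' \<and>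
                 (\<exists>e\<in>brady_erased. e \<subseteq> T \<inter> T')}\<rparr>"

text \<open>The erased edges are the short diagonals of the lozenges, so a cellular automorphism comes
  from an isometry iff it preserves them.\<close>

definition brady_isometry :: "(brady_vertex \<Rightarrow> brady_vertex) \<Rightarrow> bool" where
  "brady_isometry f \<longleftrightarrow> cell_auto brady_complex f \<and>
     (\<lambda>e. f ` e) ` brady_erased = brady_erased"

text \<open>An action of \<open>Aut(F2)\<close> on the Brady complex by cellular isometries that extends the action
  of \<open>B4\<close> modulo its centre (the inner automorphisms of \<open>B4\<close>) by left translation.\<close>

definition brady_action :: "((F2_elt \<Rightarrow> F2_elt) \<Rightarrow> brady_vertex \<Rightarrow> brady_vertex) \<Rightarrow> bool" where
  "brady_action act \<longleftrightarrow>
     group_action AutF2 brady_verts act \<and>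
     (\<forall>\<phi>\<in>carrier AutF2. brady_isometry (act \<phi>)) \<and>
     (\<forall>\<phi>. \<forall>b\<in>carrier B4. Aut_corr \<phi> (inner_aut B4 b) \<longrightarrow>
        (\<forall>v\<in>brady_verts. act \<phi> v = b <#\<^bsub>B4\<^esub> v))"


section \<open>The density model\<close>

text \<open>Here \<open>H\<close> is a subgroup of \<open>Aut(F2)\<close>.\<close>

definition face_orbits ::
  "((F2_elt \<Rightarrow> F2_elt) \<Rightarrow> brady_vertex \<Rightarrow> brady_vertex) \<Rightarrow> (F2_elt \<Rightarrow> F2_elt) set \<Rightarrow> brady_vertex set set set" where
  "face_orbits act H = {{act h ` C | h. h \<in> H} | C. C \<in> faces brady_complex}"

definition remove_faces :: "'v poly_complex \<Rightarrow> 'v set set set \<Rightarrow> 'v poly_complex" where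
  "remove_faces K \<A> = K\<lparr>faces := faces K - \<Union>\<A>\<rparr>"

text \<open>The group obtained by removing the orbits in \<open>\<A>\<close>. The complex is connected, whence the
  choice of base vertex is immaterial.\<close>

definition density_group ::
  "((F2_elt \<Rightarrow> F2_elt) \<Rightarrow> brady_vertex \<Rightarrow> brady_vertex) \<Rightarrow> (F2_elt \<Rightarrow> F2_elt) set \<Rightarrow> brady_vertex set set set
   \<Rightarrow> ((F2_elt \<Rightarrow> F2_elt) \<times> (brady_vertex list set \<Rightarrow> brady_vertex list set)) monoid" where
  "density_group act H \<A> =
     lift_group (remove_faces brady_complex \<A>) Delta_B (AutF2\<lparr>carrier := H\<rparr>) act"

text \<open>\<open>n\<close> independent uniform choices of orbits, as a list; the removed set is the set of its
  entries.\<close>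

definition random_orbits ::
  "((F2_elt \<Rightarrow> F2_elt) \<Rightarrow> brady_vertex \<Rightarrow> brady_vertex) \<Rightarrow> (F2_elt \<Rightarrow> F2_elt) set \<Rightarrow> nat
   \<Rightarrow> brady_vertex set set list pmf" where
  "random_orbits act H n = replicate_pmf n (pmf_of_set (face_orbits act H))"

definition Z2_embeds :: "('a, 'm) monoid_scheme \<Rightarrow> bool" where
  "Z2_embeds G \<longleftrightarrow> mon (integer_group \<times>\<times> integer_group) G \<noteq> {}"

end

theory Submission
  imports Defs
begin

text \<open>The automorphisms \<open>alpha\<close> and conjugation by \<open>x\<close> commute and act on the Brady complex as
  left translation by \<open>\<sigma>3\<close> to the power \<open>-2\<close> and by \<open>\<sigma>1 \<sigma>3\<inverse>\<close>. Since \<open>{1, \<sigma>1, \<sigma>1 \<sigma>3, \<sigma>3}\<close> spans a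
  lozenge, the group \<open>\<langle>\<sigma>1, \<sigma>3\<rangle>\<close> is the vertex set of a flat on which it acts simply transitively.
  Some power of \<open>x\<close> with exponent \<open>k \<le> [F2 : A p]\<close> lies in \<open>A p\<close>, and some power with exponent
  \<open>m \<le> 2 ^ p\<close> lies in \<open>B p\<close>, so that \<open>\<Gamma> p\<close> contains a copy of \<open>\<int>\<^sup>2\<close> with only \<open>2 k m\<close> orbits on the
  lozenges of the flat. If none of these orbits is removed, the flat lifts to the universal cover and
  this \<open>\<int>\<^sup>2\<close> lifts along with it. On the other hand, \<open>B4\<close> acts on \<open>\<int>\<^sup>2\<close> through \<open>SL2(\<int>)\<close>, where
  \<open>\<langle>alpha, beta\<rangle>\<close> becomes the free Sanov subgroup while the stabilizer of a lozenge has at most 12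
  images; hence there are at least \<open>p! / 12\<close> orbits of faces. As \<open>2 k m\<close> is exponentially bounded
  in \<open>p\<close>, the union bound shows that with overwhelming probability the flat survives.\<close>

section \<open>Presented groups\<close>

text \<open>Two obstacles shape the argument. A translation of the flat has one lift for every
  element of the fundamental group, and lifts chosen one by one need not compose. The lifts used
  here are those that preserve one fixed lift of the flat: a translated path is preceded by a path
  inside the flat. Since grid walks with the same ends are homotopic across the surviving lozenges,
  these lifts multiply exactly as in Z^2. Injectivity is then inherited from \<Gamma> p, to which
  the lifts project. The second obstacle is quantitative. With M orbits, about M^\<delta> draws must
  miss 2 k m of them, so failure has probability of order k m / M^(1 - \<delta>). A factorial in M
  beats every exponential even after raising to the small power 1 - \<delta>, but only if k m is
  truly exponential; the bound p! on the exponent of the quotient by B p would be useless. The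
  action is given only through its restriction to left translations, so every automorphism that
  occurs is written as \<open>sd w u\<close> and replaced by a braid \<open>sd_braid w u\<close>.
  The Z^2 on which braids act is the abelianization of \<open>F2\<close>, hence inner automorphisms
  leave no trace there and only the twist \<open>u\<close> is seen.\<close>

lemma pres_rel_lists:
  assumes "(v, w) \<in> pres_rel S R"
  shows "v \<in> lists (S \<times> UNIV) \<and> w \<in> lists (S \<times> UNIV)"
  using assms by induction auto

lemma equiv_pres_rel: "equiv (lists (S \<times> UNIV)) (pres_rel S R)"
proof (rule equivI)
  show "pres_rel S R \<subseteq> lists (S \<times> UNIV) \<times> lists (S \<times> UNIV)"
    by (clarify, drule pres_rel_lists) simp
  show "refl_on (lists (S \<times> UNIV)) (pres_rel S R)"
    by (auto simp: refl_on_def intro: pres_rel.refl)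
  show "sym (pres_rel S R)"
    by (auto intro: symI pres_rel.sym)
  show "trans (pres_rel S R)"
    by (auto intro: transI pres_rel.trans)
qed

lemma pres_rel_append_left:
  assumes "(v, w) \<in> pres_rel S R" "u \<in> lists (S \<times> UNIV)"
  shows "(u @ v, u @ w) \<in> pres_rel S R"
  using assms
proof induction
  case (cancel u' v a s)
  then show ?case using pres_rel.cancel[of "u @ u'" v S a s R] by auto
next
  case (relator l r u' v)
  then show ?case using pres_rel.relator[of l r R "u @ u'" v S] by auto
next
  case (sym v w) then show ?case by (blast intro: pres_rel.sym)
next
  case (trans u v w) then show ?case by (blast intro: pres_rel.trans)
next
  case (refl w) then show ?case by (intro pres_rel.refl) auto
qed

lemma pres_rel_append_right:
  assumes "(v, w) \<in> pres_rel S R" "u \<in> lists (S \<times> UNIV)"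
  shows "(v @ u, w @ u) \<in> pres_rel S R"
  using assms
proof induction
  case (cancel u' v a s)
  then show ?case using pres_rel.cancel[of u' "v @ u" S a s R] by auto
next
  case (relator l r u' v)
  then show ?case using pres_rel.relator[of l r R u' "v @ u" S] by auto
next
  case (sym v w) then show ?case by (blast intro: pres_rel.sym)
next
  case (trans u v w) then show ?case by (blast intro: pres_rel.trans)
next
  case (refl w) then show ?case by (intro pres_rel.refl) auto
qed

lemma pres_rel_append:
  assumes "(v, w) \<in> pres_rel S R" "(v', w') \<in> pres_rel S R"
  shows "(v @ v', w @ w') \<in> pres_rel S R"
  by (meson assms pres_rel.trans pres_rel_append_left pres_rel_append_right pres_rel_lists)

abbreviation pres_class :: "'g set \<Rightarrow> ('g word \<times> 'g word) set \<Rightarrow> 'g word \<Rightarrow> 'g word set" where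
  "pres_class S R w \<equiv> pres_rel S R `` {w}"

lemma pres_class_eq_iff:
  assumes "v \<in> lists (S \<times> UNIV)" "w \<in> lists (S \<times> UNIV)"
  shows "pres_class S R v = pres_class S R w \<longleftrightarrow> (v, w) \<in> pres_rel S R"
  using assms eq_equiv_class_iff[OF equiv_pres_rel] by metis

lemma pres_class_eqI: "(v, w) \<in> pres_rel S R \<Longrightarrow> pres_class S R v = pres_class S R w"
  using pres_class_eq_iff pres_rel_lists by metis

lemma pres_class_carrier: "w \<in> lists (S \<times> UNIV) \<Longrightarrow> pres_class S R w \<in> carrier (pres_group S R)"
  by (simp add: pres_group_def quotientI)

lemma pres_carrierE:
  assumes "A \<in> carrier (pres_group S R)"
  obtains w where "w \<in> lists (S \<times> UNIV)" "A = pres_class S R w"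
proof -
  have "A \<in> lists (S \<times> UNIV) // pres_rel S R" using assms by (simp add: pres_group_def)
  then show thesis by (rule quotientE) (rule that)
qed

lemma pres_class_mult:
  assumes "v \<in> lists (S \<times> UNIV)" "w \<in> lists (S \<times> UNIV)"
  shows "pres_class S R v \<otimes>\<^bsub>pres_group S R\<^esub> pres_class S R w = pres_class S R (v @ w)"
proof -
  have "pres_class S R (a @ b) = pres_class S R (v @ w)"
    if "a \<in> pres_class S R v" "b \<in> pres_class S R w" for a b
    using that by (intro pres_class_eqI[THEN HOL.sym]) (auto intro: pres_rel_append)
  moreover have "v \<in> pres_class S R v" "w \<in> pres_class S R w"
    using assms by (auto intro: pres_rel.refl)
  ultimately have "(\<Union>a\<in>pres_class S R v. \<Union>b\<in>pres_class S R w. pres_class S R (a @ b)) =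
      pres_class S R (v @ w)"
    by (metis (no_types, lifting) UN_constant_eq)
  then show ?thesis by (simp add: pres_group_def)
qed

lemma pres_class_one: "\<one>\<^bsub>pres_group S R\<^esub> = pres_class S R []"
  by (simp add: pres_group_def)

definition inv_word :: "'g word \<Rightarrow> 'g word" where
  "inv_word w = rev (map (\<lambda>(a, s). (a, \<not> s)) w)"

lemma inv_word_lists: "w \<in> lists (S \<times> UNIV) \<Longrightarrow> inv_word w \<in> lists (S \<times> UNIV)"
  by (auto simp: inv_word_def)

lemma inv_word_cancel:
  "w \<in> lists (S \<times> UNIV) \<Longrightarrow> (inv_word w @ w, []) \<in> pres_rel S R"
proof (induction w)
  case Nil then show ?case by (auto simp: inv_word_def intro: pres_rel.refl)
next
  case (Cons z w)
  obtain a s where z: "z = (a, s)" by fastforce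
  have "(inv_word w @ [(a, \<not> s), (a, \<not> \<not> s)] @ w, inv_word w @ w) \<in> pres_rel S R"
    using Cons.prems z inv_word_lists[of w S] by (intro pres_rel.cancel) auto
  then show ?case using Cons z by (auto simp: inv_word_def intro: pres_rel.trans)
qed

lemma group_pres_group: "group (pres_group S R)"
proof (rule groupI)
  let ?G = "pres_group S R"
  fix x assume "x \<in> carrier ?G"
  then obtain u where u: "u \<in> lists (S \<times> UNIV)" "x = pres_class S R u" by (rule pres_carrierE)
  show "\<one>\<^bsub>?G\<^esub> \<otimes>\<^bsub>?G\<^esub> x = x"
    using u pres_class_mult[of "[]" S u R] by (simp add: pres_class_one)
  have "pres_class S R (inv_word u) \<otimes>\<^bsub>?G\<^esub> x = \<one>\<^bsub>?G\<^esub>"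
    using u inv_word_cancel[of u S R] inv_word_lists[of u S]
    by (simp add: pres_class_one pres_class_mult pres_class_eqI)
  then show "\<exists>y\<in>carrier ?G. y \<otimes>\<^bsub>?G\<^esub> x = \<one>\<^bsub>?G\<^esub>"
    using u inv_word_lists pres_class_carrier by metis
  fix y assume "y \<in> carrier ?G"
  then obtain v where v: "v \<in> lists (S \<times> UNIV)" "y = pres_class S R v" by (rule pres_carrierE)
  show "x \<otimes>\<^bsub>?G\<^esub> y \<in> carrier ?G"
    using u v by (simp add: pres_class_mult pres_class_carrier)
  fix z assume "z \<in> carrier ?G"
  then obtain w where w: "w \<in> lists (S \<times> UNIV)" "z = pres_class S R w" by (rule pres_carrierE)
  show "x \<otimes>\<^bsub>?G\<^esub> y \<otimes>\<^bsub>?G\<^esub> z = x \<otimes>\<^bsub>?G\<^esub> (y \<otimes>\<^bsub>?G\<^esub> z)"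
    using u v w by (simp add: pres_class_mult)
next
  show "\<one>\<^bsub>pres_group S R\<^esub> \<in> carrier (pres_group S R)"
    by (simp add: pres_class_one pres_class_carrier)
qed

lemma pres_gen_carrier: "a \<in> S \<Longrightarrow> pres_gen S R a \<in> carrier (pres_group S R)"
  by (simp add: pres_gen_def pres_class_carrier)

lemma pres_gen_inv:
  assumes "a \<in> S"
  shows "inv\<^bsub>pres_group S R\<^esub> (pres_gen S R a) = pres_class S R [(a, False)]"
proof (rule group.inv_equality[OF group_pres_group])
  have "([] @ [(a, False), (a, \<not> False)] @ [], [] @ []) \<in> pres_rel S R"
    using assms by (intro pres_rel.cancel) auto
  then show "pres_class S R [(a, False)] \<otimes>\<^bsub>pres_group S R\<^esub> pres_gen S R a = \<one>\<^bsub>pres_group S R\<^esub>"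
    using assms unfolding pres_gen_def
    by (subst pres_class_mult) (auto simp: pres_class_one intro!: pres_class_eqI)
qed (use assms in \<open>auto intro: pres_class_carrier pres_gen_carrier\<close>)

lemma (in group) word_val_closed:
  assumes "f \<in> S \<rightarrow> carrier G" "w \<in> lists (S \<times> UNIV)"
  shows "word_val G f w \<in> carrier G"
  using assms(2) assms(1) by (induction w) (auto simp: Pi_iff)

lemma (in group) word_val_append:
  assumes "f \<in> S \<rightarrow> carrier G" "v \<in> lists (S \<times> UNIV)" "w \<in> lists (S \<times> UNIV)"
  shows "word_val G f (v @ w) = word_val G f v \<otimes> word_val G f w"
  using assms(2) assms(1,3)
proof (induction v)
  case (Cons z v)
  then show ?case
    using word_val_closed[of f S] by (cases z) (auto simp: m_assoc Pi_iff)
qed (auto simp: word_val_closed)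

text \<open>Turns classes into evaluated words: a class is the product, in the presented group
  itself, of the generators spelled by any of its words. The induction principle and the defining
  relations are both read off from this.\<close>

lemma pres_class_conv_word_val:
  assumes "w \<in> lists (S \<times> UNIV)"
  shows "pres_class S R w = word_val (pres_group S R) (pres_gen S R) w"
  using assms
proof (induction w)
  case (Cons z w)
  obtain a s where z: "z = (a, s)" by fastforce
  have "pres_class S R (z # w) = pres_class S R [z] \<otimes>\<^bsub>pres_group S R\<^esub> pres_class S R w"
    using Cons by (subst pres_class_mult) auto
  moreover have "pres_class S R [z] =
      (if s then pres_gen S R a else inv\<^bsub>pres_group S R\<^esub> (pres_gen S R a))"
    using Cons.hyps z pres_gen_inv[of a S R] by (simp add: pres_gen_def)
  ultimately show ?case using Cons.IH z by simp
qed (simp add: pres_class_one)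

lemma pres_group_induct [consumes 1, case_names one mult mult_inv]:
  assumes "A \<in> carrier (pres_group S R)" "P \<one>\<^bsub>pres_group S R\<^esub>"
    and "\<And>a A. a \<in> S \<Longrightarrow> A \<in> carrier (pres_group S R) \<Longrightarrow> P A \<Longrightarrow>
      P (pres_gen S R a \<otimes>\<^bsub>pres_group S R\<^esub> A)"
    and "\<And>a A. a \<in> S \<Longrightarrow> A \<in> carrier (pres_group S R) \<Longrightarrow> P A \<Longrightarrow>
      P (inv\<^bsub>pres_group S R\<^esub> (pres_gen S R a) \<otimes>\<^bsub>pres_group S R\<^esub> A)"
  shows "P A"
proof -
  have "P (word_val (pres_group S R) (pres_gen S R) w)" if "w \<in> lists (S \<times> UNIV)" for w
    using that
  proof (induction w)
    case (Cons z w)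
    then have "word_val (pres_group S R) (pres_gen S R) w \<in> carrier (pres_group S R)"
      by (intro group.word_val_closed[OF group_pres_group, of _ S]) (auto intro: pres_gen_carrier)
    with Cons assms(3,4) show ?case by (cases z) simp
  qed (use assms(2) in simp)
  then show ?thesis using assms(1) pres_class_conv_word_val by (metis pres_carrierE)
qed

text \<open>The setting of von Dyck's theorem. Evaluation is constant on classes by
  \<open>word_val_cong\<close>, so the extension can be computed from any word of a class.\<close>

locale pres_target = group G for G (structure) +
  fixes S :: "'g set" and R :: "('g word \<times> 'g word) set" and f :: "'g \<Rightarrow> 'a"
  assumes gens: "f \<in> S \<rightarrow> carrier G"
    and relators: "\<And>l r. (l, r) \<in> R \<Longrightarrow> l \<in> lists (S \<times> UNIV) \<Longrightarrow> r \<in> lists (S \<times> UNIV) \<Longrightarrow>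
      word_val G f l = word_val G f r"
begin

lemma word_val_cong:
  assumes "(v, w) \<in> pres_rel S R"
  shows "word_val G f v = word_val G f w"
  using assms
proof induction
  case (cancel u v a s)
  have l: "u \<in> lists (S \<times> UNIV)" "v \<in> lists (S \<times> UNIV)" "[(a, s), (a, \<not> s)] \<in> lists (S \<times> UNIV)"
    using cancel by simp_all
  have "word_val G f [(a, s), (a, \<not> s)] = \<one>"
    using gens cancel by (auto simp: Pi_iff)
  then show ?case
    using l word_val_closed[OF gens l(2)]
    by (simp add: word_val_append[OF gens] del: in_lists_conv_set append_Cons append_Nil)
next
  case (relator l r u v)
  then have "u \<in> lists (S \<times> UNIV)" "v \<in> lists (S \<times> UNIV)"
    "l \<in> lists (S \<times> UNIV)" "r \<in> lists (S \<times> UNIV)" by simp_all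
  with relators[OF relator(1)] show ?case
    by (simp add: word_val_append[OF gens] del: in_lists_conv_set)
qed simp_all

definition hom_ext :: "'g word set \<Rightarrow> 'a" where
  "hom_ext A = the_elem (word_val G f ` A)"

lemma hom_ext_class:
  assumes "w \<in> lists (S \<times> UNIV)"
  shows "hom_ext (pres_class S R w) = word_val G f w"
proof -
  have "word_val G f ` pres_class S R w = (\<lambda>_. word_val G f w) ` pres_class S R w"
    by (rule image_cong[OF HOL.refl]) (erule ImageE, drule word_val_cong, simp only: singleton_iff)
  also have "\<dots> = {word_val G f w}"
    by (rule image_constant[of w]) (rule ImageI[OF pres_rel.refl[OF assms] singletonI])
  finally have "word_val G f ` pres_class S R w = {word_val G f w}" .
  then show ?thesis by (simp add: hom_ext_def)
qed

lemma hom_ext_hom: "hom_ext \<in> hom (pres_group S R) G"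
proof (rule homI)
  fix A B assume "A \<in> carrier (pres_group S R)" "B \<in> carrier (pres_group S R)"
  then show "hom_ext (A \<otimes>\<^bsub>pres_group S R\<^esub> B) = hom_ext A \<otimes> hom_ext B"
    by (elim pres_carrierE) (simp add: pres_class_mult hom_ext_class word_val_append[OF gens])
next
  fix A assume "A \<in> carrier (pres_group S R)"
  then show "hom_ext A \<in> carrier G"
    by (elim pres_carrierE) (simp add: hom_ext_class word_val_closed[OF gens] del: in_lists_conv_set)
qed

lemma hom_ext_gen: "a \<in> S \<Longrightarrow> hom_ext (pres_gen S R a) = f a"
  using gens by (simp add: pres_gen_def hom_ext_class Pi_iff)

end

lemma pres_group_hom_eq:
  assumes "group G" "g \<in> hom (pres_group S R) G" "h \<in> hom (pres_group S R) G"
    and "\<And>a. a \<in> S \<Longrightarrow> g (pres_gen S R a) = h (pres_gen S R a)"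
    and "A \<in> carrier (pres_group S R)"
  shows "g A = h A"
proof -
  interpret P: group "pres_group S R" by (rule group_pres_group)
  interpret g: group_hom "pres_group S R" G g
    using assms by (simp add: group_hom_def group_hom_axioms_def group_pres_group)
  interpret h: group_hom "pres_group S R" G h
    using assms by (simp add: group_hom_def group_hom_axioms_def group_pres_group)
  show ?thesis using assms(5)
    by (induction rule: pres_group_induct) (simp_all add: assms(4) pres_gen_carrier)
qed


section \<open>The free group of rank two\<close>

lemma group_F2: "group F2"
  by (simp add: F2_def group_pres_group)

interpretation F2: group F2 by (rule group_F2)

lemma F2_x_carrier [simp]: "F2_x \<in> carrier F2" and F2_y_carrier [simp]: "F2_y \<in> carrier F2"
  by (simp_all add: F2_def F2_x_def F2_y_def pres_gen_carrier)

lemma F2_induct [consumes 1, case_names one x y inv_x inv_y]: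
  assumes "w \<in> carrier F2" "P \<one>\<^bsub>F2\<^esub>"
    and "\<And>w. w \<in> carrier F2 \<Longrightarrow> P w \<Longrightarrow> P (F2_x \<otimes>\<^bsub>F2\<^esub> w)"
    and "\<And>w. w \<in> carrier F2 \<Longrightarrow> P w \<Longrightarrow> P (F2_y \<otimes>\<^bsub>F2\<^esub> w)"
    and "\<And>w. w \<in> carrier F2 \<Longrightarrow> P w \<Longrightarrow> P (inv\<^bsub>F2\<^esub> F2_x \<otimes>\<^bsub>F2\<^esub> w)"
    and "\<And>w. w \<in> carrier F2 \<Longrightarrow> P w \<Longrightarrow> P (inv\<^bsub>F2\<^esub> F2_y \<otimes>\<^bsub>F2\<^esub> w)"
  shows "P w"
  using assms(1) unfolding F2_def
proof (induction rule: pres_group_induct)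
  case one then show ?case using assms(2) by (simp add: F2_def)
next
  case (mult a A)
  then show ?case using assms(3,4) by (cases a rule: gen2.exhaust) (simp_all add: F2_def F2_x_def F2_y_def)
next
  case (mult_inv a A)
  then show ?case using assms(5,6) by (cases a rule: gen2.exhaust) (simp_all add: F2_def F2_x_def F2_y_def)
qed

lemma F2_hom_eq:
  assumes "group G" "g \<in> hom F2 G" "h \<in> hom F2 G"
    and "g F2_x = h F2_x" "g F2_y = h F2_y" "w \<in> carrier F2"
  shows "g w = h w"
proof (rule pres_group_hom_eq[OF assms(1)])
  fix a show "g (pres_gen UNIV {} a) = h (pres_gen UNIV {} a)"
    using assms(4,5) by (cases a) (simp_all add: F2_x_def F2_y_def)
qed (use assms in \<open>simp_all add: F2_def\<close>)

context group
begin

lemma F2_pres_target: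
  assumes "a \<in> carrier G" "b \<in> carrier G"
  shows "pres_target G UNIV {} (case_gen2 a b)"
  using assms by unfold_locales (auto split: gen2.split)

lemma F2_hom_class:
  assumes "a \<in> carrier G" "b \<in> carrier G"
  shows "F2_hom G a b (pres_class UNIV {} w) = word_val G (case_gen2 a b) w"
proof -
  interpret pres_target G UNIV "{}" "case_gen2 a b" using assms by (rule F2_pres_target)
  show ?thesis using hom_ext_class[of w] pres_class_carrier[of w UNIV "{}"]
    by (simp add: F2_hom_def hom_ext_def F2_def)
qed

lemma F2_hom_hom:
  assumes "a \<in> carrier G" "b \<in> carrier G"
  shows "F2_hom G a b \<in> hom F2 G"
proof -
  interpret pres_target G UNIV "{}" "case_gen2 a b" using assms by (rule F2_pres_target)
  have "F2_hom G a b w = hom_ext w" if "w \<in> carrier F2" for w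
    using that by (simp add: F2_hom_def hom_ext_def)
  then show ?thesis using hom_ext_hom by (simp add: hom_def F2_def[symmetric] Pi_iff)
qed

lemma F2_hom_group_hom:
  assumes "a \<in> carrier G" "b \<in> carrier G"
  shows "group_hom F2 G (F2_hom G a b)"
  using F2_hom_hom[OF assms] by (simp add: group_hom_def group_hom_axioms_def group_F2 is_group)

lemma F2_hom_gen:
  assumes "a \<in> carrier G" "b \<in> carrier G"
  shows "F2_hom G a b F2_x = a" "F2_hom G a b F2_y = b"
  using assms by (simp_all add: F2_x_def F2_y_def pres_gen_def F2_hom_class)

end

section \<open>The Sanov subgroup\<close>

text \<open>Quadruples list the matrix entries row by row, which leaves products and inverses of
  explicit matrices to \<open>simp\<close>.\<close>

definition SL2Z :: "(int \<times> int \<times> int \<times> int) monoid" where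
  "SL2Z = \<lparr>carrier = {(a, b, c, d). a * d - b * c = 1},
     monoid.mult = (\<lambda>(a, b, c, d) (a', b', c', d').
       (a * a' + b * c', a * b' + b * d', c * a' + d * c', c * b' + d * d')),
     one = (1, 0, 0, 1)\<rparr>"

lemma SL2Z_carrier: "(a, b, c, d) \<in> carrier SL2Z \<longleftrightarrow> a * d - b * c = 1"
  by (simp add: SL2Z_def)

lemma SL2Z_mult: "(a, b, c, d) \<otimes>\<^bsub>SL2Z\<^esub> (a', b', c', d') =
    (a * a' + b * c', a * b' + b * d', c * a' + d * c', c * b' + d * d')"
  by (simp add: SL2Z_def)

lemma SL2Z_one: "\<one>\<^bsub>SL2Z\<^esub> = (1, 0, 0, 1)"
  by (simp add: SL2Z_def)

lemma SL2Z_mult_closed: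
  assumes "a * d - b * c = (1::int)" "a' * d' - b' * c' = 1"
  shows "(a * a' + b * c') * (c * b' + d * d') - (a * b' + b * d') * (c * a' + d * c') = 1"
proof -
  have "(a * a' + b * c') * (c * b' + d * d') - (a * b' + b * d') * (c * a' + d * c')
      = (a * d - b * c) * (a' * d' - b' * c')" by (simp add: algebra_simps)
  then show ?thesis using assms by simp
qed

lemma group_SL2Z: "group SL2Z"
proof (rule groupI)
  fix x assume "x \<in> carrier SL2Z"
  then obtain a b c d where x: "x = (a, b, c, d)" "a * d - b * c = 1"
    by (cases x) (auto simp: SL2Z_carrier)
  show "\<one>\<^bsub>SL2Z\<^esub> \<otimes>\<^bsub>SL2Z\<^esub> x = x" using x by (simp add: SL2Z_one SL2Z_mult)
  show "\<exists>y\<in>carrier SL2Z. y \<otimes>\<^bsub>SL2Z\<^esub> x = \<one>\<^bsub>SL2Z\<^esub>"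
    using x by (intro bexI[of _ "(d, - b, - c, a)"])
      (simp_all add: SL2Z_one SL2Z_mult SL2Z_carrier algebra_simps)
  fix y assume "y \<in> carrier SL2Z"
  then obtain a' b' c' d' where y: "y = (a', b', c', d')" "a' * d' - b' * c' = 1"
    by (cases y) (auto simp: SL2Z_carrier)
  show "x \<otimes>\<^bsub>SL2Z\<^esub> y \<in> carrier SL2Z"
    using SL2Z_mult_closed[OF x(2) y(2)] by (simp add: x y SL2Z_mult SL2Z_carrier)
  fix z assume "z \<in> carrier SL2Z"
  show "x \<otimes>\<^bsub>SL2Z\<^esub> y \<otimes>\<^bsub>SL2Z\<^esub> z = x \<otimes>\<^bsub>SL2Z\<^esub> (y \<otimes>\<^bsub>SL2Z\<^esub> z)"
    by (cases z) (simp add: x y SL2Z_mult algebra_simps)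
qed (simp add: SL2Z_one SL2Z_carrier)

interpretation SL2Z: group SL2Z by (rule group_SL2Z)

lemma SL2Z_inv:
  assumes "a * d - b * c = 1"
  shows "inv\<^bsub>SL2Z\<^esub> (a, b, c, d) = (d, - b, - c, a)"
  using assms by (intro SL2Z.inv_equality) (simp_all add: SL2Z_one SL2Z_mult SL2Z_carrier algebra_simps)

abbreviation sanov_x :: "int \<times> int \<times> int \<times> int" where "sanov_x \<equiv> (1, 2, 0, 1)"
abbreviation sanov_y :: "int \<times> int \<times> int \<times> int" where "sanov_y \<equiv> (1, 0, 2, 1)"

definition sanov :: "F2_elt \<Rightarrow> int \<times> int \<times> int \<times> int" where
  "sanov = F2_hom SL2Z sanov_x sanov_y"

lemma sanov_gens_carrier: "sanov_x \<in> carrier SL2Z" "sanov_y \<in> carrier SL2Z"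
  by (simp_all add: SL2Z_carrier)

interpretation sanov: group_hom F2 SL2Z sanov
  unfolding sanov_def by (intro SL2Z.F2_hom_group_hom sanov_gens_carrier)

lemma sanov_x: "sanov F2_x = sanov_x" and sanov_y: "sanov F2_y = sanov_y"
  unfolding sanov_def by (intro SL2Z.F2_hom_gen sanov_gens_carrier)+

section \<open>Reduced words and the ping-pong argument\<close>

fun reduced_word :: "'g word \<Rightarrow> bool" where
  "reduced_word (z # z' # w) \<longleftrightarrow> \<not> (fst z = fst z' \<and> snd z \<noteq> snd z') \<and> reduced_word (z' # w)"
| "reduced_word _ \<longleftrightarrow> True"

lemma reduced_word_tl: "reduced_word (z # w) \<Longrightarrow> reduced_word w"
  by (cases w) auto

text \<open>A letter put in front of a reduced word either leaves it reduced or cancels against its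
  first letter, and the tail that remains is again reduced.\<close>

lemma ex_reduced_word:
  "\<exists>w'. reduced_word w' \<and> (w, w') \<in> pres_rel UNIV R"
proof (induction w)
  case Nil
  have "([], []) \<in> pres_rel UNIV R" by (intro pres_rel.refl) simp
  then show ?case by (intro exI[of _ "[]"]) simp
next
  case (Cons z w)
  then obtain w' where w': "reduced_word w'" "(w, w') \<in> pres_rel UNIV R" by blast
  have zw: "(z # w, z # w') \<in> pres_rel UNIV R"
    using pres_rel_append_left[OF w'(2), of "[z]"] by simp
  show ?case
  proof (cases "reduced_word (z # w')")
    case True
    with zw show ?thesis by blast
  next
    case False
    obtain z' w'' where w'': "w' = z' # w''" "fst z = fst z'" "snd z \<noteq> snd z'"
      using False w'(1) by (cases w') auto
    have "([] @ [(fst z, snd z), (fst z, \<not> snd z)] @ w'', [] @ w'') \<in> pres_rel UNIV R"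
      by (intro pres_rel.cancel) auto
    then have "(z # w', w'') \<in> pres_rel UNIV R"
      using w'' by (cases z, cases z') auto
    moreover have "reduced_word w''"
      using w'(1) w'' reduced_word_tl by simp
    ultimately show ?thesis using zw pres_rel.trans by blast
  qed
qed

fun sanov_step :: "gen2 \<times> bool \<Rightarrow> int \<times> int \<Rightarrow> int \<times> int" where
  "sanov_step (GenX, s) (p, q) = (if s then p + 2 * q else p - 2 * q, q)"
| "sanov_step (GenY, s) (p, q) = (p, if s then q + 2 * p else q - 2 * p)"

text \<open>The ping-pong domains: four disjoint open double sectors bounded by the axes and the
  diagonals. The two along the horizontal axis belong to x and its inverse, the two along the
  vertical axis to y and its inverse.\<close>

fun sanov_region :: "gen2 \<times> bool \<Rightarrow> int \<times> int \<Rightarrow> bool" where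
  "sanov_region (GenX, s) (p, q) \<longleftrightarrow> \<bar>q\<bar> < \<bar>p\<bar> \<and> (if s then 0 < p * q else p * q < 0)"
| "sanov_region (GenY, s) (p, q) \<longleftrightarrow> \<bar>p\<bar> < \<bar>q\<bar> \<and> (if s then 0 < p * q else p * q < 0)"

text \<open>Every sector except that of the inverse letter is sent into the letter's own sector:
  twice the other coordinate either dominates, being larger, or reinforces, having the right sign.
  Once the signs are split this is linear arithmetic.\<close>

lemma sanov_step_region:
  assumes "sanov_region z' v" "\<not> (fst z = fst z' \<and> snd z \<noteq> snd z')"
  shows "sanov_region z (sanov_step z v)"
proof -
  obtain p q a s a' s' where d: "v = (p, q)" "z = (a, s)" "z' = (a', s')"
    by (metis prod.exhaust)
  show ?thesis
    using assms unfolding d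
    by (cases a; cases a'; cases s; cases s';
        simp add: zero_less_mult_iff mult_less_0_iff; linarith)
qed

text \<open>The coordinate vector that the last letter moves. It is thrown into the sector of that
  letter, which starts the ping-pong, while the vector itself lies on an axis and thus in no
  sector.\<close>

definition sanov_start :: "gen2 \<times> bool \<Rightarrow> int \<times> int" where
  "sanov_start z = (case fst z of GenX \<Rightarrow> (0, 1) | GenY \<Rightarrow> (1, 0))"

lemma sanov_ping_pong:
  "reduced_word (z # w) \<Longrightarrow>
    sanov_region z (foldr sanov_step (z # w) (sanov_start (last (z # w))))"
proof (induction w arbitrary: z)
  case Nil
  obtain a s where "z = (a, s)" by fastforce
  then show ?case by (cases a; cases s; simp add: sanov_start_def)
next
  case (Cons z' w)
  then show ?case using sanov_step_region[of z' _ z] by simp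
qed

fun SL2Z_apply :: "int \<times> int \<times> int \<times> int \<Rightarrow> int \<times> int \<Rightarrow> int \<times> int" where
  "SL2Z_apply (a, b, c, d) (p, q) = (a * p + b * q, c * p + d * q)"

lemma SL2Z_apply_mult: "SL2Z_apply (M \<otimes>\<^bsub>SL2Z\<^esub> M') v = SL2Z_apply M (SL2Z_apply M' v)"
  by (cases M; cases M'; cases v) (simp add: SL2Z_mult algebra_simps)

lemma SL2Z_apply_word_val:
  "SL2Z_apply (word_val SL2Z (case_gen2 sanov_x sanov_y) w) v = foldr sanov_step w v"
proof (induction w)
  case Nil then show ?case by (cases v) (simp add: SL2Z_one)
next
  case (Cons z w)
  obtain a s p q where d: "z = (a, s)" "foldr sanov_step w v = (p, q)" by fastforce
  show ?case
    using Cons unfolding d(1)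
    by (cases a; cases s) (simp_all add: SL2Z_apply_mult SL2Z_inv d(2))
qed

text \<open>A nonempty reduced word of trivial value would fix its starting vector, yet ping-pong
  places the result in a sector.\<close>

lemma sanov_inj: "inj_on sanov (carrier F2)"
proof (rule sanov.inj_on_one_iff[THEN iffD2], intro allI impI)
  fix u assume u: "u \<in> carrier F2" "sanov u = \<one>\<^bsub>SL2Z\<^esub>"
  then obtain w where w: "u = pres_class UNIV {} w"
    unfolding F2_def by (blast elim: pres_carrierE)
  obtain w' where w': "reduced_word w'" "(w, w') \<in> pres_rel UNIV {}"
    using ex_reduced_word by blast
  then have u': "u = pres_class UNIV {} w'" using w pres_class_eqI by metis
  have "word_val SL2Z (case_gen2 sanov_x sanov_y) w' = \<one>\<^bsub>SL2Z\<^esub>"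
    using u(2) unfolding u' sanov_def
    by (simp add: SL2Z.F2_hom_class sanov_gens_carrier)
  then have id: "foldr sanov_step w' v = v" for v
    by (cases v) (metis SL2Z_apply_word_val SL2Z_one SL2Z_apply.simps add_0 mult_1 mult_zero_left add_0_right)
  have "w' = []"
  proof (cases w')
    case (Cons z w'')
    then have "sanov_region z (sanov_start (last w'))"
      using sanov_ping_pong[of z w''] w'(1) id by simp
    moreover have "sanov_start (last w') = (0, 1) \<or> sanov_start (last w') = (1, 0)"
      by (simp add: sanov_start_def split: gen2.split)
    moreover have "\<not> sanov_region z (0, 1)" "\<not> sanov_region z (1, 0)"
      by (cases z; cases "fst z"; simp)+
    ultimately have False by metis
    then show ?thesis ..
  qed simp
  then show "u = \<one>\<^bsub>F2\<^esub>" using u' by (simp add: F2_def pres_class_one)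
qed


section \<open>The braid group on four strands\<close>

lemma group_B4: "group B4"
  by (simp add: B4_def group_pres_group)

interpretation B4: group B4 by (rule group_B4)

lemma pres_group_relation:
  assumes "(l, r) \<in> R" "l \<in> lists (S \<times> UNIV)" "r \<in> lists (S \<times> UNIV)"
  shows "word_val (pres_group S R) (pres_gen S R) l = word_val (pres_group S R) (pres_gen S R) r"
  using assms pres_rel.relator[of l r R "[]" "[]" S]
  by (auto simp: pres_class_conv_word_val[symmetric] simp del: in_lists_conv_set intro!: pres_class_eqI)

lemma atom_idx_eq: "atom_idx = {(2, 1), (3, 1), (4, 1), (3, 2), (4, 2), (4, 3)}"
proof -
  have "p \<in> atom_idx \<longleftrightarrow> p \<in> {(2, 1), (3, 1), (4, 1), (3, 2), (4, 2), (4, 3)}" for p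
    by (cases p) (simp add: atom_idx_def, presburger)
  then show ?thesis by blast
qed

lemma atom_carrier: "i \<in> atom_idx \<Longrightarrow> atom i \<in> carrier B4"
  by (simp add: atom_def B4_def pres_gen_carrier)

abbreviation "s1 \<equiv> atom (2, 1)"
abbreviation "s2 \<equiv> atom (3, 2)"
abbreviation "s3 \<equiv> atom (4, 3)"
abbreviation "a31 \<equiv> atom (3, 1)"
abbreviation "a42 \<equiv> atom (4, 2)"

lemma atoms_carrier [simp]:
  "s1 \<in> carrier B4" "s2 \<in> carrier B4" "s3 \<in> carrier B4" "a31 \<in> carrier B4" "a42 \<in> carrier B4"
  by (simp_all add: atom_carrier atom_idx_eq)

lemma BKL_triple:
  assumes "(t, s) \<in> atom_idx" "(s, r) \<in> atom_idx"
  shows "atom (t, s) \<otimes>\<^bsub>B4\<^esub> atom (s, r) = atom (t, r) \<otimes>\<^bsub>B4\<^esub> atom (t, s)"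
    and "atom (t, s) \<otimes>\<^bsub>B4\<^esub> atom (s, r) = atom (s, r) \<otimes>\<^bsub>B4\<^esub> atom (t, r)"
proof -
  interpret P: group "pres_group atom_idx BKL_rel" by (rule group_pres_group)
  have tr: "(t, r) \<in> atom_idx" using assms by (auto simp: atom_idx_def)
  note c = atom_carrier[OF assms(1)] atom_carrier[OF assms(2)] atom_carrier[OF tr]
  have 1: "([((t, s), True), ((s, r), True)], [((t, r), True), ((t, s), True)]) \<in> BKL_rel"
    and 2: "([((t, s), True), ((s, r), True)], [((s, r), True), ((t, r), True)]) \<in> BKL_rel"
    using assms unfolding BKL_rel_def by blast+
  show "atom (t, s) \<otimes>\<^bsub>B4\<^esub> atom (s, r) = atom (t, r) \<otimes>\<^bsub>B4\<^esub> atom (t, s)"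
    using pres_group_relation[OF 1, of atom_idx] assms tr c by (simp add: atom_def B4_def P.r_one)
  show "atom (t, s) \<otimes>\<^bsub>B4\<^esub> atom (s, r) = atom (s, r) \<otimes>\<^bsub>B4\<^esub> atom (t, r)"
    using pres_group_relation[OF 2, of atom_idx] assms tr c by (simp add: atom_def B4_def P.r_one)
qed

lemma s1_s3_commute: "s1 \<otimes>\<^bsub>B4\<^esub> s3 = s3 \<otimes>\<^bsub>B4\<^esub> s1"
proof -
  interpret P: group "pres_group atom_idx BKL_rel" by (rule group_pres_group)
  have i: "(2, 1) \<in> atom_idx" "(4, 3) \<in> atom_idx" by (auto simp: atom_idx_eq)
  have "([((2, 1), True), ((4, 3), True)], [((4, 3), True), ((2, 1), True)]) \<in> BKL_rel"
    unfolding BKL_rel_def using i by fastforce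
  from pres_group_relation[OF this, of atom_idx] show ?thesis
    using i atom_carrier[OF i(1)] atom_carrier[OF i(2)] by (simp add: atom_def B4_def P.r_one)
qed

lemma s2_s1: "s2 \<otimes>\<^bsub>B4\<^esub> s1 = s1 \<otimes>\<^bsub>B4\<^esub> a31" "s2 \<otimes>\<^bsub>B4\<^esub> s1 = a31 \<otimes>\<^bsub>B4\<^esub> s2"
  by (intro BKL_triple; simp add: atom_idx_eq)+

lemma s3_s2: "s3 \<otimes>\<^bsub>B4\<^esub> s2 = a42 \<otimes>\<^bsub>B4\<^esub> s3" "s3 \<otimes>\<^bsub>B4\<^esub> s2 = s2 \<otimes>\<^bsub>B4\<^esub> a42"
  by (intro BKL_triple; simp add: atom_idx_eq)+

lemma s1_s2_braid: "s1 \<otimes>\<^bsub>B4\<^esub> s2 \<otimes>\<^bsub>B4\<^esub> s1 = s2 \<otimes>\<^bsub>B4\<^esub> s1 \<otimes>\<^bsub>B4\<^esub> s2"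
  by (metis B4.m_assoc atoms_carrier s2_s1)

lemma s2_s3_braid: "s2 \<otimes>\<^bsub>B4\<^esub> s3 \<otimes>\<^bsub>B4\<^esub> s2 = s3 \<otimes>\<^bsub>B4\<^esub> s2 \<otimes>\<^bsub>B4\<^esub> s3"
  by (metis B4.m_assoc atoms_carrier s3_s2)

lemma delta_carrier [simp]: "delta_B \<in> carrier B4"
  by (simp add: delta_B_def)

text \<open>Two factorizations with the same last atom. They yield the two triangles that meet along
  an edge of type \<open>a31\<close>, that is, a lozenge.\<close>

lemma delta_factor: "s1 \<otimes>\<^bsub>B4\<^esub> s3 \<otimes>\<^bsub>B4\<^esub> a31 = delta_B" "s3 \<otimes>\<^bsub>B4\<^esub> s1 \<otimes>\<^bsub>B4\<^esub> a31 = delta_B"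
  unfolding delta_B_def by (simp_all add: s1_s3_commute B4.m_assoc s2_s1(1))

text \<open>For indices up to 4 the positivity condition leaves only the unlinked pairs 12, 34 and
  14, 23, and there are four descending triples. Checking the relations in a target group thus
  becomes a finite computation.\<close>

lemma BKL_rel_cases:
  assumes "(l, r) \<in> BKL_rel"
    and "\<And>i j. (i, j) \<in> {((2, 1), (4, 3)), ((4, 3), (2, 1)), ((4, 1), (3, 2)), ((3, 2), (4, 1))} \<Longrightarrow>
      P [(i, True), (j, True)] [(j, True), (i, True)]"
    and "\<And>t s r. (t, s, r) \<in> {(4, 3, 2), (4, 3, 1), (4, 2, 1), (3, 2, 1)} \<Longrightarrow>
      P [((t, s), True), ((s, r), True)] [((t, r), True), ((t, s), True)]"
    and "\<And>t s r. (t, s, r) \<in> {(4, 3, 2), (4, 3, 1), (4, 2, 1), (3, 2, 1)} \<Longrightarrow>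
      P [((t, s), True), ((s, r), True)] [((s, r), True), ((t, r), True)]"
  shows "P l r"
proof -
  consider (c) t s r' q where "(t, s) \<in> atom_idx" "(r', q) \<in> atom_idx"
      "(t - r') * (t - q) * (s - r') * (s - q) > 0"
      "l = [((t, s), True), ((r', q), True)]" "r = [((r', q), True), ((t, s), True)]"
    | (t) t s r' where "(t, s) \<in> atom_idx" "(s, r') \<in> atom_idx"
      "l = [((t, s), True), ((s, r'), True)]"
      "r = [((t, r'), True), ((t, s), True)] \<or> r = [((s, r'), True), ((t, r'), True)]"
  proof -
    have "(\<exists>t s r' q. (l, r) = ([((t, s), True), ((r', q), True)], [((r', q), True), ((t, s), True)]) \<and>
          (t, s) \<in> atom_idx \<and> (r', q) \<in> atom_idx \<and> (t - r') * (t - q) * (s - r') * (s - q) > 0) \<or>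
        (\<exists>t s r'. (l, r) = ([((t, s), True), ((s, r'), True)], [((t, r'), True), ((t, s), True)]) \<and>
          (t, s) \<in> atom_idx \<and> (s, r') \<in> atom_idx) \<or>
        (\<exists>t s r'. (l, r) = ([((t, s), True), ((s, r'), True)], [((s, r'), True), ((t, r'), True)]) \<and>
          (t, s) \<in> atom_idx \<and> (s, r') \<in> atom_idx)"
      using assms(1) unfolding BKL_rel_def Un_iff mem_Collect_eq by (simp only: disj_assoc)
    then show thesis
    proof (elim disjE exE conjE)
      fix t s r' q
      assume "(l, r) = ([((t, s), True), ((r', q), True)], [((r', q), True), ((t, s), True)])"
        "(t, s) \<in> atom_idx" "(r', q) \<in> atom_idx" "(t - r') * (t - q) * (s - r') * (s - q) > 0"
      then show thesis by (intro that(1)[of t s r' q]) simp_all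
    next
      fix t s r'
      assume "(l, r) = ([((t, s), True), ((s, r'), True)], [((t, r'), True), ((t, s), True)])"
        "(t, s) \<in> atom_idx" "(s, r') \<in> atom_idx"
      then show thesis by (intro that(2)[of t s r']) simp_all
    next
      fix t s r'
      assume "(l, r) = ([((t, s), True), ((s, r'), True)], [((s, r'), True), ((t, r'), True)])"
        "(t, s) \<in> atom_idx" "(s, r') \<in> atom_idx"
      then show thesis by (intro that(2)[of t s r']) simp_all
    qed
  qed
  then show ?thesis
  proof cases
    case c
    have "((t, s), (r', q)) \<in> {((2, 1), (4, 3)), ((4, 3), (2, 1)), ((4, 1), (3, 2)), ((3, 2), (4, 1))}"
      using c(1,2) c(3) unfolding atom_idx_eq by (simp only: insert_iff empty_iff prod.inject) (elim disjE conjE; simp)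
    then show ?thesis unfolding c(4,5) by (rule assms(2))
  next
    case t
    have "(t, s, r') \<in> {(4, 3, 2), (4, 3, 1), (4, 2, 1), (3, 2, 1)}"
      using t(1,2) by (auto simp: atom_idx_eq)
    then show ?thesis using assms(3,4) t(3,4) by metis
  qed
qed

text \<open>Conjugation on the abelianization Z^2 of the kernel identified with \<open>F2\<close>,
  in the basis of the classes of x and y, with matrices acting on columns; \<open>s3\<close>, for
  instance, fixes x and sends y to x^-1 y. The action factors through B3, so commuting atoms share a
  matrix.\<close>

definition mu_atom :: "int \<times> int \<Rightarrow> int \<times> int \<times> int \<times> int" where
  "mu_atom i =
     (if i = (2, 1) \<or> i = (4, 3) then (1, -1, 0, 1)
      else if i = (3, 2) \<or> i = (4, 1) then (0, -1, 1, 2)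
      else if i = (3, 1) then (1, 0, 1, 1) else (-1, -4, 1, 3))"

lemma mu_atom_values:
  "mu_atom (2, 1) = (1, -1, 0, 1)" "mu_atom (4, 3) = (1, -1, 0, 1)" "mu_atom (3, 2) = (0, -1, 1, 2)"
  "mu_atom (4, 1) = (0, -1, 1, 2)" "mu_atom (3, 1) = (1, 0, 1, 1)" "mu_atom (4, 2) = (-1, -4, 1, 3)"
  by (simp_all add: mu_atom_def)

lemma mu_target: "pres_target SL2Z atom_idx BKL_rel mu_atom"
proof
  show "mu_atom \<in> atom_idx \<rightarrow> carrier SL2Z"
    by (auto simp: mu_atom_def SL2Z_carrier)
  fix l r assume "(l, r) \<in> BKL_rel"
  then show "word_val SL2Z mu_atom l = word_val SL2Z mu_atom r"
  proof (rule BKL_rel_cases)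
    fix i j :: "int \<times> int" assume "(i, j) \<in> {((2, 1), (4, 3)), ((4, 3), (2, 1)), ((4, 1), (3, 2)), ((3, 2), (4, 1))}"
    then show "word_val SL2Z mu_atom [(i, True), (j, True)] = word_val SL2Z mu_atom [(j, True), (i, True)]"
      unfolding insert_iff empty_iff prod.inject simp_thms
      by (elim disjE conjE; hypsubst; simp add: mu_atom_values SL2Z_mult SL2Z_one)
  next
    fix t s r :: int assume "(t, s, r) \<in> {(4, 3, 2), (4, 3, 1), (4, 2, 1), (3, 2, 1)}"
    then show "word_val SL2Z mu_atom [((t, s), True), ((s, r), True)] =
          word_val SL2Z mu_atom [((t, r), True), ((t, s), True)]"
        "word_val SL2Z mu_atom [((t, s), True), ((s, r), True)] =
          word_val SL2Z mu_atom [((s, r), True), ((t, r), True)]"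
      unfolding insert_iff empty_iff prod.inject simp_thms
      by (elim disjE conjE; hypsubst; simp add: mu_atom_values SL2Z_mult SL2Z_one)+
  qed
qed

definition mu :: "B4_elt \<Rightarrow> int \<times> int \<times> int \<times> int" where
  "mu = pres_target.hom_ext SL2Z mu_atom"

interpretation mu: group_hom B4 SL2Z mu
proof -
  interpret pres_target SL2Z atom_idx BKL_rel mu_atom by (rule mu_target)
  show "group_hom B4 SL2Z mu"
    using hom_ext_hom by unfold_locales (simp add: mu_def B4_def)
qed

lemma mu_atom: "i \<in> atom_idx \<Longrightarrow> mu (atom i) = mu_atom i"
  unfolding mu_def atom_def by (rule pres_target.hom_ext_gen[OF mu_target])

lemma mu_values:
  "mu s1 = (1, -1, 0, 1)" "mu s2 = (0, -1, 1, 2)" "mu s3 = (1, -1, 0, 1)"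
  "mu delta_B = (-1, -2, 1, 1)"
proof -
  show v: "mu s1 = (1, -1, 0, 1)" "mu s2 = (0, -1, 1, 2)" "mu s3 = (1, -1, 0, 1)"
    by (simp_all add: mu_atom atom_idx_eq mu_atom_values)
  show "mu delta_B = (-1, -2, 1, 1)"
    unfolding delta_B_def by (simp add: v SL2Z_mult)
qed

section \<open>The permutation of the strands\<close>

definition perm_atom :: "int \<times> int \<Rightarrow> nat \<Rightarrow> nat" where
  "perm_atom i = Transposition.transpose (nat (fst i)) (nat (snd i))"

lemma perm_target: "pres_target (sym_group 4) atom_idx BKL_rel perm_atom"
proof -
  interpret group "sym_group 4" by (rule sym_group_is_group)
  show ?thesis
  proof
    show "perm_atom \<in> atom_idx \<rightarrow> carrier (sym_group 4)"
      by (auto simp: perm_atom_def sym_group_carrier atom_idx_eq intro!: permutes_swap_id)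
    fix l r assume "(l, r) \<in> BKL_rel"
    then show "word_val (sym_group 4) perm_atom l = word_val (sym_group 4) perm_atom r"
    proof (rule BKL_rel_cases)
      fix i j :: "int \<times> int" assume "(i, j) \<in> {((2, 1), (4, 3)), ((4, 3), (2, 1)), ((4, 1), (3, 2)), ((3, 2), (4, 1))}"
      then show "word_val (sym_group 4) perm_atom [(i, True), (j, True)] =
          word_val (sym_group 4) perm_atom [(j, True), (i, True)]"
        unfolding insert_iff empty_iff prod.inject simp_thms
        by (elim disjE conjE; hypsubst;
            simp add: perm_atom_def sym_group_mult sym_group_one fun_eq_iff Transposition.transpose_def)
    next
      fix t s r :: int assume "(t, s, r) \<in> {(4, 3, 2), (4, 3, 1), (4, 2, 1), (3, 2, 1)}"
      then show "word_val (sym_group 4) perm_atom [((t, s), True), ((s, r), True)] =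
            word_val (sym_group 4) perm_atom [((t, r), True), ((t, s), True)]"
          "word_val (sym_group 4) perm_atom [((t, s), True), ((s, r), True)] =
            word_val (sym_group 4) perm_atom [((s, r), True), ((t, r), True)]"
        unfolding insert_iff empty_iff prod.inject simp_thms
        by (elim disjE conjE; hypsubst;
            simp add: perm_atom_def sym_group_mult sym_group_one fun_eq_iff Transposition.transpose_def)+
    qed
  qed
qed

text \<open>Serves to separate cosets of \<open>Delta_B\<close>. The matrices of \<open>mu\<close>
  cannot do this, as \<open>s1\<close> and \<open>s3\<close> have the same one.\<close>

definition strand_perm :: "B4_elt \<Rightarrow> nat \<Rightarrow> nat" where
  "strand_perm = pres_target.hom_ext (sym_group 4) perm_atom"

interpretation strand_perm: group_hom B4 "sym_group 4" strand_perm
proof -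
  interpret pres_target "sym_group 4" atom_idx BKL_rel perm_atom by (rule perm_target)
  show "group_hom B4 (sym_group 4) strand_perm"
    using hom_ext_hom by unfold_locales (simp add: strand_perm_def B4_def)
qed

lemma strand_perm_atom: "i \<in> atom_idx \<Longrightarrow> strand_perm (atom i) = perm_atom i"
  unfolding strand_perm_def atom_def by (rule pres_target.hom_ext_gen[OF perm_target])

lemma strand_perm_mult:
  "g \<in> carrier B4 \<Longrightarrow> h \<in> carrier B4 \<Longrightarrow> strand_perm (g \<otimes>\<^bsub>B4\<^esub> h) n = strand_perm g (strand_perm h n)"
  by (simp add: sym_group_mult)

lemma strand_perm_s1: "strand_perm s1 = Transposition.transpose 2 1"
  and strand_perm_s2: "strand_perm s2 = Transposition.transpose 3 2"
  and strand_perm_s3: "strand_perm s3 = Transposition.transpose 4 3"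
  and strand_perm_a31: "strand_perm a31 = Transposition.transpose 3 1"
  and strand_perm_a42: "strand_perm a42 = Transposition.transpose 4 2"
  by (simp_all add: strand_perm_atom atom_idx_eq perm_atom_def)

section \<open>Automorphisms of the free group and braids\<close>

lemma (in group) conj_mult:
  assumes "g \<in> carrier G" "u \<in> carrier G" "v \<in> carrier G"
  shows "g \<otimes> (u \<otimes> v) \<otimes> inv g = (g \<otimes> u \<otimes> inv g) \<otimes> (g \<otimes> v \<otimes> inv g)"
proof -
  have "(g \<otimes> u \<otimes> inv g) \<otimes> (g \<otimes> v \<otimes> inv g) = g \<otimes> u \<otimes> (inv g \<otimes> g) \<otimes> v \<otimes> inv g"
    using assms by (simp only: m_assoc inv_closed m_closed)
  then show ?thesis using assms by (simp add: m_assoc)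
qed

lemma (in group) inner_aut_apply: "u \<in> carrier G \<Longrightarrow> inner_aut G w u = w \<otimes> u \<otimes> inv w"
  by (simp add: inner_aut_def)

lemma (in group) inner_aut_comp:
  assumes "v \<in> carrier G" "w \<in> carrier G" "u \<in> carrier G"
  shows "inner_aut G v (inner_aut G w u) = inner_aut G (v \<otimes> w) u"
  using assms by (simp add: inner_aut_def inv_mult_group m_assoc)

lemma (in group) inner_aut_auto:
  assumes "w \<in> carrier G"
  shows "inner_aut G w \<in> auto G"
proof -
  have hom: "inner_aut G w \<in> hom G G"
    using assms by (intro homI) (simp_all add: inner_aut_apply conj_mult)
  have inverse: "inner_aut G v (inner_aut G (inv v) u) = u" if "u \<in> carrier G" "v \<in> carrier G" for u v
    using that inner_aut_comp[of v "inv v" u] by (simp add: inner_aut_apply)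
  have "bij_betw (inner_aut G w) (carrier G) (carrier G)"
    using assms inverse[of _ w] inverse[of _ "inv w"]
    by (intro bij_betw_byWitness[where f' = "inner_aut G (inv w)"]) (auto simp: inner_aut_apply)
  then show ?thesis
    using hom by (simp add: auto_def Bij_def inner_aut_def)
qed

lemma AutoGroup_carrier: "carrier (AutoGroup G) = auto G"
  by (simp add: AutoGroup_def)

lemma auto_Bij: "\<phi> \<in> auto G \<Longrightarrow> \<phi> \<in> Bij (carrier G)"
  and auto_hom: "\<phi> \<in> auto G \<Longrightarrow> \<phi> \<in> hom G G"
  by (simp_all add: auto_def)

lemma auto_closed: "\<phi> \<in> auto G \<Longrightarrow> u \<in> carrier G \<Longrightarrow> \<phi> u \<in> carrier G"
  by (auto simp: auto_def hom_def)

lemma AutoGroup_mult: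
  assumes "\<phi> \<in> auto G" "\<psi> \<in> auto G"
  shows "\<phi> \<otimes>\<^bsub>AutoGroup G\<^esub> \<psi> = compose (carrier G) \<phi> \<psi>"
  using assms auto_Bij by (auto simp: AutoGroup_def BijGroup_def)

lemma AutoGroup_mult_apply:
  assumes "\<phi> \<in> auto G" "\<psi> \<in> auto G" "u \<in> carrier G"
  shows "(\<phi> \<otimes>\<^bsub>AutoGroup G\<^esub> \<psi>) u = \<phi> (\<psi> u)"
  using assms by (simp add: AutoGroup_mult compose_def)

lemma AutoGroup_one: "\<one>\<^bsub>AutoGroup G\<^esub> = (\<lambda>u\<in>carrier G. u)"
  by (simp add: AutoGroup_def BijGroup_def)

lemma auto_eqI:
  assumes "\<phi> \<in> auto G" "\<psi> \<in> auto G" "\<And>u. u \<in> carrier G \<Longrightarrow> \<phi> u = \<psi> u"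
  shows "\<phi> = \<psi>"
  by (rule extensionalityI[of _ "carrier G"]) (use assms in \<open>auto simp: auto_def Bij_def\<close>)

lemma (in group) inner_aut_mult:
  assumes "v \<in> carrier G" "w \<in> carrier G"
  shows "inner_aut G v \<otimes>\<^bsub>AutoGroup G\<^esub> inner_aut G w = inner_aut G (v \<otimes> w)"
proof -
  interpret A: group "AutoGroup G" by (rule AutoGroup)
  show ?thesis
    using assms A.m_closed inner_aut_auto
    by (intro auto_eqI[of _ G]) (auto simp: AutoGroup_mult_apply inner_aut_comp AutoGroup_carrier)
qed

lemma (in group) auto_inner_aut:
  assumes "\<phi> \<in> auto G" "w \<in> carrier G"
  shows "\<phi> \<otimes>\<^bsub>AutoGroup G\<^esub> inner_aut G w = inner_aut G (\<phi> w) \<otimes>\<^bsub>AutoGroup G\<^esub> \<phi>"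
proof -
  interpret A: group "AutoGroup G" by (rule AutoGroup)
  interpret group_hom G G \<phi>
    using assms by (simp add: group_hom_def group_hom_axioms_def is_group auto_hom)
  note auts = assms(1) inner_aut_auto[OF assms(2)] inner_aut_auto[OF auto_closed[OF assms]]
  show ?thesis
  proof (rule auto_eqI[of _ G])
    fix u assume "u \<in> carrier G"
    then show "(\<phi> \<otimes>\<^bsub>AutoGroup G\<^esub> inner_aut G w) u = (inner_aut G (\<phi> w) \<otimes>\<^bsub>AutoGroup G\<^esub> \<phi>) u"
      using assms auts auto_closed[of "inner_aut G w" G u]
      by (simp add: AutoGroup_mult_apply inner_aut_apply)
  qed (use A.m_closed auts in \<open>auto simp: AutoGroup_carrier\<close>)
qed

lemma (in group) AutoGroup_inv_apply:
  assumes "\<phi> \<in> auto G" "u \<in> carrier G"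
  shows "\<phi> ((inv\<^bsub>AutoGroup G\<^esub> \<phi>) u) = u" "(inv\<^bsub>AutoGroup G\<^esub> \<phi>) (\<phi> u) = u"
    "(inv\<^bsub>AutoGroup G\<^esub> \<phi>) u \<in> carrier G"
proof -
  interpret A: group "AutoGroup G" by (rule AutoGroup)
  have c: "\<phi> \<in> carrier (AutoGroup G)" using assms by (simp add: AutoGroup_carrier)
  have i: "inv\<^bsub>AutoGroup G\<^esub> \<phi> \<in> auto G" using A.inv_closed[OF c] by (simp add: AutoGroup_carrier)
  show "\<phi> ((inv\<^bsub>AutoGroup G\<^esub> \<phi>) u) = u"
    using AutoGroup_mult_apply[OF assms(1) i assms(2)] A.r_inv[OF c] assms by (simp add: AutoGroup_one)
  show "(inv\<^bsub>AutoGroup G\<^esub> \<phi>) (\<phi> u) = u"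
    using AutoGroup_mult_apply[OF i assms(1) assms(2)] A.l_inv[OF c] assms by (simp add: AutoGroup_one)
  show "(inv\<^bsub>AutoGroup G\<^esub> \<phi>) u \<in> carrier G"
    using auto_closed[OF i assms(2)] .
qed

interpretation AutF2: group AutF2 by (rule F2.AutoGroup)

lemma F2_hom_carrier:
  "a \<in> carrier F2 \<Longrightarrow> b \<in> carrier F2 \<Longrightarrow> w \<in> carrier F2 \<Longrightarrow> F2_hom F2 a b w \<in> carrier F2"
  using F2.F2_hom_hom[of a b] by (auto simp: hom_def)

text \<open>The elements \<open>a'\<close> and \<open>b'\<close> are the images of the generators
  under the inverse substitution. The four equations make the two substitutions cancel on
  generators, hence everywhere.\<close>

lemma F2_hom_auto:
  assumes c: "a \<in> carrier F2" "b \<in> carrier F2" "a' \<in> carrier F2" "b' \<in> carrier F2"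
    and "F2_hom F2 a b a' = F2_x" "F2_hom F2 a b b' = F2_y"
    and "F2_hom F2 a' b' a = F2_x" "F2_hom F2 a' b' b = F2_y"
  shows "F2_hom F2 a b \<in> auto F2"
proof -
  have id: "F2_hom F2 p q (F2_hom F2 p' q' w) = w"
    if "p \<in> carrier F2" "q \<in> carrier F2" "p' \<in> carrier F2" "q' \<in> carrier F2"
      "F2_hom F2 p q p' = F2_x" "F2_hom F2 p q q' = F2_y" "w \<in> carrier F2" for p q p' q' w
  proof (rule F2_hom_eq[OF group_F2 _ _ _ _ that(7), where h = "\<lambda>w. w" and
        g = "\<lambda>w. F2_hom F2 p q (F2_hom F2 p' q' w)"])
    show "(\<lambda>w. F2_hom F2 p q (F2_hom F2 p' q' w)) \<in> hom F2 F2"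
      using hom_compose[OF F2.F2_hom_hom[of p' q'] F2.F2_hom_hom[of p q]] that
      by (simp add: comp_def)
  qed (use that in \<open>simp_all add: F2.F2_hom_gen hom_def\<close>)
  have "bij_betw (F2_hom F2 a b) (carrier F2) (carrier F2)"
    using assms id F2_hom_carrier
    by (intro bij_betw_byWitness[where f' = "F2_hom F2 a' b'"]) auto
  then show ?thesis
    using F2.F2_hom_hom[OF c(1,2)] by (simp add: auto_def Bij_def F2_hom_def)
qed

lemma F2_hom_mult:
  assumes "a \<in> carrier F2" "b \<in> carrier F2" "u \<in> carrier F2" "v \<in> carrier F2"
  shows "F2_hom F2 a b (u \<otimes>\<^bsub>F2\<^esub> v) = F2_hom F2 a b u \<otimes>\<^bsub>F2\<^esub> F2_hom F2 a b v"
  using F2.F2_hom_hom[OF assms(1,2)] assms(3,4) by (simp add: hom_def)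

lemma F2_hom_inv:
  assumes "a \<in> carrier F2" "b \<in> carrier F2" "u \<in> carrier F2"
  shows "F2_hom F2 a b (inv\<^bsub>F2\<^esub> u) = inv\<^bsub>F2\<^esub> (F2_hom F2 a b u)"
  using group_hom.hom_inv[OF F2.F2_hom_group_hom[OF assms(1,2)] assms(3)] .

lemma (in group) mult_inv_cancel:
  assumes "a \<in> carrier G" "b \<in> carrier G"
  shows "a \<otimes> (inv a \<otimes> b) = b" "inv a \<otimes> (a \<otimes> b) = b"
  using assms by (simp_all add: m_assoc[symmetric])

lemma alpha_auto: "alpha \<in> auto F2"
  unfolding alpha_def
  by (rule F2_hom_auto[where a' = F2_x and
        b' = "inv\<^bsub>F2\<^esub> F2_x \<otimes>\<^bsub>F2\<^esub> inv\<^bsub>F2\<^esub> F2_x \<otimes>\<^bsub>F2\<^esub> F2_y"])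
    (simp_all add: F2_hom_mult F2_hom_inv F2.F2_hom_gen F2.m_assoc F2.mult_inv_cancel)

lemma beta_auto: "beta \<in> auto F2"
  unfolding beta_def
  by (rule F2_hom_auto[where b' = F2_y and
        a' = "F2_x \<otimes>\<^bsub>F2\<^esub> inv\<^bsub>F2\<^esub> F2_y \<otimes>\<^bsub>F2\<^esub> inv\<^bsub>F2\<^esub> F2_y"])
    (simp_all add: F2_hom_mult F2_hom_inv F2.F2_hom_gen F2.m_assoc F2.mult_inv_cancel)

definition twist :: "F2_elt \<Rightarrow> F2_elt \<Rightarrow> F2_elt" where
  "twist = F2_hom AutF2 alpha beta"

interpretation twist: group_hom F2 AutF2 twist
  unfolding twist_def by (intro AutF2.F2_hom_group_hom) (simp_all add: AutoGroup_carrier alpha_auto beta_auto)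

declare twist.hom_inv [simp del]

lemma twist_x: "twist F2_x = alpha" and twist_y: "twist F2_y = beta"
  unfolding twist_def
  by (intro AutF2.F2_hom_gen; simp add: AutoGroup_carrier alpha_auto beta_auto)+

lemma twist_auto: "u \<in> carrier F2 \<Longrightarrow> twist u \<in> auto F2"
  using twist.hom_closed by (simp add: AutoGroup_carrier)

section \<open>Braids that realize the two twists\<close>

abbreviation "braid_x \<equiv> s1 \<otimes>\<^bsub>B4\<^esub> inv\<^bsub>B4\<^esub> s3"
abbreviation "braid_y \<equiv> s2 \<otimes>\<^bsub>B4\<^esub> s1 \<otimes>\<^bsub>B4\<^esub> inv\<^bsub>B4\<^esub> s3 \<otimes>\<^bsub>B4\<^esub> inv\<^bsub>B4\<^esub> s2"

interpretation F2_in_B4: group_hom F2 B4 F2_in_B4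
  unfolding F2_in_B4_def by (intro B4.F2_hom_group_hom) simp_all

lemma F2_in_B4_x: "F2_in_B4 F2_x = braid_x" and F2_in_B4_y: "F2_in_B4 F2_y = braid_y"
  unfolding F2_in_B4_def by (intro B4.F2_hom_gen; simp)+

text \<open>The braid relation solved for conjugates, ready for moving a letter across the inverse
  of its neighbour.\<close>

lemma (in group) braid_conj:
  assumes "a \<in> carrier G" "b \<in> carrier G" "a \<otimes> b \<otimes> a = b \<otimes> a \<otimes> b"
  shows "inv a \<otimes> b \<otimes> a = b \<otimes> a \<otimes> inv b" "a \<otimes> b \<otimes> inv a = inv b \<otimes> a \<otimes> b"
    "inv a \<otimes> inv b \<otimes> a = b \<otimes> inv a \<otimes> inv b"
proof -
  let ?A = "inv a" and ?B = "inv b"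
  have ba: "b \<otimes> a = a \<otimes> b \<otimes> a \<otimes> ?B" and ab: "a \<otimes> b = b \<otimes> a \<otimes> b \<otimes> ?A"
    using assms by (simp_all add: m_assoc) (metis assms(3) m_assoc m_closed r_inv r_one inv_closed)+
  show 1: "?A \<otimes> b \<otimes> a = b \<otimes> a \<otimes> ?B"
    using assms(1,2) arg_cong[OF ba, of "\<lambda>z. ?A \<otimes> z"] by (simp add: m_assoc mult_inv_cancel)
  show "a \<otimes> b \<otimes> ?A = ?B \<otimes> a \<otimes> b"
    using assms(1,2) arg_cong[OF ab, of "\<lambda>z. ?B \<otimes> z"] by (simp add: m_assoc mult_inv_cancel)
  show "?A \<otimes> ?B \<otimes> a = b \<otimes> ?A \<otimes> ?B"
    using assms(1,2) arg_cong[OF 1, of "\<lambda>z. inv z"] by (simp add: m_assoc inv_mult_group)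
qed

lemma (in group) commute_inv:
  assumes "a \<in> carrier G" "c \<in> carrier G" "a \<otimes> c = c \<otimes> a"
  shows "a \<otimes> inv c = inv c \<otimes> a"
  using assms by (metis inv_closed inv_solve_left inv_solve_right m_assoc m_closed)

text \<open>Together with \<open>s3_fixes_braid_x\<close> this identifies conjugation by the inverse
  of \<open>s3\<close> with the substitution that fixes x and sends y to xy. That is a square root
  of \<open>alpha\<close>, whence the exponent -2.\<close>

lemma s3_conj_braid_y: "inv\<^bsub>B4\<^esub> s3 \<otimes>\<^bsub>B4\<^esub> braid_y \<otimes>\<^bsub>B4\<^esub> s3 = braid_x \<otimes>\<^bsub>B4\<^esub> braid_y"
proof -
  let ?C = "inv\<^bsub>B4\<^esub> s3" and ?B = "inv\<^bsub>B4\<^esub> s2"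
  have "braid_x \<otimes>\<^bsub>B4\<^esub> braid_y = ?C \<otimes>\<^bsub>B4\<^esub> (s1 \<otimes>\<^bsub>B4\<^esub> s2 \<otimes>\<^bsub>B4\<^esub> s1) \<otimes>\<^bsub>B4\<^esub> ?C \<otimes>\<^bsub>B4\<^esub> ?B"
    by (simp add: B4.m_assoc B4.commute_inv s1_s3_commute)
  also have "\<dots> = ?C \<otimes>\<^bsub>B4\<^esub> s2 \<otimes>\<^bsub>B4\<^esub> s1 \<otimes>\<^bsub>B4\<^esub> (s2 \<otimes>\<^bsub>B4\<^esub> ?C \<otimes>\<^bsub>B4\<^esub> ?B)"
    by (simp only: s1_s2_braid) (simp add: B4.m_assoc)
  also have "s2 \<otimes>\<^bsub>B4\<^esub> ?C \<otimes>\<^bsub>B4\<^esub> ?B = ?C \<otimes>\<^bsub>B4\<^esub> ?B \<otimes>\<^bsub>B4\<^esub> s3"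
    by (simp add: B4.braid_conj(3) s2_s3_braid)
  finally show ?thesis by (simp add: B4.m_assoc)
qed

text \<open>The hypothesis says that \<open>b\<close> commutes with the conjugate of its inverse by
  \<open>x\<close>. For y = b x b^-1 it turns b y b^-1 into y x^-1 y, the formula wanted for
  \<open>s2\<close>.\<close>

lemma (in group) conj_conj_of_commutation:
  assumes "b \<in> carrier G" "x \<in> carrier G"
    and "b \<otimes> x \<otimes> inv b \<otimes> inv x = x \<otimes> inv b \<otimes> inv x \<otimes> b"
  shows "b \<otimes> (b \<otimes> x \<otimes> inv b) \<otimes> inv b =
    (b \<otimes> x \<otimes> inv b) \<otimes> inv x \<otimes> (b \<otimes> x \<otimes> inv b)"
proof -
  have "b \<otimes> x \<otimes> inv b = b \<otimes> x \<otimes> inv b \<otimes> inv x \<otimes> x"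
    using assms(1,2) by (simp add: m_assoc)
  also have "\<dots> = x \<otimes> inv b \<otimes> inv x \<otimes> b \<otimes> x"
    by (simp only: assms(3))
  finally have "b \<otimes> (b \<otimes> x \<otimes> inv b) \<otimes> inv b = b \<otimes> (x \<otimes> inv b \<otimes> inv x \<otimes> b \<otimes> x) \<otimes> inv b"
    by simp
  then show ?thesis using assms(1,2) by (simp add: m_assoc)
qed

lemma s2_conj_braid_y: "s2 \<otimes>\<^bsub>B4\<^esub> braid_y \<otimes>\<^bsub>B4\<^esub> inv\<^bsub>B4\<^esub> s2 =
  braid_y \<otimes>\<^bsub>B4\<^esub> inv\<^bsub>B4\<^esub> braid_x \<otimes>\<^bsub>B4\<^esub> braid_y"
proof -
  let ?A = "inv\<^bsub>B4\<^esub> s1" and ?C = "inv\<^bsub>B4\<^esub> s3" and ?B = "inv\<^bsub>B4\<^esub> s2"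
  have CBc: "?C \<otimes>\<^bsub>B4\<^esub> ?B \<otimes>\<^bsub>B4\<^esub> s3 = s2 \<otimes>\<^bsub>B4\<^esub> ?C \<otimes>\<^bsub>B4\<^esub> ?B"
    by (simp add: B4.braid_conj(3) s2_s3_braid)
  have BAb: "?B \<otimes>\<^bsub>B4\<^esub> ?A \<otimes>\<^bsub>B4\<^esub> s2 = s1 \<otimes>\<^bsub>B4\<^esub> ?B \<otimes>\<^bsub>B4\<^esub> ?A"
    by (simp add: B4.braid_conj(3) s1_s2_braid)
  \<comment> \<open>The chain shows that \<open>s2\<close> commutes with the conjugate of its
    inverse by \<open>braid_x\<close>, which is what \<open>conj_conj_of_commutation\<close> asks
    for.\<close>
  have "s2 \<otimes>\<^bsub>B4\<^esub> braid_x \<otimes>\<^bsub>B4\<^esub> ?B \<otimes>\<^bsub>B4\<^esub> inv\<^bsub>B4\<^esub> braid_x =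
      s2 \<otimes>\<^bsub>B4\<^esub> s1 \<otimes>\<^bsub>B4\<^esub> (?C \<otimes>\<^bsub>B4\<^esub> ?B \<otimes>\<^bsub>B4\<^esub> s3) \<otimes>\<^bsub>B4\<^esub> ?A"
    by (simp add: B4.m_assoc B4.inv_mult_group)
  also have "\<dots> = (s2 \<otimes>\<^bsub>B4\<^esub> s1 \<otimes>\<^bsub>B4\<^esub> s2) \<otimes>\<^bsub>B4\<^esub> ?C \<otimes>\<^bsub>B4\<^esub> ?B \<otimes>\<^bsub>B4\<^esub> ?A"
    unfolding CBc by (simp add: B4.m_assoc)
  also have "\<dots> = s1 \<otimes>\<^bsub>B4\<^esub> s2 \<otimes>\<^bsub>B4\<^esub> (?C \<otimes>\<^bsub>B4\<^esub> s1) \<otimes>\<^bsub>B4\<^esub> ?B \<otimes>\<^bsub>B4\<^esub> ?A"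
    unfolding s1_s2_braid[symmetric] by (simp add: B4.m_assoc B4.commute_inv[symmetric] s1_s3_commute)
  also have "\<dots> = s1 \<otimes>\<^bsub>B4\<^esub> (s2 \<otimes>\<^bsub>B4\<^esub> ?C \<otimes>\<^bsub>B4\<^esub> ?B) \<otimes>\<^bsub>B4\<^esub> ?A \<otimes>\<^bsub>B4\<^esub> s2"
    using arg_cong[OF BAb, of "\<lambda>z. s1 \<otimes>\<^bsub>B4\<^esub> s2 \<otimes>\<^bsub>B4\<^esub> ?C \<otimes>\<^bsub>B4\<^esub> z"] by (simp add: B4.m_assoc)
  also have "\<dots> = braid_x \<otimes>\<^bsub>B4\<^esub> ?B \<otimes>\<^bsub>B4\<^esub> inv\<^bsub>B4\<^esub> braid_x \<otimes>\<^bsub>B4\<^esub> s2"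
    unfolding CBc[symmetric] by (simp add: B4.m_assoc B4.inv_mult_group)
  finally have "s2 \<otimes>\<^bsub>B4\<^esub> braid_x \<otimes>\<^bsub>B4\<^esub> ?B \<otimes>\<^bsub>B4\<^esub> inv\<^bsub>B4\<^esub> braid_x =
      braid_x \<otimes>\<^bsub>B4\<^esub> ?B \<otimes>\<^bsub>B4\<^esub> inv\<^bsub>B4\<^esub> braid_x \<otimes>\<^bsub>B4\<^esub> s2" .
  from B4.conj_conj_of_commutation[OF _ _ this] show ?thesis by (simp add: B4.m_assoc)
qed

abbreviation "braid_alpha \<equiv> inv\<^bsub>B4\<^esub> s3 \<otimes>\<^bsub>B4\<^esub> inv\<^bsub>B4\<^esub> s3"
abbreviation "braid_beta \<equiv> s2 \<otimes>\<^bsub>B4\<^esub> s3 \<otimes>\<^bsub>B4\<^esub> s3 \<otimes>\<^bsub>B4\<^esub> inv\<^bsub>B4\<^esub> s2"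

lemma s3_fixes_braid_x: "inner_aut B4 (inv\<^bsub>B4\<^esub> s3) braid_x = braid_x" "inner_aut B4 s3 braid_x = braid_x"
proof -
  have 1: "s3 \<otimes>\<^bsub>B4\<^esub> braid_x = s1"
    by (simp add: B4.m_assoc[symmetric] s1_s3_commute[symmetric]) (simp add: B4.m_assoc)
  show "inner_aut B4 s3 braid_x = braid_x"
    by (simp add: B4.inner_aut_apply 1)
  have "inv\<^bsub>B4\<^esub> s3 \<otimes>\<^bsub>B4\<^esub> s1 = braid_x"
    using B4.mult_inv_cancel(2)[of s3 braid_x] by (simp add: 1)
  then show "inner_aut B4 (inv\<^bsub>B4\<^esub> s3) braid_x = braid_x"
    by (simp add: B4.inner_aut_apply B4.m_assoc)
qed

lemma braid_alpha_conj:
  "inner_aut B4 braid_alpha braid_x = braid_x"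
  "inner_aut B4 braid_alpha braid_y = braid_x \<otimes>\<^bsub>B4\<^esub> braid_x \<otimes>\<^bsub>B4\<^esub> braid_y"
proof -
  let ?i = "inner_aut B4 (inv\<^bsub>B4\<^esub> s3)"
  have hom: "?i (u \<otimes>\<^bsub>B4\<^esub> v) = ?i u \<otimes>\<^bsub>B4\<^esub> ?i v" if "u \<in> carrier B4" "v \<in> carrier B4" for u v
    using auto_hom[OF B4.inner_aut_auto, of "inv\<^bsub>B4\<^esub> s3"] that by (simp add: hom_def)
  have x: "?i braid_x = braid_x" by (rule s3_fixes_braid_x)
  have y: "?i braid_y = braid_x \<otimes>\<^bsub>B4\<^esub> braid_y"
    using s3_conj_braid_y by (simp add: B4.inner_aut_apply)
  show "inner_aut B4 braid_alpha braid_x = braid_x"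
    using B4.inner_aut_comp[of "inv\<^bsub>B4\<^esub> s3" "inv\<^bsub>B4\<^esub> s3" braid_x] by (simp only: x) simp
  show "inner_aut B4 braid_alpha braid_y = braid_x \<otimes>\<^bsub>B4\<^esub> braid_x \<otimes>\<^bsub>B4\<^esub> braid_y"
    using B4.inner_aut_comp[of "inv\<^bsub>B4\<^esub> s3" "inv\<^bsub>B4\<^esub> s3" braid_y] hom[of braid_x braid_y]
    by (simp only: x y) (simp add: B4.m_assoc)
qed

text \<open>As \<open>s2\<close> carries x to y and \<open>s3\<close> fixes x, the conjugate of the
  square of \<open>s3\<close> by \<open>s2\<close> fixes y. Its value at x results from composing
  the four substitutions.\<close>

lemma braid_beta_conj:
  "inner_aut B4 braid_beta braid_x = braid_x \<otimes>\<^bsub>B4\<^esub> braid_y \<otimes>\<^bsub>B4\<^esub> braid_y"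
  "inner_aut B4 braid_beta braid_y = braid_y"
proof -
  let ?i = "inner_aut B4" and ?X = "inv\<^bsub>B4\<^esub> braid_x" and ?Y = "inv\<^bsub>B4\<^esub> braid_y"
  have i: "group_hom B4 B4 (?i g)" if "g \<in> carrier B4" for g
    using auto_hom[OF B4.inner_aut_auto[OF that]]
    by (simp add: group_hom_def group_hom_axioms_def group_B4)
  interpret i2: group_hom B4 B4 "?i s2" by (rule i) simp
  interpret i3: group_hom B4 B4 "?i s3" by (rule i) simp
  have c: "braid_x \<in> carrier B4" "braid_y \<in> carrier B4" by simp_all
  \<comment> \<open>Variables in place of the two braid words keep \<open>simp\<close> from
    expanding them; what follows is a computation with letters x and y.\<close>
  obtain x y where xy: "braid_x = x" "braid_y = y" by blast
  note c = c[unfolded xy]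
  have i_inverse: "?i (inv\<^bsub>B4\<^esub> g) (?i g u) = u" "?i g (?i (inv\<^bsub>B4\<^esub> g) u) = u"
    if "g \<in> carrier B4" "u \<in> carrier B4" for g u
    using that B4.inner_aut_comp[of "inv\<^bsub>B4\<^esub> g" g u] B4.inner_aut_comp[of g "inv\<^bsub>B4\<^esub> g" u]
    by (simp_all add: B4.inner_aut_apply)
  have s3x: "?i s3 x = x"
    unfolding xy[symmetric] by (rule s3_fixes_braid_x)
  have "?i (inv\<^bsub>B4\<^esub> s3) y = x \<otimes>\<^bsub>B4\<^esub> y"
    using s3_conj_braid_y unfolding xy[symmetric] by (simp add: B4.inner_aut_apply)
  then have "y = x \<otimes>\<^bsub>B4\<^esub> ?i s3 y"
    using i_inverse(2)[of s3 y] c s3x by simp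
  then have s3y: "?i s3 y = inv\<^bsub>B4\<^esub> x \<otimes>\<^bsub>B4\<^esub> y"
    using c by (metis B4.inv_solve_left i3.hom_closed)
  have s2x: "?i s2 x = y"
    unfolding xy[symmetric] by (simp add: B4.inner_aut_apply B4.m_assoc)
  have s2y: "?i s2 y = y \<otimes>\<^bsub>B4\<^esub> inv\<^bsub>B4\<^esub> x \<otimes>\<^bsub>B4\<^esub> y"
    using s2_conj_braid_y unfolding xy by (simp add: B4.inner_aut_apply c)
  \<comment> \<open>The preimage of x under \<open>s2\<close> is exhibited directly: x goes to y and
    y to y x^-1 y, so x y^-1 x goes to y (y^-1 x y^-1) y.\<close>
  have "?i s2 (x \<otimes>\<^bsub>B4\<^esub> inv\<^bsub>B4\<^esub> y \<otimes>\<^bsub>B4\<^esub> x) = x"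
    using c by (simp add: s2x s2y B4.m_assoc B4.inv_mult_group B4.mult_inv_cancel)
  then have s2x': "?i (inv\<^bsub>B4\<^esub> s2) x = x \<otimes>\<^bsub>B4\<^esub> inv\<^bsub>B4\<^esub> y \<otimes>\<^bsub>B4\<^esub> x"
    using i_inverse(1)[of s2 "x \<otimes>\<^bsub>B4\<^esub> inv\<^bsub>B4\<^esub> y \<otimes>\<^bsub>B4\<^esub> x"] c by simp
  have s2y': "?i (inv\<^bsub>B4\<^esub> s2) y = x"
    using i_inverse(1)[of s2 x] c s2x by simp
  have beta: "?i braid_beta u = ?i s2 (?i s3 (?i s3 (?i (inv\<^bsub>B4\<^esub> s2) u)))" if "u \<in> carrier B4" for u
    using that by (simp add: B4.inner_aut_comp B4.m_assoc)
  show "?i braid_beta braid_x = braid_x \<otimes>\<^bsub>B4\<^esub> braid_y \<otimes>\<^bsub>B4\<^esub> braid_y"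
    unfolding xy using c
    by (subst beta) (simp_all add: s2x' s3x s3y s2x s2y B4.m_assoc B4.inv_mult_group B4.mult_inv_cancel)
  show "?i braid_beta braid_y = braid_y"
    unfolding xy using c by (simp add: beta s2y' s3x s2x)
qed

lemma Aut_corrI:
  assumes "\<phi> \<in> auto F2" "b \<in> carrier B4"
    and "inner_aut B4 b braid_x = F2_in_B4 (\<phi> F2_x)" "inner_aut B4 b braid_y = F2_in_B4 (\<phi> F2_y)"
  shows "Aut_corr \<phi> (inner_aut B4 b)"
proof -
  have "inner_aut B4 b (F2_in_B4 w) = F2_in_B4 (\<phi> w)" if "w \<in> carrier F2" for w
  proof (rule F2_hom_eq[OF group_B4 _ _ _ _ that, where g = "\<lambda>w. inner_aut B4 b (F2_in_B4 w)"
        and h = "\<lambda>w. F2_in_B4 (\<phi> w)"])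
    show "(\<lambda>w. inner_aut B4 b (F2_in_B4 w)) \<in> hom F2 B4"
      using hom_compose[OF F2_in_B4.homh auto_hom[OF B4.inner_aut_auto[OF assms(2)]]]
      by (simp add: comp_def)
    show "(\<lambda>w. F2_in_B4 (\<phi> w)) \<in> hom F2 B4"
      using hom_compose[OF auto_hom[OF assms(1)] F2_in_B4.homh] by (simp add: comp_def)
  qed (use assms in \<open>simp_all add: F2_in_B4_x F2_in_B4_y\<close>)
  then show ?thesis
    using assms(1,2) B4.inner_aut_auto by (simp add: Aut_corr_def)
qed

lemma Aut_corr_alpha: "Aut_corr alpha (inner_aut B4 braid_alpha)"
  by (rule Aut_corrI[OF alpha_auto])
    (simp_all add: braid_alpha_conj alpha_def F2.F2_hom_gen F2_in_B4_x F2_in_B4_y)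

lemma Aut_corr_beta: "Aut_corr beta (inner_aut B4 braid_beta)"
  by (rule Aut_corrI[OF beta_auto])
    (simp_all add: braid_beta_conj beta_def F2.F2_hom_gen F2_in_B4_x F2_in_B4_y)

lemma Aut_corr_inner:
  assumes "w \<in> carrier F2"
  shows "Aut_corr (inner_aut F2 w) (inner_aut B4 (F2_in_B4 w))"
  using assms by (intro Aut_corrI[OF F2.inner_aut_auto[OF assms]])
    (simp_all add: F2.inner_aut_apply F2_in_B4_x F2_in_B4_y B4.inner_aut_apply)

lemma Aut_corr_mult:
  assumes "Aut_corr \<phi> (inner_aut B4 b)" "Aut_corr \<psi> (inner_aut B4 c)"
    and "b \<in> carrier B4" "c \<in> carrier B4"
  shows "Aut_corr (\<phi> \<otimes>\<^bsub>AutF2\<^esub> \<psi>) (inner_aut B4 (b \<otimes>\<^bsub>B4\<^esub> c))"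
proof -
  have auts: "\<phi> \<in> auto F2" "\<psi> \<in> auto F2" using assms by (simp_all add: Aut_corr_def)
  then have "\<phi> \<otimes>\<^bsub>AutF2\<^esub> \<psi> \<in> auto F2"
    using AutF2.m_closed[of \<phi> \<psi>] by (simp add: AutoGroup_carrier)
  then show ?thesis
    using assms auts B4.inner_aut_auto
    by (simp add: Aut_corr_def AutoGroup_mult_apply B4.inner_aut_comp[symmetric] auto_closed)
qed

lemma Aut_corr_inv:
  assumes "Aut_corr \<phi> (inner_aut B4 b)" "b \<in> carrier B4"
  shows "Aut_corr (inv\<^bsub>AutF2\<^esub> \<phi>) (inner_aut B4 (inv\<^bsub>B4\<^esub> b))"
proof -
  have aut: "\<phi> \<in> auto F2" using assms by (simp add: Aut_corr_def)
  then have "inv\<^bsub>AutF2\<^esub> \<phi> \<in> auto F2"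
    using AutF2.inv_closed[of \<phi>] by (simp add: AutoGroup_carrier)
  moreover have "inner_aut B4 (inv\<^bsub>B4\<^esub> b) (F2_in_B4 w) = F2_in_B4 ((inv\<^bsub>AutF2\<^esub> \<phi>) w)"
    if w: "w \<in> carrier F2" for w
  proof -
    let ?w = "(inv\<^bsub>AutF2\<^esub> \<phi>) w"
    have "F2_in_B4 w = inner_aut B4 b (F2_in_B4 ?w)"
      using F2.AutoGroup_inv_apply[OF aut w] assms(1) by (simp add: Aut_corr_def)
    then show ?thesis
      using B4.inner_aut_comp[of "inv\<^bsub>B4\<^esub> b" b "F2_in_B4 ?w"] assms(2)
        F2.AutoGroup_inv_apply(3)[OF aut w]
      by (simp add: B4.inner_aut_apply)
  qed
  ultimately show ?thesis
    using assms(2) B4.inner_aut_auto by (simp add: Aut_corr_def)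
qed

definition twist_braid :: "F2_elt \<Rightarrow> B4_elt" where
  "twist_braid = F2_hom B4 braid_alpha braid_beta"

interpretation twist_braid: group_hom F2 B4 twist_braid
  unfolding twist_braid_def by (intro B4.F2_hom_group_hom) simp_all

lemma twist_braid_x: "twist_braid F2_x = braid_alpha"
  and twist_braid_y: "twist_braid F2_y = braid_beta"
  unfolding twist_braid_def by (intro B4.F2_hom_gen; simp)+

lemma Aut_corr_twist:
  "u \<in> carrier F2 \<Longrightarrow> Aut_corr (twist u) (inner_aut B4 (twist_braid u))"
proof (induction rule: F2_induct)
  case one
  have "Aut_corr (inner_aut F2 \<one>\<^bsub>F2\<^esub>) (inner_aut B4 \<one>\<^bsub>B4\<^esub>)"
    using Aut_corr_inner[of "\<one>\<^bsub>F2\<^esub>"] by simp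
  moreover have "inner_aut F2 \<one>\<^bsub>F2\<^esub> = \<one>\<^bsub>AutF2\<^esub>"
    by (auto simp: inner_aut_def AutoGroup_one fun_eq_iff)
  ultimately show ?case by simp
next
  case (x w)
  from Aut_corr_mult[OF Aut_corr_alpha x(2)] show ?case
    using x(1) by (simp add: twist_x twist_braid_x twist.hom_inv)
next
  case (y w)
  from Aut_corr_mult[OF Aut_corr_beta y(2)] show ?case
    using y(1) by (simp add: twist_y twist_braid_y twist.hom_inv)
next
  case (inv_x w)
  from Aut_corr_mult[OF Aut_corr_inv[OF Aut_corr_alpha] inv_x(2)] show ?case
    using inv_x(1) by (simp add: twist_x twist_braid_x twist.hom_inv)
next
  case (inv_y w)
  from Aut_corr_mult[OF Aut_corr_inv[OF Aut_corr_beta] inv_y(2)] show ?case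
    using inv_y(1) by (simp add: twist_y twist_braid_y twist.hom_inv)
qed

text \<open>Inner automorphisms of a group act trivially on its abelianization. Concretely, the
  matrices of \<open>s1\<close> and \<open>s3\<close> cancel in both generators.\<close>

lemma mu_F2_in_B4: "w \<in> carrier F2 \<Longrightarrow> mu (F2_in_B4 w) = \<one>\<^bsub>SL2Z\<^esub>"
  by (induction rule: F2_induct)
    (simp_all add: F2_in_B4_x F2_in_B4_y mu_values SL2Z_mult SL2Z_inv SL2Z_one)

text \<open>Both sides describe how \<open>twist u\<close> acts on the abelianization of
  \<open>F2\<close>, so it suffices to compare the generators. With \<open>sanov_inj\<close>, the
  twist part \<open>u\<close> can be recovered from the braid \<open>sd_braid w u\<close>.\<close>

lemma mu_twist_braid:
  assumes "u \<in> carrier F2"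
  shows "mu (twist_braid u) = sanov u"
proof (rule F2_hom_eq[OF group_SL2Z _ sanov.homh _ _ assms, where g = "\<lambda>u. mu (twist_braid u)"])
  show "(\<lambda>u. mu (twist_braid u)) \<in> hom F2 SL2Z"
    using hom_compose[OF twist_braid.homh mu.homh] by (simp add: comp_def)
qed (simp_all add: twist_braid_x twist_braid_y mu_values SL2Z_mult SL2Z_inv sanov_x sanov_y)


subsection \<open>Semidirect products of inner automorphisms and twists\<close>

definition sd :: "F2_elt \<Rightarrow> F2_elt \<Rightarrow> F2_elt \<Rightarrow> F2_elt" where
  "sd w u = inner_aut F2 w \<otimes>\<^bsub>AutF2\<^esub> twist u"

lemma sd_carrier: "w \<in> carrier F2 \<Longrightarrow> u \<in> carrier F2 \<Longrightarrow> sd w u \<in> carrier AutF2"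
  unfolding sd_def by (intro AutF2.m_closed) (simp_all add: AutoGroup_carrier F2.inner_aut_auto twist_auto)

lemma sd_mult:
  assumes "w \<in> carrier F2" "u \<in> carrier F2" "w' \<in> carrier F2" "u' \<in> carrier F2"
  shows "sd w u \<otimes>\<^bsub>AutF2\<^esub> sd w' u' = sd (w \<otimes>\<^bsub>F2\<^esub> twist u w') (u \<otimes>\<^bsub>F2\<^esub> u')"
proof -
  have c: "inner_aut F2 w \<in> carrier AutF2" "inner_aut F2 w' \<in> carrier AutF2"
    "inner_aut F2 (twist u w') \<in> carrier AutF2" "twist u w' \<in> carrier F2"
    using assms by (simp_all add: AutoGroup_carrier F2.inner_aut_auto auto_closed twist_auto)
  have "sd w u \<otimes>\<^bsub>AutF2\<^esub> sd w' u' =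
      inner_aut F2 w \<otimes>\<^bsub>AutF2\<^esub> (twist u \<otimes>\<^bsub>AutF2\<^esub> inner_aut F2 w') \<otimes>\<^bsub>AutF2\<^esub> twist u'"
    using assms c by (simp add: sd_def AutF2.m_assoc)
  also have "twist u \<otimes>\<^bsub>AutF2\<^esub> inner_aut F2 w' = inner_aut F2 (twist u w') \<otimes>\<^bsub>AutF2\<^esub> twist u"
    using assms by (intro F2.auto_inner_aut twist_auto)
  finally show ?thesis
    using assms c by (simp add: sd_def AutF2.m_assoc F2.inner_aut_mult[symmetric])
qed

lemma sd_inv:
  assumes "w \<in> carrier F2" "u \<in> carrier F2"
  shows "inv\<^bsub>AutF2\<^esub> (sd w u) = sd (twist (inv\<^bsub>F2\<^esub> u) (inv\<^bsub>F2\<^esub> w)) (inv\<^bsub>F2\<^esub> u)"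
proof (rule AutF2.inv_equality)
  have c: "twist (inv\<^bsub>F2\<^esub> u) v \<in> carrier F2" if "v \<in> carrier F2" for v
    using assms that by (simp add: auto_closed[OF twist_auto])
  interpret t: group_hom F2 F2 "twist (inv\<^bsub>F2\<^esub> u)"
    using assms auto_hom[OF twist_auto] by (simp add: group_hom_def group_hom_axioms_def group_F2)
  have "sd \<one>\<^bsub>F2\<^esub> \<one>\<^bsub>F2\<^esub> = \<one>\<^bsub>AutF2\<^esub>"
  proof -
    have "inner_aut F2 \<one>\<^bsub>F2\<^esub> = \<one>\<^bsub>AutF2\<^esub>"
      by (auto simp: inner_aut_def AutoGroup_one fun_eq_iff)
    then show ?thesis by (simp add: sd_def)
  qed
  then show "sd (twist (inv\<^bsub>F2\<^esub> u) (inv\<^bsub>F2\<^esub> w)) (inv\<^bsub>F2\<^esub> u) \<otimes>\<^bsub>AutF2\<^esub> sd w u = \<one>\<^bsub>AutF2\<^esub>"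
    using assms c by (simp add: sd_mult t.hom_mult[symmetric] del: t.hom_inv t.hom_mult)
qed (use assms in \<open>simp_all add: sd_carrier auto_closed[OF twist_auto]\<close>)

lemma semidirect_Aut_eq: "semidirect_Aut A B = {sd w u | w u. w \<in> A \<and> u \<in> B}"
  unfolding semidirect_Aut_def sd_def twist_def[symmetric] by (auto simp: set_mult_def)

text \<open>Products and inverses apply twists to elements of \<open>A\<close>; these remain in
  \<open>A\<close> because it is characteristic.\<close>

lemma semidirect_Aut_subgroup:
  assumes A: "characteristic_subgroup A F2" and B: "subgroup B F2"
  shows "subgroup (semidirect_Aut A B) AutF2"
proof -
  interpret A: subgroup A F2 using A by (simp add: characteristic_subgroup_def)
  interpret B: subgroup B F2 by (rule B)
  have t: "twist u w \<in> A" if "u \<in> carrier F2" "w \<in> A" for u w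
    using A twist_auto[OF that(1)] that(2) by (auto simp: characteristic_subgroup_def)
  show ?thesis
  proof (rule AutF2.subgroupI)
    show "semidirect_Aut A B \<subseteq> carrier AutF2"
      unfolding semidirect_Aut_eq using A.subset B.subset by (auto intro!: sd_carrier)
    show "semidirect_Aut A B \<noteq> {}"
      unfolding semidirect_Aut_eq using A.one_closed B.one_closed by blast
  next
    fix g assume "g \<in> semidirect_Aut A B"
    then obtain w u where g: "g = sd w u" "w \<in> A" "u \<in> B" by (auto simp: semidirect_Aut_eq)
    then have "inv\<^bsub>AutF2\<^esub> g = sd (twist (inv\<^bsub>F2\<^esub> u) (inv\<^bsub>F2\<^esub> w)) (inv\<^bsub>F2\<^esub> u)"
      by (simp add: sd_inv)
    then show "inv\<^bsub>AutF2\<^esub> g \<in> semidirect_Aut A B"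
      using g t[of "inv\<^bsub>F2\<^esub> u" "inv\<^bsub>F2\<^esub> w"] unfolding semidirect_Aut_eq
      by (auto intro!: exI)
    fix h assume "h \<in> semidirect_Aut A B"
    then obtain w' u' where h: "h = sd w' u'" "w' \<in> A" "u' \<in> B" by (auto simp: semidirect_Aut_eq)
    have "g \<otimes>\<^bsub>AutF2\<^esub> h = sd (w \<otimes>\<^bsub>F2\<^esub> twist u w') (u \<otimes>\<^bsub>F2\<^esub> u')"
      using g h by (simp add: sd_mult)
    moreover have "w \<otimes>\<^bsub>F2\<^esub> twist u w' \<in> A" "u \<otimes>\<^bsub>F2\<^esub> u' \<in> B" using g h t by auto
    ultimately show "g \<otimes>\<^bsub>AutF2\<^esub> h \<in> semidirect_Aut A B"
      by (auto simp: semidirect_Aut_eq)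
  qed
qed

definition sd_braid :: "F2_elt \<Rightarrow> F2_elt \<Rightarrow> B4_elt" where
  "sd_braid w u = F2_in_B4 w \<otimes>\<^bsub>B4\<^esub> twist_braid u"

lemma sd_braid_carrier: "w \<in> carrier F2 \<Longrightarrow> u \<in> carrier F2 \<Longrightarrow> sd_braid w u \<in> carrier B4"
  by (simp add: sd_braid_def)

text \<open>Here an otherwise unspecified \<open>act\<close> becomes explicit: \<open>sd w u\<close>
  corresponds to conjugation by a braid, and for such automorphisms the action is
  prescribed.\<close>

lemma brady_action_sd:
  assumes "brady_action act" "w \<in> carrier F2" "u \<in> carrier F2" "v \<in> brady_verts"
  shows "act (sd w u) v = sd_braid w u <#\<^bsub>B4\<^esub> v"
proof -
  have "Aut_corr (sd w u) (inner_aut B4 (sd_braid w u))"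
    unfolding sd_def sd_braid_def using assms
    by (intro Aut_corr_mult Aut_corr_inner Aut_corr_twist) auto
  with assms sd_braid_carrier show ?thesis unfolding brady_action_def by blast
qed

lemma mu_sd_braid:
  "w \<in> carrier F2 \<Longrightarrow> u \<in> carrier F2 \<Longrightarrow> mu (sd_braid w u) = sanov u"
  by (simp add: sd_braid_def mu_F2_in_B4 mu_twist_braid)

section \<open>Homotopy of edge paths\<close>

abbreviation homotopic :: "'v poly_complex \<Rightarrow> 'v list \<Rightarrow> 'v list \<Rightarrow> bool" where
  "homotopic K \<equiv> equivclp (path_step K)"

lemma homotopic_sym: "homotopic K p q \<Longrightarrow> homotopic K q p"
  by (rule equivclp_sym)

lemma homotopic_trans [trans]: "homotopic K p q \<Longrightarrow> homotopic K q r \<Longrightarrow> homotopic K p r"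
  by (rule equivclp_trans)

lemma homotopic_map:
  assumes "homotopic K p q" "\<And>p q. path_step K p q \<Longrightarrow> path_step K' (f p) (f q)"
  shows "homotopic K' (f p) (f q)"
  using assms(1)
proof (induction rule: equivclp_induct)
  case (step y z)
  then have "homotopic K' (f y) (f z)"
    using assms(2) by (auto intro: equivclp_sym r_into_equivclp)
  with step.IH show ?case by (rule homotopic_trans)
qed simp

lemma path_step_context: "path_step K p q \<Longrightarrow> path_step K (u @ p @ w) (u @ q @ w)"
proof (induction rule: path_step.induct)
  case (backtrack a b p q)
  then show ?case using path_step.backtrack[of a b K "u @ p" "q @ w"] by simp
next
  case (face C c p q)
  then show ?case using path_step.face[of K C c "u @ p" "q @ w"] by simp
qed

lemma homotopic_context: "homotopic K p q \<Longrightarrow> homotopic K (u @ p @ w) (u @ q @ w)"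
  by (rule homotopic_map[where f = "\<lambda>p. u @ p @ w"]) (auto intro: path_step_context)

lemma homotopic_prefix: "homotopic K p q \<Longrightarrow> homotopic K (u @ p) (u @ q)"
  using homotopic_context[of K p q u "[]"] by simp

lemma homotopic_suffix: "homotopic K p q \<Longrightarrow> homotopic K (p @ w) (q @ w)"
  using homotopic_context[of K p q "[]" w] by simp

lemma homotopic_backtrack: "{a, b} \<in> edges K \<Longrightarrow> homotopic K (p @ a # b # a # q) (p @ a # q)"
  using path_step.backtrack[of a b K p q] by (auto intro: equivclp_sym r_into_equivclp)

lemma path_step_last: "path_step K p q \<Longrightarrow> p \<noteq> [] \<and> q \<noteq> [] \<and> last p = last q"
  by (induction rule: path_step.induct)
    (auto simp: boundary_cycle_def edge_path_def last_append split: if_splits)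

lemma homotopic_last:
  assumes "homotopic K p q" "p \<noteq> []"
  shows "q \<noteq> [] \<and> last q = last p"
  using assms by (induction rule: equivclp_induct) (auto dest: path_step_last)

lemma path_class_eq_iff: "path_class K p = path_class K q \<longleftrightarrow> homotopic K p q"
proof
  assume "path_class K p = path_class K q"
  then have "q \<in> path_class K p" by (simp add: path_class_def)
  then show "homotopic K p q" by (simp add: path_class_def)
next
  assume "homotopic K p q"
  then show "path_class K p = path_class K q"
    unfolding path_class_def by (auto intro: homotopic_trans homotopic_sym)
qed

lemma cover_proj_path_class:
  assumes "p \<noteq> []"
  shows "cover_proj (path_class K p) = last p"
proof -
  have "last ` path_class K p = (\<lambda>_. last p) ` path_class K p"
  proof (rule image_cong[OF HOL.refl])
    fix q assume "q \<in> path_class K p"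
    then have "homotopic K p q" by (simp add: path_class_def)
    from homotopic_last[OF this assms] show "last q = last p" ..
  qed
  also have "\<dots> = {last p}"
    by (rule image_constant[of p]) (simp add: path_class_def)
  finally have "last ` path_class K p = {last p}" .
  then show ?thesis by (simp add: cover_proj_def)
qed

text \<open>The boundary cycle is inserted at the start of the path through \<open>d\<close>; the
  excess then cancels by the backtracks d, a, d and c, d, c.\<close>

lemma homotopic_square:
  assumes "boundary_cycle K C [a, b, c, d, a]" "{d, a} \<in> edges K" "{c, d} \<in> edges K"
  shows "homotopic K [a, b, c] [a, d, c]"
proof -
  have "path_step K ([] @ [hd [a, b, c, d, a]] @ [d, c]) ([] @ [a, b, c, d, a] @ [d, c])"
    by (rule path_step.face[OF assms(1)])
  then have "homotopic K [a, d, c] ([a, b, c] @ d # a # d # [c])"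
    by (auto intro: r_into_equivclp)
  also have "homotopic K \<dots> ([a, b, c] @ d # [c])"
    by (rule homotopic_backtrack[OF assms(2)])
  also have "[a, b, c] @ d # [c] = [a, b] @ c # d # c # []" by simp
  also have "homotopic K \<dots> ([a, b] @ c # [])"
    by (rule homotopic_backtrack[OF assms(3)])
  finally show ?thesis by (simp add: homotopic_sym)
qed

text \<open>A boundary cycle has a fixed starting corner and direction. Rotation provides the same
  relation at the other corners without a further face.\<close>

lemma homotopic_square_rotate:
  assumes "homotopic K [a, b, c] [a, d, c]" "{b, a} \<in> edges K" "{d, c} \<in> edges K"
  shows "homotopic K [b, c, d] [b, a, d]"
proof -
  have "homotopic K [b, c, d] ([] @ b # a # b # [c, d])"
    using homotopic_backtrack[OF assms(2), of "[]" "[c, d]"] by (simp add: homotopic_sym)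
  also have "[] @ b # a # b # [c, d] = [b] @ [a, b, c] @ [d]" by simp
  also have "homotopic K \<dots> ([b] @ [a, d, c] @ [d])"
    by (rule homotopic_context[OF assms(1)])
  also have "[b] @ [a, d, c] @ [d] = [b, a] @ d # c # d # []" by simp
  also have "homotopic K \<dots> ([b, a] @ d # [])"
    by (rule homotopic_backtrack[OF assms(3)])
  finally show ?thesis by simp
qed

section \<open>Normal forms of walks in the square grid\<close>

definition int_ray :: "int \<Rightarrow> int list" where
  "int_ray i = map (\<lambda>k. sgn i * int k) [0..<Suc (nat \<bar>i\<bar>)]"

lemma int_ray_0: "int_ray 0 = [0]"
  by (simp add: int_ray_def)

lemma int_ray_Suc: "0 \<le> i \<Longrightarrow> int_ray (i + 1) = int_ray i @ [i + 1]"
  by (cases "i = 0") (simp_all add: int_ray_def nat_add_distrib)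

lemma int_ray_pred: "i \<le> 0 \<Longrightarrow> int_ray (i - 1) = int_ray i @ [i - 1]"
proof (cases "i = 0")
  case False
  moreover assume "i \<le> 0"
  ultimately have "nat \<bar>i - 1\<bar> = Suc (nat \<bar>i\<bar>)" "sgn (i - 1) = sgn i" "sgn i = -1" "int (nat \<bar>i\<bar>) = - i"
    by simp_all
  then show ?thesis by (simp add: int_ray_def)
qed (simp add: int_ray_def)

definition grid_adjacent :: "int \<times> int \<Rightarrow> int \<times> int \<Rightarrow> bool" where
  "grid_adjacent z w \<longleftrightarrow> \<bar>fst z - fst w\<bar> + \<bar>snd z - snd w\<bar> = 1"

text \<open>A normal form for walks from the origin: along the axis, then along the column. Vertical
  steps merely lengthen or shorten it, so squares are needed for horizontal steps only.\<close>

definition grid_path :: "int \<times> int \<Rightarrow> (int \<times> int) list" where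
  "grid_path z = map (\<lambda>a. (a, 0)) (int_ray (fst z)) @ map (\<lambda>b. (fst z, b)) (tl (int_ray (snd z)))"

lemma int_ray_nonempty: "int_ray i \<noteq> []"
  by (simp add: int_ray_def)

lemma grid_path_0: "grid_path (0, 0) = [(0, 0)]"
  by (simp add: grid_path_def int_ray_0)

lemma grid_path_vert:
  "0 \<le> j \<Longrightarrow> grid_path (i, j + 1) = grid_path (i, j) @ [(i, j + 1)]"
  "j \<le> 0 \<Longrightarrow> grid_path (i, j - 1) = grid_path (i, j) @ [(i, j - 1)]"
  by (simp_all add: grid_path_def int_ray_Suc int_ray_pred int_ray_nonempty)

lemma grid_path_horiz:
  "0 \<le> i \<Longrightarrow> grid_path (i + 1, 0) = grid_path (i, 0) @ [(i + 1, 0)]"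
  "i \<le> 0 \<Longrightarrow> grid_path (i - 1, 0) = grid_path (i, 0) @ [(i - 1, 0)]"
  by (simp_all add: grid_path_def int_ray_Suc int_ray_pred int_ray_0)

lemma grid_path_induct:
  assumes "P (0, 0) [(0, 0)]"
    and "\<And>z w p. P z p \<Longrightarrow> grid_adjacent z w \<Longrightarrow> P w (p @ [w])"
  shows "P z (grid_path z)"
proof -
  have h: "P (i, 0) (grid_path (i, 0))" for i
  proof (induction i rule: int_induct[where k = 0])
    case base then show ?case by (simp add: grid_path_0 assms(1))
  next
    case (step1 i)
    then show ?case using assms(2)[OF step1(2), of "(i + 1, 0)"]
      by (simp add: grid_path_horiz grid_adjacent_def)
  next
    case (step2 i)
    then show ?case using assms(2)[OF step2(2), of "(i - 1, 0)"]
      by (simp add: grid_path_horiz grid_adjacent_def)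
  qed
  have "P (i, j) (grid_path (i, j))" for i j
  proof (induction j rule: int_induct[where k = 0])
    case base then show ?case by (rule h)
  next
    case (step1 j)
    then show ?case using assms(2)[OF step1(2), of "(i, j + 1)"]
      by (simp add: grid_path_vert grid_adjacent_def)
  next
    case (step2 j)
    then show ?case using assms(2)[OF step2(2), of "(i, j - 1)"]
      by (simp add: grid_path_vert grid_adjacent_def)
  qed
  then show ?thesis by (cases z) simp
qed

lemma grid_path_props:
  "grid_path z \<noteq> [] \<and> hd (grid_path z) = (0, 0) \<and> last (grid_path z) = z \<and>
    successively grid_adjacent (grid_path z)"
  by (rule grid_path_induct[where P = "\<lambda>z p. p \<noteq> [] \<and> hd p = (0, 0) \<and> last p = z \<and> successively grid_adjacent p"])
    (auto simp: successively_append_iff)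

lemmas grid_path_nonempty = grid_path_props[THEN conjunct1]
  and grid_path_hd = grid_path_props[THEN conjunct2, THEN conjunct1]
  and grid_path_last = grid_path_props[THEN conjunct2, THEN conjunct2, THEN conjunct1]
  and grid_path_successively = grid_path_props[THEN conjunct2, THEN conjunct2, THEN conjunct2]

text \<open>A cellular image of the square grid in \<open>K\<close>, with one face for each square.
  The boundary of a square is required from one corner and in one direction; \<open>V_corner\<close>
  recovers the rest.\<close>

locale plane =
  fixes K :: "'v poly_complex" and V :: "int \<times> int \<Rightarrow> 'v"
  assumes V_verts: "V z \<in> verts K"
    and V_horiz: "{V (i, j), V (i + 1, j)} \<in> edges K"
    and V_vert: "{V (i, j), V (i, j + 1)} \<in> edges K"
    and V_square: "\<exists>C. boundary_cycle K C
      [V (i, j), V (i + 1, j), V (i + 1, j + 1), V (i, j + 1), V (i, j)]"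
begin

lemma V_edge: "grid_adjacent z w \<Longrightarrow> {V z, V w} \<in> edges K"
proof -
  assume "grid_adjacent z w"
  moreover obtain i j k l where zw: "z = (i, j)" "w = (k, l)" by fastforce
  ultimately have "\<bar>i - k\<bar> + \<bar>j - l\<bar> = 1" by (simp add: grid_adjacent_def)
  then consider "k = i + 1" "l = j" | "i = k + 1" "l = j" | "k = i" "l = j + 1" | "k = i" "j = l + 1"
    by arith
  then show ?thesis by cases (use V_horiz V_vert zw in \<open>auto simp: insert_commute\<close>)
qed

text \<open>The four sign patterns of a turn are the four rotations of a single square.\<close>

lemma V_corner:
  assumes "\<bar>i - i'\<bar> = 1" "\<bar>j - j'\<bar> = 1"
  shows "homotopic K [V (i, j), V (i, j'), V (i', j')] [V (i, j), V (i', j), V (i', j')]"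
proof -
  have sq: "homotopic K [V (i, j), V (i + 1, j), V (i + 1, j + 1)] [V (i, j), V (i, j + 1), V (i + 1, j + 1)]" for i j
  proof -
    obtain C where "boundary_cycle K C [V (i, j), V (i + 1, j), V (i + 1, j + 1), V (i, j + 1), V (i, j)]"
      using V_square by blast
    then show ?thesis by (rule homotopic_square) (auto simp: V_edge grid_adjacent_def)
  qed
  have sq2: "homotopic K [V (i + 1, j), V (i + 1, j + 1), V (i, j + 1)] [V (i + 1, j), V (i, j), V (i, j + 1)]" for i j
    by (rule homotopic_square_rotate[OF sq]) (auto simp: V_edge grid_adjacent_def)
  have sq3: "homotopic K [V (i + 1, j + 1), V (i, j + 1), V (i, j)] [V (i + 1, j + 1), V (i + 1, j), V (i, j)]" for i j
    by (rule homotopic_square_rotate[OF sq2]) (auto simp: V_edge grid_adjacent_def)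
  have sq4: "homotopic K [V (i, j + 1), V (i, j), V (i + 1, j)] [V (i, j + 1), V (i + 1, j + 1), V (i + 1, j)]" for i j
    by (rule homotopic_square_rotate[OF sq3]) (auto simp: V_edge grid_adjacent_def)
  have "i' = i + 1 \<or> i' = i - 1" "j' = j + 1 \<or> j' = j - 1" using assms by arith+
  then show ?thesis
    using sq[of i j] sq2[of "i - 1" j] sq3[of "i - 1" "j - 1"] sq4[of i "j - 1"]
    by (elim disjE) (simp_all add: homotopic_sym)
qed

definition V_path :: "int \<times> int \<Rightarrow> 'v list" where
  "V_path z = map V (grid_path z)"

lemma V_path_nonempty: "V_path z \<noteq> []"
  and V_path_last: "last (V_path z) = V z"
  and V_path_hd: "hd (V_path z) = V (0, 0)"
  by (simp_all add: V_path_def grid_path_nonempty grid_path_hd grid_path_last hd_map last_map)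

text \<open>Handles steps towards the origin along a normal form: they retrace its last
  edge.\<close>

lemma V_path_return:
  assumes "V_path w = V_path z @ [V w]" "grid_adjacent z w"
  shows "homotopic K (V_path w @ [V z]) (V_path z)"
proof -
  obtain p where p: "V_path z = p @ [V z]"
    using V_path_nonempty V_path_last append_butlast_last_id by metis
  show ?thesis
    unfolding assms(1) p using homotopic_backtrack[OF V_edge[OF assms(2)], of p "[]"] by simp
qed

lemma V_path_vert:
  assumes "\<bar>j - j'\<bar> = 1"
  shows "homotopic K (V_path (i, j) @ [V (i, j')]) (V_path (i, j'))"
proof -
  have adj: "grid_adjacent (i, j) (i, j')" "grid_adjacent (i, j') (i, j)"
    using assms by (simp_all add: grid_adjacent_def abs_minus_commute)
  consider "j' = j + 1" "0 \<le> j" | "j' = j - 1" "j \<le> 0" | "j = j' + 1" "0 \<le> j'" | "j = j' - 1" "j' \<le> 0"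
    using assms by arith
  then show ?thesis
  proof cases
    case 3 show ?thesis by (rule V_path_return[OF _ adj(2)]) (use 3 in \<open>simp add: V_path_def grid_path_vert\<close>)
  next
    case 4 show ?thesis by (rule V_path_return[OF _ adj(2)]) (use 4 in \<open>simp add: V_path_def grid_path_vert\<close>)
  qed (simp_all add: V_path_def grid_path_vert)
qed

lemma V_path_horiz0:
  assumes "\<bar>i - i'\<bar> = 1"
  shows "homotopic K (V_path (i, 0) @ [V (i', 0)]) (V_path (i', 0))"
proof -
  have adj: "grid_adjacent (i, 0) (i', 0)" "grid_adjacent (i', 0) (i, 0)"
    using assms by (simp_all add: grid_adjacent_def abs_minus_commute)
  consider "i' = i + 1" "0 \<le> i" | "i' = i - 1" "i \<le> 0" | "i = i' + 1" "0 \<le> i'" | "i = i' - 1" "i' \<le> 0"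
    using assms by arith
  then show ?thesis
  proof cases
    case 3 show ?thesis by (rule V_path_return[OF _ adj(2)]) (use 3 in \<open>simp add: V_path_def grid_path_horiz\<close>)
  next
    case 4 show ?thesis by (rule V_path_return[OF _ adj(2)]) (use 4 in \<open>simp add: V_path_def grid_path_horiz\<close>)
  qed (simp_all add: V_path_def grid_path_horiz)
qed

lemma V_path_horiz_step:
  assumes "\<bar>i - i'\<bar> = 1" "\<bar>j - j'\<bar> = 1"
    and "homotopic K (V_path (i, j) @ [V (i', j)]) (V_path (i', j))"
  shows "homotopic K (V_path (i, j') @ [V (i', j')]) (V_path (i', j'))"
proof -
  obtain p where p: "V_path (i, j) = p @ [V (i, j)]"
    using V_path_nonempty V_path_last append_butlast_last_id by metis
  have "homotopic K (V_path (i, j') @ [V (i', j')]) ((V_path (i, j) @ [V (i, j')]) @ [V (i', j')])"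
    by (rule homotopic_suffix[OF homotopic_sym[OF V_path_vert]]) (rule assms(2))
  also have "\<dots> = p @ [V (i, j), V (i, j'), V (i', j')]" by (simp add: p)
  also have "homotopic K \<dots> (p @ [V (i, j), V (i', j), V (i', j')])"
    by (rule homotopic_prefix[OF V_corner[OF assms(1,2)]])
  also have "\<dots> = (V_path (i, j) @ [V (i', j)]) @ [V (i', j')]" by (simp add: p)
  also have "homotopic K \<dots> (V_path (i', j) @ [V (i', j')])"
    by (rule homotopic_suffix[OF assms(3)])
  also have "homotopic K \<dots> (V_path (i', j'))"
    by (rule V_path_vert[OF assms(2)])
  finally show ?thesis .
qed

lemma V_path_horiz:
  assumes "\<bar>i - i'\<bar> = 1"
  shows "homotopic K (V_path (i, j) @ [V (i', j)]) (V_path (i', j))"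
proof (induction j rule: int_induct[where k = 0])
  case base show ?case by (rule V_path_horiz0[OF assms])
next
  case (step1 j) then show ?case by (intro V_path_horiz_step[OF assms _ step1(2)]) simp
next
  case (step2 j) then show ?case by (intro V_path_horiz_step[OF assms _ step2(2)]) simp
qed

lemma V_path_step:
  assumes "grid_adjacent z w"
  shows "homotopic K (V_path z @ [V w]) (V_path w)"
proof -
  obtain i j k l where zw: "z = (i, j)" "w = (k, l)" by fastforce
  have "\<bar>i - k\<bar> + \<bar>j - l\<bar> = 1" using assms by (simp add: zw grid_adjacent_def)
  then consider "\<bar>i - k\<bar> = 1" "j = l" | "\<bar>j - l\<bar> = 1" "i = k"
    by arith
  then show ?thesis
    by cases (simp_all add: zw V_path_horiz V_path_vert)
qed

text \<open>Simple connectivity of the plane: up to homotopy a walk depends only on its end, whose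
  normal form it takes.\<close>

lemma V_path_walk:
  assumes "successively grid_adjacent (z # r)"
  shows "homotopic K (V_path z @ map V r) (V_path (last (z # r)))"
  using assms
proof (induction r arbitrary: z)
  case (Cons w r)
  have "homotopic K (V_path z @ map V (w # r)) (V_path w @ map V r)"
    using homotopic_suffix[OF V_path_step, of z w "map V r"] Cons.prems by simp
  also have "homotopic K \<dots> (V_path (last (w # r)))"
    using Cons by simp
  finally show ?case by simp
qed simp

end

section \<open>Lifting an action on a plane to the universal cover\<close>

lemma path_step_hd: "path_step K p q \<Longrightarrow> p \<noteq> [] \<and> q \<noteq> [] \<and> hd p = hd q"
  by (induction rule: path_step.induct)
    (auto simp: boundary_cycle_def edge_path_def hd_append split: if_splits)

lemma homotopic_hd:
  assumes "homotopic K p q" "p \<noteq> []"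
  shows "q \<noteq> [] \<and> hd q = hd p"
  using assms by (induction rule: equivclp_induct) (auto dest: path_step_hd)

lemma successively_append_tl:
  assumes "successively P xs" "successively P ys" "xs \<noteq> []" "ys \<noteq> []" "last xs = hd ys"
  shows "successively P (xs @ tl ys)"
proof (cases ys)
  case (Cons y zs)
  with assms show ?thesis by (cases zs) (auto simp: successively_append_iff)
qed (use assms in simp)

text \<open>An action of Z^2 on \<open>K\<close> that moves the plane by the translations
  \<open>T z\<close>. Invariance of faces is stated for boundary cycles, since these are what enters
  \<open>path_step\<close>.\<close>

locale plane_action = plane K V for K :: "'v poly_complex" and V +
  fixes F :: "int \<times> int \<Rightarrow> 'v \<Rightarrow> 'v" and T :: "int \<times> int \<Rightarrow> int \<times> int"
  assumes F_V: "F z (V w) = V (w + T z)"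
    and F_verts: "v \<in> verts K \<Longrightarrow> F z v \<in> verts K"
    and F_edges: "e \<in> edges K \<Longrightarrow> F z ` e \<in> edges K"
    and F_cycle: "boundary_cycle K C c \<Longrightarrow> boundary_cycle K (F z ` C) (map (F z) c)"
    and F_add: "v \<in> verts K \<Longrightarrow> F (z + w) v = F z (F w v)"
    and F_0: "v \<in> verts K \<Longrightarrow> F (0, 0) v = v"
    and T_add: "T (z + w) = T z + T w"
    and edges_verts: "e \<in> edges K \<Longrightarrow> e \<subseteq> verts K"
begin

lemma T_0: "T (0, 0) = (0, 0)"
  using T_add[of "(0, 0)" "(0, 0)"] by (cases "T (0, 0)") simp

abbreviation "base \<equiv> V (0, 0)"
abbreviation "UC \<equiv> univ_cover K base"

text \<open>As \<open>F z\<close> moves the base vertex, the image of a path must first be joined to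
  the base. Joining it inside the plane selects the lift of \<open>F z\<close> that preserves the
  lifted plane.\<close>

definition translate :: "int \<times> int \<Rightarrow> 'v list \<Rightarrow> 'v list" where
  "translate z p = V_path (T z) @ tl (map (F z) p)"

lemma F_base: "F z base = V (T z)"
  by (cases "T z") (simp add: F_V)

text \<open>Contains the full image of \<open>p\<close>, first vertex included, so that a homotopy
  of \<open>p\<close> can be carried over under a fixed prefix.\<close>

lemma translate_conv_butlast:
  assumes "p \<noteq> []" "hd p = base"
  shows "translate z p = butlast (V_path (T z)) @ map (F z) p"
proof -
  obtain q where "p = base # q" using assms by (cases p) auto
  then show ?thesis
    using append_butlast_last_id[OF V_path_nonempty[of "T z"]]
    by (simp add: translate_def F_base V_path_last)
qed

lemma path_step_map: "path_step K p q \<Longrightarrow> path_step K (map (F z) p) (map (F z) q)"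
proof (induction rule: path_step.induct)
  case (backtrack a b p q)
  have "{F z a, F z b} \<in> edges K" using F_edges[OF backtrack, of z] by simp
  from path_step.backtrack[OF this, of "map (F z) p" "map (F z) q"] show ?case by simp
next
  case (face C c p q)
  have "c \<noteq> []" using face by (auto simp: boundary_cycle_def edge_path_def)
  then show ?case
    using path_step.face[OF F_cycle[OF face, of z], of "map (F z) p" "map (F z) q"]
    by (simp add: hd_map)
qed

lemma homotopic_translate:
  assumes "homotopic K p q" "p \<noteq> []" "hd p = base"
  shows "homotopic K (translate z p) (translate z q)"
proof -
  have "homotopic K (map (F z) p) (map (F z) q)"
    by (rule homotopic_map[OF assms(1)]) (rule path_step_map)
  then show ?thesis
    using homotopic_hd[OF assms(1,2)] assms by (simp add: translate_conv_butlast homotopic_prefix)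
qed

lemma V_path_edge_path: "edge_path K (V_path z)"
proof -
  have "successively (\<lambda>a b. {V a, V b} \<in> edges K) (grid_path z)"
    by (rule successively_mono[OF grid_path_successively]) (rule V_edge)
  then show ?thesis
    using V_verts by (auto simp: edge_path_def V_path_def grid_path_nonempty successively_map)
qed

lemma paths_fromD:
  assumes "p \<in> paths_from K base"
  shows "p \<noteq> []" "set p \<subseteq> verts K" "hd p = base" "successively (\<lambda>a b. {a, b} \<in> edges K) p"
  using assms by (auto simp: paths_from_def edge_path_def)

lemma translate_paths:
  assumes "p \<in> paths_from K base"
  shows "translate z p \<in> paths_from K base" "last (translate z p) = F z (last p)"
proof -
  note p = paths_fromD[OF assms]
  have "successively (\<lambda>a b. {F z a, F z b} \<in> edges K) p"
    by (rule successively_mono[OF p(4)]) (use F_edges in fastforce)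
  then have "successively (\<lambda>a b. {a, b} \<in> edges K) (translate z p)"
    unfolding translate_def using V_path_edge_path p
    by (intro successively_append_tl)
      (auto simp: successively_map edge_path_def V_path_nonempty V_path_last hd_map F_base)
  moreover have "set (translate z p) \<subseteq> verts K"
    using p V_path_edge_path[of "T z"] F_verts[of _ z]
    by (auto simp: translate_conv_butlast edge_path_def dest!: in_set_butlastD)
  ultimately show "translate z p \<in> paths_from K base"
    using V_path_nonempty[of "T z"] V_path_hd[of "T z"]
    by (simp add: paths_from_def edge_path_def translate_def)
  show "last (translate z p) = F z (last p)"
    using p by (simp add: translate_conv_butlast last_map)
qed

text \<open>The prefix for \<open>z\<close>, followed by the prefix for \<open>w\<close> shifted by
  \<open>T z\<close>, is a grid walk from the origin to \<open>T (z + w)\<close> and therefore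
  homotopic to the direct prefix. Thus the lifts compose without any correction from the fundamental
  group.\<close>

lemma translate_translate:
  assumes "p \<in> paths_from K base"
  shows "homotopic K (translate z (translate w p)) (translate (z + w) p)"
proof -
  note p = paths_fromD[OF assms]
  let ?r = "map (\<lambda>u. u + T z) (grid_path (T w))"
  \<comment> \<open>The shifted walk begins at \<open>T z\<close>, where the first prefix already
    ends; \<open>r\<close> is the part still to be walked.\<close>
  obtain r where r: "?r = T z # r"
    using grid_path_nonempty[of "T w"] grid_path_hd[of "T w"]
    by (cases "grid_path (T w)"; cases "T z") (simp_all add: zero_prod_def[symmetric])
  have "successively (\<lambda>u v. grid_adjacent (u + T z) (v + T z)) (grid_path (T w))"
    by (rule successively_mono[OF grid_path_successively]) (simp add: grid_adjacent_def)
  then have succ: "successively grid_adjacent (T z # r)"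
    unfolding r[symmetric] by (simp add: successively_map)
  have last: "last (T z # r) = T (z + w)"
    unfolding r[symmetric] by (simp add: last_map grid_path_nonempty grid_path_last T_add add.commute)
  have "map (F z) (V_path (T w)) = map V ?r"
    by (simp add: V_path_def F_V)
  then have walk: "tl (map (F z) (V_path (T w))) = map V r" by (simp only: r) simp
  have tl: "map (F z) (map (F w) (tl p)) = map (F (z + w)) (tl p)"
    using p(2) list.set_sel(2)[OF p(1)] by (auto simp: F_add subset_iff)
  have "translate z (translate w p) =
      V_path (T z) @ tl (map (F z) (V_path (T w))) @ map (F z) (map (F w) (tl p))"
    by (simp add: translate_def V_path_nonempty map_tl)
  also have "\<dots> = (V_path (T z) @ map V r) @ map (F (z + w)) (tl p)"
    by (simp only: walk tl append_assoc)
  also have "homotopic K \<dots> (V_path (T (z + w)) @ map (F (z + w)) (tl p))"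
    using V_path_walk[OF succ] unfolding last by (rule homotopic_suffix)
  also have "\<dots> = translate (z + w) p" by (simp add: translate_def map_tl)
  finally show ?thesis .
qed

lemma translate_0:
  assumes "p \<in> paths_from K base"
  shows "translate (0, 0) p = p"
proof -
  note p = paths_fromD[OF assms]
  have "map (F (0, 0)) p = p" using p(2) F_0 by (intro map_idI) auto
  then show ?thesis
    using p by (simp add: translate_conv_butlast T_0 V_path_def grid_path_0)
qed

text \<open>By \<open>lift_class\<close> the chosen representative does not matter. The restriction
  to the vertices supplies the extensionality that \<open>Bij\<close> demands.\<close>

definition lift :: "int \<times> int \<Rightarrow> 'v list set \<Rightarrow> 'v list set" where
  "lift z = (\<lambda>P\<in>verts UC. path_class K (translate z (SOME p. p \<in> P)))"

lemma UC_verts: "verts UC = path_class K ` paths_from K base"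
  by (simp add: univ_cover_def)

lemma lift_class:
  assumes "p \<in> paths_from K base"
  shows "lift z (path_class K p) = path_class K (translate z p)"
proof -
  have "p \<in> path_class K p" by (simp add: path_class_def)
  then have "(SOME q. q \<in> path_class K p) \<in> path_class K p" by (rule someI)
  then have "homotopic K p (SOME q. q \<in> path_class K p)" by (simp add: path_class_def)
  then have "homotopic K (translate z p) (translate z (SOME q. q \<in> path_class K p))"
    using paths_fromD[OF assms] by (intro homotopic_translate)
  then show ?thesis
    using assms by (simp add: lift_def UC_verts path_class_eq_iff[THEN iffD2, OF homotopic_sym])
qed

lemma lift_verts: "P \<in> verts UC \<Longrightarrow> lift z P \<in> verts UC"
  by (auto simp: UC_verts lift_class translate_paths)

lemma lift_add:
  assumes "P \<in> verts UC"
  shows "lift (z + w) P = lift z (lift w P)"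
proof -
  obtain p where "p \<in> paths_from K base" "P = path_class K p"
    using assms by (auto simp: UC_verts)
  then show ?thesis
    using translate_translate[of p z w]
    by (simp add: lift_class translate_paths path_class_eq_iff homotopic_sym)
qed

lemma lift_0: "P \<in> verts UC \<Longrightarrow> lift (0, 0) P = P"
  by (auto simp: UC_verts lift_class translate_0)

lemma lift_inverse: "P \<in> verts UC \<Longrightarrow> lift z (lift (- z) P) = P"
  using lift_add[of P z "- z"] lift_0 by (cases z) simp

lemma cover_proj_lift:
  assumes "P \<in> verts UC"
  shows "cover_proj (lift z P) = F z (cover_proj P)"
proof -
  obtain p where p: "p \<in> paths_from K base" "P = path_class K p"
    using assms by (auto simp: UC_verts)
  then show ?thesis
    using paths_fromD(1)[OF p(1)] paths_fromD(1)[OF translate_paths(1)[OF p(1)]] translate_paths[OF p(1), of z]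
    by (simp add: lift_class cover_proj_path_class)
qed

lemma paths_from_extend:
  assumes "p \<in> paths_from K base" "{last p, w} \<in> edges K"
  shows "p @ [w] \<in> paths_from K base"
  using assms edges_verts[OF assms(2)] paths_fromD(1,3)[OF assms(1)]
  by (auto simp: paths_from_def edge_path_def successively_append_iff)

lemma translate_extend:
  assumes "p \<in> paths_from K base"
  shows "translate z (p @ q) = translate z p @ map (F z) q"
  using paths_fromD[OF assms] by (simp add: translate_conv_butlast)

lemma UC_edges: "edges UC = {{path_class K p, path_class K (p @ [w])} | p w.
    p \<in> paths_from K base \<and> {last p, w} \<in> edges K}"
  by (simp add: univ_cover_def)

lemma UC_faces: "faces UC = {{path_class K (p @ take k (tl c)) | k. k \<le> length (tl c)} | p C c.
    p \<in> paths_from K base \<and> boundary_cycle K C c \<and> hd c = last p}"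
  by (simp add: univ_cover_def)

lemma lift_edges:
  assumes "e \<in> edges UC"
  shows "e \<subseteq> verts UC" "lift z ` e \<in> edges UC"
proof -
  obtain p w where e: "e = {path_class K p, path_class K (p @ [w])}"
    and p: "p \<in> paths_from K base" "{last p, w} \<in> edges K"
    using assms by (auto simp: UC_edges)
  note pw = paths_from_extend[OF p]
  show "e \<subseteq> verts UC" using e p(1) pw by (auto simp: UC_verts)
  have "lift z ` e = {path_class K (translate z p), path_class K (translate z p @ [F z w])}"
    using p(1) pw by (simp add: e lift_class translate_extend)
  moreover have "{last (translate z p), F z w} \<in> edges K"
    using F_edges[OF p(2), of z] translate_paths[OF p(1)] by simp
  ultimately show "lift z ` e \<in> edges UC"
    using translate_paths[OF p(1)] unfolding UC_edges by blast
qed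

lemma paths_from_cycle:
  assumes "p \<in> paths_from K base" "boundary_cycle K C c" "hd c = last p"
  shows "p @ take k (tl c) \<in> paths_from K base"
proof -
  have c: "c \<noteq> []" "set c \<subseteq> verts K" "successively (\<lambda>a b. {a, b} \<in> edges K) c"
    using assms(2) by (auto simp: boundary_cycle_def edge_path_def)
  note p = paths_fromD[OF assms(1)]
  have "successively (\<lambda>a b. {a, b} \<in> edges K) (p @ tl c)"
    using p c assms(3) by (intro successively_append_tl) auto
  moreover have "p @ tl c = (p @ take k (tl c)) @ drop k (tl c)" by simp
  ultimately have "successively (\<lambda>a b. {a, b} \<in> edges K) (p @ take k (tl c))"
    by (metis successively_append_iff)
  moreover have "set (take k (tl c)) \<subseteq> verts K"
    using c set_take_subset[of k "tl c"] list.set_sel(2)[OF c(1)] by auto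
  ultimately show ?thesis
    using p by (simp add: paths_from_def edge_path_def)
qed

lemma lift_faces:
  assumes "f \<in> faces UC"
  shows "f \<subseteq> verts UC" "lift z ` f \<in> faces UC"
proof -
  obtain p C c where f: "f = {path_class K (p @ take k (tl c)) | k. k \<le> length (tl c)}"
    and p: "p \<in> paths_from K base" "boundary_cycle K C c" "hd c = last p"
    using assms unfolding UC_faces by blast
  note pk = paths_from_cycle[OF p]
  show "f \<subseteq> verts UC" using f pk by (auto simp: UC_verts)
  have c: "c \<noteq> []" using p(2) by (auto simp: boundary_cycle_def edge_path_def)
  have "lift z (path_class K (p @ take k (tl c))) =
      path_class K (translate z p @ take k (tl (map (F z) c)))" for k
    using p(1) pk by (simp add: lift_class translate_extend take_map map_tl[symmetric])
  then have "lift z ` f = {path_class K (translate z p @ take k (tl (map (F z) c))) | k.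
      k \<le> length (tl (map (F z) c))}"
    unfolding f setcompr_eq_image image_image by (simp only: length_tl length_map)
  moreover have "hd (map (F z) c) = last (translate z p)"
    using c p translate_paths[OF p(1)] by (simp add: hd_map)
  ultimately show "lift z ` f \<in> faces UC"
    using translate_paths(1)[OF p(1)] F_cycle[OF p(2)] unfolding UC_faces mem_Collect_eq
    by (intro exI[of _ "translate z p"] exI[of _ "F z ` C"] exI[of _ "map (F z) c"] conjI)
qed

lemma lift_cell_auto: "cell_auto UC (lift z)"
proof -
  have "bij_betw (lift z) (verts UC) (verts UC)"
    using lift_verts[of _ z] lift_verts[of _ "- z"] lift_inverse[of _ z] lift_inverse[of _ "- z"]
    by (intro bij_betw_byWitness[where f' = "lift (- z)"]) auto
  moreover have "lift z \<in> extensional (verts UC)" by (simp add: lift_def)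
  moreover have "(\<lambda>e. lift z ` e) ` \<E> = \<E>"
    if sub: "\<And>e. e \<in> \<E> \<Longrightarrow> e \<subseteq> verts UC" and closed: "\<And>e z. e \<in> \<E> \<Longrightarrow> lift z ` e \<in> \<E>" for \<E>
  proof -
    have "e = lift z ` lift (- z) ` e" if "e \<in> \<E>" for e
    proof -
      have "lift z ` lift (- z) ` e = (\<lambda>P. P) ` e"
        unfolding image_image using sub[OF that] by (intro image_cong HOL.refl lift_inverse) blast
      then show ?thesis by simp
    qed
    \<comment> \<open>Invariance under the inverse lift gives the reverse inclusion, hence equality
      and not just containment.\<close>
    then have "\<E> \<subseteq> (\<lambda>e. lift z ` e) ` \<E>" using closed[of _ "- z"] by (intro subsetI image_eqI) 
    moreover have "(\<lambda>e. lift z ` e) ` \<E> \<subseteq> \<E>" by (rule image_subsetI) (rule closed)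
    ultimately show ?thesis by (intro equalityI)
  qed
  ultimately show ?thesis
    using lift_edges lift_faces by (simp add: cell_auto_def Bij_def)
qed

text \<open>Injectivity comes from the component \<tau> in \<open>G\<close>; the component of lifts
  contributes only the homomorphism property.\<close>

lemma Z2_embeds_lift_group:
  assumes "\<And>z. \<tau> z \<in> carrier G" "\<And>z w. \<tau> (z + w) = \<tau> z \<otimes>\<^bsub>G\<^esub> \<tau> w" "inj \<tau>"
    and "\<And>z v. v \<in> verts K \<Longrightarrow> act (\<tau> z) v = F z v"
  shows "Z2_embeds (lift_group K base G act)"
proof -
  let ?L = "lift_group K base G act"
  have proj: "cover_proj P \<in> verts K" if P: "P \<in> verts UC" for P
  proof -
    obtain p where p: "p \<in> paths_from K base" "P = path_class K p"
      using P by (auto simp: UC_verts)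
    then show ?thesis
      using paths_fromD(1,2)[OF p(1)] last_in_set[of p] by (auto simp: cover_proj_path_class)
  qed
  have bij: "lift z \<in> Bij (verts UC)" for z
    using lift_cell_auto by (simp add: cell_auto_def)
  have add: "lift (z + w) = compose (verts UC) (lift z) (lift w)" for z w
  proof (rule extensionalityI[of _ "verts UC"])
    show "lift (z + w) \<in> extensional (verts UC)" by (simp add: lift_def)
    show "compose (verts UC) (lift z) (lift w) \<in> extensional (verts UC)" by (rule compose_extensional)
    fix P assume "P \<in> verts UC"
    then show "lift (z + w) P = compose (verts UC) (lift z) (lift w) P"
      by (simp add: lift_add compose_def)
  qed
  have "(\<lambda>z. (\<tau> z, lift z)) \<in> hom (integer_group \<times>\<times> integer_group) ?L"
  proof (rule homI)
    fix z :: "int \<times> int"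
    show "(\<tau> z, lift z) \<in> carrier ?L"
      using assms(1,4) lift_cell_auto proj by (simp add: lift_group_def cover_proj_lift)
    fix w :: "int \<times> int"
    have "z \<otimes>\<^bsub>integer_group \<times>\<times> integer_group\<^esub> w = z + w"
      by (cases z; cases w) (simp add: DirProd_def)
    then show "(\<tau> (z \<otimes>\<^bsub>integer_group \<times>\<times> integer_group\<^esub> w), lift (z \<otimes>\<^bsub>integer_group \<times>\<times> integer_group\<^esub> w)) =
        (\<tau> z, lift z) \<otimes>\<^bsub>?L\<^esub> (\<tau> w, lift w)"
      using bij by (simp add: lift_group_def assms(2) add BijGroup_def DirProd_def)
  qed
  moreover have "inj_on (\<lambda>z. (\<tau> z, lift z)) (carrier (integer_group \<times>\<times> integer_group))"
    using assms(3) by (auto simp: inj_on_def)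
  ultimately show ?thesis by (auto simp: Z2_embeds_def mon_def)
qed

end

section \<open>Lozenges and flats of the Brady complex\<close>

abbreviation vtx :: "B4_elt \<Rightarrow> brady_vertex" where
  "vtx g \<equiv> g <#\<^bsub>B4\<^esub> Delta_B"

lemma Delta_subgroup: "subgroup Delta_B B4"
  unfolding Delta_B_def by (rule B4.generate_is_subgroup) simp

lemma Delta_carrier: "v \<in> Delta_B \<Longrightarrow> v \<in> carrier B4"
  using subgroup.subset[OF Delta_subgroup] by blast

lemma vtx_eqD:
  assumes "vtx g = vtx h" "g \<in> carrier B4" "h \<in> carrier B4"
  shows "\<exists>v\<in>Delta_B. h = g \<otimes>\<^bsub>B4\<^esub> v"
proof -
  have "h \<otimes>\<^bsub>B4\<^esub> \<one>\<^bsub>B4\<^esub> \<in> vtx h"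
    using subgroup.one_closed[OF Delta_subgroup] unfolding l_coset_def by blast
  then have "h \<in> vtx g" using assms by simp
  then show ?thesis unfolding l_coset_def by blast
qed

lemma vtx_mult:
  assumes "g \<in> carrier B4" "h \<in> carrier B4"
  shows "g <#\<^bsub>B4\<^esub> vtx h = vtx (g \<otimes>\<^bsub>B4\<^esub> h)"
  using assms by (simp add: B4.lcos_m_assoc subgroup.subset[OF Delta_subgroup])

lemma vtx_mult_Delta:
  assumes "g \<in> carrier B4" "v \<in> Delta_B"
  shows "vtx (g \<otimes>\<^bsub>B4\<^esub> v) = vtx g"
proof -
  have "vtx v = Delta_B"
    by (rule B4.coset_join3[OF Delta_carrier[OF assms(2)] Delta_subgroup assms(2)])
  then show ?thesis
    using vtx_mult[OF assms(1) Delta_carrier[OF assms(2)]] by simp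
qed

lemma vtx_one: "vtx \<one>\<^bsub>B4\<^esub> = Delta_B"
  by (simp add: B4.lcos_mult_one subgroup.subset[OF Delta_subgroup])

lemma vtx_eq_mult_cancel:
  assumes "vtx (g \<otimes>\<^bsub>B4\<^esub> h) = vtx (g \<otimes>\<^bsub>B4\<^esub> k)" "g \<in> carrier B4" "h \<in> carrier B4" "k \<in> carrier B4"
  shows "\<exists>v\<in>Delta_B. k = h \<otimes>\<^bsub>B4\<^esub> v"
proof -
  obtain v where v: "v \<in> Delta_B" "g \<otimes>\<^bsub>B4\<^esub> k = g \<otimes>\<^bsub>B4\<^esub> h \<otimes>\<^bsub>B4\<^esub> v"
    using vtx_eqD[OF assms(1) B4.m_closed[OF assms(2,3)] B4.m_closed[OF assms(2,4)]] by blast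
  have vc: "v \<in> carrier B4" by (rule Delta_carrier[OF v(1)])
  have "g \<otimes>\<^bsub>B4\<^esub> k = g \<otimes>\<^bsub>B4\<^esub> (h \<otimes>\<^bsub>B4\<^esub> v)"
    unfolding v(2) using assms(2-4) vc by (simp add: B4.m_assoc)
  then have "k = h \<otimes>\<^bsub>B4\<^esub> v"
    by (rule B4.l_cancel[OF _ assms(4) B4.m_closed[OF assms(3) vc] assms(2)])
  then show ?thesis by (rule bexI[OF _ v(1)])
qed

lemma strand_perm_delta:
  "strand_perm delta_B 1 = 4" "strand_perm delta_B 2 = 1" "strand_perm delta_B 3 = 2" "strand_perm delta_B 4 = 3"
  unfolding delta_B_def
  by (simp_all add: strand_perm_mult strand_perm_s1 strand_perm_s2 strand_perm_s3 Transposition.transpose_def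
      del: strand_perm.hom_mult)

lemma strand_perm_one: "strand_perm \<one>\<^bsub>B4\<^esub> = id"
  using strand_perm.hom_one by (simp add: sym_group_one)

text \<open>These are the powers of the 4-cycle to which the dual Garside element maps.\<close>

lemma strand_perm_Delta:
  assumes "v \<in> Delta_B"
  shows "(strand_perm v 1, strand_perm v 2, strand_perm v 3, strand_perm v 4) \<in>
    {(1, 2, 3, 4), (4, 1, 2, 3), (3, 4, 1, 2), (2, 3, 4, 1)}"
  using assms unfolding Delta_B_def
proof (induction rule: generate.induct)
  case one then show ?case by (simp add: sym_group_one)
next
  case (incl h) then show ?case by (simp add: strand_perm_delta del: One_nat_def)
next
  case (inv h)
  have "strand_perm (inv\<^bsub>B4\<^esub> delta_B) (strand_perm delta_B n) = n" for n
    using strand_perm_mult[of "inv\<^bsub>B4\<^esub> delta_B" delta_B n] by (simp add: strand_perm_one sym_group_one del: strand_perm.hom_mult strand_perm.hom_inv)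
  from this[of 1] this[of 2] this[of 3] this[of 4] show ?case
    using inv by (simp add: strand_perm_delta del: One_nat_def strand_perm.hom_inv)
next
  case (eng h1 h2)
  have "h1 \<in> carrier B4" "h2 \<in> carrier B4"
    using eng B4.generate_in_carrier[of "{delta_B}"] by simp_all
  with eng.IH show ?case
    unfolding insert_iff empty_iff prod.inject simp_thms
    by (elim disjE conjE; simp add: strand_perm_mult del: One_nat_def strand_perm.hom_mult)
qed

text \<open>If the vertices agreed, \<open>k\<close> would be \<open>h\<close> times an element of
  \<open>Delta_B\<close>, whose permutation has only four possible value lists at 1, 2, 3, 4.
  Distinctness thus becomes a finite check.\<close>

lemma vtx_neqI:
  assumes "\<forall>(m1, m2, m3, m4) \<in> {(1, 2, 3, 4), (4, 1, 2, 3), (3, 4, 1, 2), (2, 3, 4, 1)}.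
      \<not> (strand_perm k 1 = strand_perm h m1 \<and> strand_perm k 2 = strand_perm h m2 \<and>
         strand_perm k 3 = strand_perm h m3 \<and> strand_perm k 4 = strand_perm h m4)"
    and "g \<in> carrier B4" "h \<in> carrier B4" "k \<in> carrier B4"
  shows "vtx (g \<otimes>\<^bsub>B4\<^esub> h) \<noteq> vtx (g \<otimes>\<^bsub>B4\<^esub> k)"
proof
  assume "vtx (g \<otimes>\<^bsub>B4\<^esub> h) = vtx (g \<otimes>\<^bsub>B4\<^esub> k)"
  then obtain v where v: "v \<in> Delta_B" "k = h \<otimes>\<^bsub>B4\<^esub> v"
    using vtx_eq_mult_cancel[OF _ assms(2-4)] by blast
  have "strand_perm k n = strand_perm h (strand_perm v n)" for n
    unfolding v(2) by (rule strand_perm_mult[OF assms(3) Delta_carrier[OF v(1)]])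
  then show False using bspec[OF assms(1) strand_perm_Delta[OF v(1)]] by simp
qed

lemma lozenge_distinct:
  assumes "g \<in> carrier B4"
  shows "distinct [vtx g, vtx (g \<otimes>\<^bsub>B4\<^esub> s1), vtx (g \<otimes>\<^bsub>B4\<^esub> (s1 \<otimes>\<^bsub>B4\<^esub> s3)), vtx (g \<otimes>\<^bsub>B4\<^esub> s3)]"
proof -
  note simps = strand_perm_s1 strand_perm_s3 sym_group_one sym_group_mult Transposition.transpose_def
  have "vtx (g \<otimes>\<^bsub>B4\<^esub> \<one>\<^bsub>B4\<^esub>) \<noteq> vtx (g \<otimes>\<^bsub>B4\<^esub> s1)"
    by (rule vtx_neqI) (simp_all add: assms simps)
  moreover have "vtx (g \<otimes>\<^bsub>B4\<^esub> \<one>\<^bsub>B4\<^esub>) \<noteq> vtx (g \<otimes>\<^bsub>B4\<^esub> (s1 \<otimes>\<^bsub>B4\<^esub> s3))"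
    by (rule vtx_neqI) (simp_all add: assms simps)
  moreover have "vtx (g \<otimes>\<^bsub>B4\<^esub> \<one>\<^bsub>B4\<^esub>) \<noteq> vtx (g \<otimes>\<^bsub>B4\<^esub> s3)"
    by (rule vtx_neqI) (simp_all add: assms simps)
  moreover have "vtx (g \<otimes>\<^bsub>B4\<^esub> s1) \<noteq> vtx (g \<otimes>\<^bsub>B4\<^esub> (s1 \<otimes>\<^bsub>B4\<^esub> s3))"
    by (rule vtx_neqI) (simp_all add: assms simps)
  moreover have "vtx (g \<otimes>\<^bsub>B4\<^esub> s1) \<noteq> vtx (g \<otimes>\<^bsub>B4\<^esub> s3)"
    by (rule vtx_neqI) (simp_all add: assms simps)
  moreover have "vtx (g \<otimes>\<^bsub>B4\<^esub> (s1 \<otimes>\<^bsub>B4\<^esub> s3)) \<noteq> vtx (g \<otimes>\<^bsub>B4\<^esub> s3)"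
    by (rule vtx_neqI) (simp_all add: assms simps)
  ultimately show ?thesis using assms by simp
qed

text \<open>The corners follow in cyclic order along the boundary; the erased diagonal joins the
  first to the third.\<close>

definition lozenge :: "B4_elt \<Rightarrow> brady_vertex set" where
  "lozenge g = {vtx g, vtx (g \<otimes>\<^bsub>B4\<^esub> s1), vtx (g \<otimes>\<^bsub>B4\<^esub> (s1 \<otimes>\<^bsub>B4\<^esub> s3)), vtx (g \<otimes>\<^bsub>B4\<^esub> s3)}"

lemma atoms_mem: "s1 \<in> atoms" "s3 \<in> atoms" "a31 \<in> atoms"
  by (auto simp: atoms_def atom_idx_eq)

lemma lozenge_triangles:
  assumes "g \<in> carrier B4"
  shows "{vtx g, vtx (g \<otimes>\<^bsub>B4\<^esub> s1), vtx (g \<otimes>\<^bsub>B4\<^esub> (s1 \<otimes>\<^bsub>B4\<^esub> s3))} \<in> brady_triangles"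
    and "{vtx g, vtx (g \<otimes>\<^bsub>B4\<^esub> s3), vtx (g \<otimes>\<^bsub>B4\<^esub> (s1 \<otimes>\<^bsub>B4\<^esub> s3))} \<in> brady_triangles"
proof -
  have "{vtx g, vtx (g \<otimes>\<^bsub>B4\<^esub> s1), vtx (g \<otimes>\<^bsub>B4\<^esub> s1 \<otimes>\<^bsub>B4\<^esub> s3)} \<in> brady_triangles"
    unfolding brady_triangles_def mem_Collect_eq
    by (intro exI[of _ g] exI[of _ s1] exI[of _ s3] exI[of _ a31])
      (simp add: assms atoms_mem delta_factor)
  then show "{vtx g, vtx (g \<otimes>\<^bsub>B4\<^esub> s1), vtx (g \<otimes>\<^bsub>B4\<^esub> (s1 \<otimes>\<^bsub>B4\<^esub> s3))} \<in> brady_triangles"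
    using assms by (simp add: B4.m_assoc)
  have "{vtx g, vtx (g \<otimes>\<^bsub>B4\<^esub> s3), vtx (g \<otimes>\<^bsub>B4\<^esub> s3 \<otimes>\<^bsub>B4\<^esub> s1)} \<in> brady_triangles"
    unfolding brady_triangles_def mem_Collect_eq
    by (intro exI[of _ g] exI[of _ s3] exI[of _ s1] exI[of _ a31])
      (simp add: assms atoms_mem delta_factor)
  then show "{vtx g, vtx (g \<otimes>\<^bsub>B4\<^esub> s3), vtx (g \<otimes>\<^bsub>B4\<^esub> (s1 \<otimes>\<^bsub>B4\<^esub> s3))} \<in> brady_triangles"
    using assms by (simp add: B4.m_assoc s1_s3_commute)
qed

lemma lozenge_face:
  assumes "g \<in> carrier B4"
  shows "lozenge g \<in> faces brady_complex"
proof -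
  let ?T = "{vtx g, vtx (g \<otimes>\<^bsub>B4\<^esub> s1), vtx (g \<otimes>\<^bsub>B4\<^esub> (s1 \<otimes>\<^bsub>B4\<^esub> s3))}"
  let ?T' = "{vtx g, vtx (g \<otimes>\<^bsub>B4\<^esub> s3), vtx (g \<otimes>\<^bsub>B4\<^esub> (s1 \<otimes>\<^bsub>B4\<^esub> s3))}"
  let ?e = "{vtx (g \<otimes>\<^bsub>B4\<^esub> (s1 \<otimes>\<^bsub>B4\<^esub> s3)), vtx g}"
  \<comment> \<open>As \<open>s1\<close>, \<open>s3\<close>, \<open>a31\<close> multiply to
    \<open>delta_B\<close>, the diagonal is the edge of type \<open>a31\<close> that leads from the
    third corner back to the first.\<close>
  have "vtx (g \<otimes>\<^bsub>B4\<^esub> (s1 \<otimes>\<^bsub>B4\<^esub> s3) \<otimes>\<^bsub>B4\<^esub> a31) = vtx (g \<otimes>\<^bsub>B4\<^esub> delta_B)"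
    using assms by (simp add: B4.m_assoc delta_factor(1)[symmetric])
  also have "\<dots> = vtx g"
    by (rule vtx_mult_Delta[OF assms]) (auto simp: Delta_B_def intro: generate.incl)
  finally have "?e \<in> brady_erased"
    unfolding brady_erased_def mem_Collect_eq using assms
    by (intro exI[of _ "g \<otimes>\<^bsub>B4\<^esub> (s1 \<otimes>\<^bsub>B4\<^esub> s3)"] exI[of _ a31]) simp
  moreover have "?e \<subseteq> ?T \<inter> ?T'" by simp
  moreover have "?T \<noteq> ?T'"
  proof
    assume "?T = ?T'"
    then have "vtx (g \<otimes>\<^bsub>B4\<^esub> s1) \<in> ?T'" by (rule subst) simp
    then show False using lozenge_distinct[OF assms] by simp
  qed
  ultimately have "?T \<union> ?T' \<in> faces brady_complex"
    using lozenge_triangles[OF assms] unfolding brady_complex_def poly_complex.select_convs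
    by (intro UnI2 CollectI exI[of _ ?T] exI[of _ ?T'] conjI HOL.refl bexI[of _ ?e])
  moreover have "lozenge g = ?T \<union> ?T'"
    unfolding lozenge_def by (simp only: Un_insert_left Un_insert_right Un_empty_left Un_empty_right insert_commute insert_absorb2)
  ultimately show ?thesis by simp
qed

text \<open>An erased edge joins cosets that differ by an element mapping into the dihedral group
  generated by the 4-cycle and \<open>(1 3)\<close>, whose elements map \<open>{1, 3}\<close> to \<open>{1, 3}\<close> or \<open>{2, 4}\<close>.\<close>

lemma not_erased:
  assumes "g \<in> carrier B4" "s = s1 \<or> s = s3"
  shows "{vtx g, vtx (g \<otimes>\<^bsub>B4\<^esub> s)} \<notin> brady_erased"
proof
  assume "{vtx g, vtx (g \<otimes>\<^bsub>B4\<^esub> s)} \<in> brady_erased"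
  then obtain h a where h: "h \<in> carrier B4" "a = a31 \<or> a = a42"
    "{vtx g, vtx (g \<otimes>\<^bsub>B4\<^esub> s)} = {vtx h, vtx (h \<otimes>\<^bsub>B4\<^esub> a)}"
    unfolding brady_erased_def by blast
  have s: "s \<in> carrier B4" and a: "a \<in> carrier B4" using assms h by auto
  have even_Delta: "even (strand_perm v 1 + strand_perm v 3)"
    "(strand_perm v 1, strand_perm v 3) \<in> {(1, 3), (3, 1), (2, 4), (4, 2)}" if "v \<in> Delta_B" for v
    using strand_perm_Delta[OF that] by auto
  have a13: "even (strand_perm v (strand_perm a 1) + strand_perm v (strand_perm a 3))"
    if "v \<in> Delta_B" for v
    using even_Delta(1)[OF that] h(2)
    by (auto simp: strand_perm_a31 strand_perm_a42 Transposition.transpose_def add.commute)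
  \<comment> \<open>Each of (1 2) and (3 4) moves exactly one element of {1, 3} and of {2, 4},
    changing its parity. A pair of equal parity becomes mixed, which the dihedral elements never
    achieve.\<close>
  have s13: "odd (strand_perm s m + strand_perm s n)"
    if "(m, n) \<in> {(1, 3), (3, 1), (2, 4), (4, 2)}" for m n
    using that assms(2) by (auto simp: strand_perm_s1 strand_perm_s3 Transposition.transpose_def)
  consider "vtx g = vtx h" "vtx (g \<otimes>\<^bsub>B4\<^esub> s) = vtx (h \<otimes>\<^bsub>B4\<^esub> a)"
    | "vtx (g \<otimes>\<^bsub>B4\<^esub> s) = vtx h" "vtx g = vtx (h \<otimes>\<^bsub>B4\<^esub> a)"
    using h(3) by (auto simp: doubleton_eq_iff)
  then show False
  proof cases
    case 1
    obtain v where v: "v \<in> Delta_B" "h = g \<otimes>\<^bsub>B4\<^esub> v"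
      using vtx_eqD[OF 1(1) assms(1) h(1)] by blast
    note vc = Delta_carrier[OF v(1)]
    have "vtx (g \<otimes>\<^bsub>B4\<^esub> s) = vtx (g \<otimes>\<^bsub>B4\<^esub> (v \<otimes>\<^bsub>B4\<^esub> a))"
      using 1(2) v assms a vc by (simp add: B4.m_assoc)
    then obtain w where w: "w \<in> Delta_B" "v \<otimes>\<^bsub>B4\<^esub> a = s \<otimes>\<^bsub>B4\<^esub> w"
      using vtx_eq_mult_cancel[OF _ assms(1) s B4.m_closed[OF vc a]] by blast
    have "strand_perm v (strand_perm a n) = strand_perm s (strand_perm w n)" for n
      using w strand_perm_mult[OF vc a] strand_perm_mult[OF s Delta_carrier[OF w(1)]] by metis
    then show False
      using a13[OF v(1)] s13[OF even_Delta(2)[OF w(1)]] by simp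
  next
    case 2
    obtain v where v: "v \<in> Delta_B" "h = g \<otimes>\<^bsub>B4\<^esub> s \<otimes>\<^bsub>B4\<^esub> v"
      using vtx_eqD[OF 2(1) B4.m_closed[OF assms(1) s] h(1)] by blast
    note vc = Delta_carrier[OF v(1)]
    have "vtx (g \<otimes>\<^bsub>B4\<^esub> \<one>\<^bsub>B4\<^esub>) = vtx (g \<otimes>\<^bsub>B4\<^esub> (s \<otimes>\<^bsub>B4\<^esub> (v \<otimes>\<^bsub>B4\<^esub> a)))"
      using 2(2) v assms a s vc by (simp add: B4.m_assoc)
    then obtain w where w: "w \<in> Delta_B" "s \<otimes>\<^bsub>B4\<^esub> (v \<otimes>\<^bsub>B4\<^esub> a) = \<one>\<^bsub>B4\<^esub> \<otimes>\<^bsub>B4\<^esub> w"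
      using vtx_eq_mult_cancel[OF _ assms(1) B4.one_closed B4.m_closed[OF s B4.m_closed[OF vc a]]] by blast
    have "strand_perm s (strand_perm v (strand_perm a n)) = strand_perm w n" for n
      using w(2) strand_perm_mult[OF vc a] strand_perm_mult[OF s B4.m_closed[OF vc a]]
        Delta_carrier[OF w(1)] by (metis B4.l_one)
    moreover have "(strand_perm v (strand_perm a 1), strand_perm v (strand_perm a 3)) \<in>
        {(1, 3), (3, 1), (2, 4), (4, 2)}"
      using strand_perm_Delta[OF v(1)] h(2)
      by (auto simp: strand_perm_a31 strand_perm_a42 Transposition.transpose_def)
    ultimately show False
      using even_Delta(1)[OF w(1)] s13 by metis
  qed
qed

lemma lozenge_edge:
  assumes "g \<in> carrier B4" "s = s1 \<or> s = s3"
  shows "{vtx g, vtx (g \<otimes>\<^bsub>B4\<^esub> s)} \<in> edges brady_complex"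
proof -
  have "vtx g \<noteq> vtx (g \<otimes>\<^bsub>B4\<^esub> s)" using lozenge_distinct[OF assms(1)] assms(2) by auto
  then have "card {vtx g, vtx (g \<otimes>\<^bsub>B4\<^esub> s)} = 2" by simp
  moreover have "\<exists>T\<in>brady_triangles. {vtx g, vtx (g \<otimes>\<^bsub>B4\<^esub> s)} \<subseteq> T"
    using assms(2)
  proof
    assume "s = s1"
    then show ?thesis by (intro bexI[OF _ lozenge_triangles(1)[OF assms(1)]]) simp
  next
    assume "s = s3"
    then show ?thesis by (intro bexI[OF _ lozenge_triangles(2)[OF assms(1)]]) simp
  qed
  ultimately show ?thesis
    using not_erased[OF assms] by (simp add: brady_complex_def)
qed

lemma vtx_verts: "g \<in> carrier B4 \<Longrightarrow> vtx g \<in> brady_verts"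
  by (auto simp: brady_verts_def)

lemma brady_triangle_verts:
  assumes "T \<in> brady_triangles"
  shows "T \<subseteq> brady_verts"
  using assms unfolding brady_triangles_def mem_Collect_eq
proof (elim exE conjE)
  fix g t1 t2
  assume T: "T = {vtx g, vtx (g \<otimes>\<^bsub>B4\<^esub> t1), vtx (g \<otimes>\<^bsub>B4\<^esub> t1 \<otimes>\<^bsub>B4\<^esub> t2)}"
    and "g \<in> carrier B4" "t1 \<in> atoms" "t2 \<in> atoms"
  moreover from this have "t1 \<in> carrier B4" "t2 \<in> carrier B4"
    by (auto simp: atoms_def atom_carrier)
  ultimately show ?thesis by (simp add: vtx_verts)
qed

lemma brady_edges_verts: "e \<in> edges brady_complex \<Longrightarrow> e \<subseteq> brady_verts"
  using brady_triangle_verts by (auto simp: brady_complex_def)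

lemma brady_faces_verts: "C \<in> faces brady_complex \<Longrightarrow> C \<subseteq> brady_verts"
  using brady_triangle_verts by (auto simp: brady_complex_def)

section \<open>The flat spanned by the first and third braid generators\<close>

lemma (in group) commute_int_pow_left:
  fixes i :: int
  assumes "x \<in> carrier G" "y \<in> carrier G" "x \<otimes> y = y \<otimes> x"
  shows "x [^] i \<otimes> y = y \<otimes> x [^] i"
proof -
  \<comment> \<open>Commuting with \<open>y\<close> means being fixed by conjugation by
    \<open>y\<close>, and a homomorphism that fixes \<open>x\<close> fixes its powers.\<close>
  interpret h: group_hom G G "inner_aut G y"
    using auto_hom[OF inner_aut_auto[OF assms(2)]]
    by (simp add: group_hom_def group_hom_axioms_def is_group)
  have fix_iff: "inner_aut G y u = u \<longleftrightarrow> u \<otimes> y = y \<otimes> u" if "u \<in> carrier G" for u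
    using assms that by (simp add: inner_aut_apply) (metis inv_solve_right' m_closed)
  have "inner_aut G y (x [^] i) = x [^] i"
    using h.hom_int_pow[of x i] assms fix_iff[of x] by simp
  then show ?thesis using fix_iff[of "x [^] i"] assms by simp
qed

definition flat_elt :: "int \<times> int \<Rightarrow> B4_elt" where
  "flat_elt z = s1 [^]\<^bsub>B4\<^esub> fst z \<otimes>\<^bsub>B4\<^esub> s3 [^]\<^bsub>B4\<^esub> snd z"

lemma flat_elt_carrier [simp]: "flat_elt z \<in> carrier B4"
  by (simp add: flat_elt_def)

lemma flat_elt_add: "flat_elt (z + w) = flat_elt z \<otimes>\<^bsub>B4\<^esub> flat_elt w"
proof -
  let ?x = "\<lambda>n::int. s1 [^]\<^bsub>B4\<^esub> n" and ?y = "\<lambda>n::int. s3 [^]\<^bsub>B4\<^esub> n"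
  have "?x m \<otimes>\<^bsub>B4\<^esub> s3 = s3 \<otimes>\<^bsub>B4\<^esub> ?x m" for m
    by (rule B4.commute_int_pow_left) (simp_all add: s1_s3_commute)
  then have swap: "?y n \<otimes>\<^bsub>B4\<^esub> ?x m = ?x m \<otimes>\<^bsub>B4\<^esub> ?y n" for m n
    by (intro B4.commute_int_pow_left) simp_all
  then have comm: "?y n \<otimes>\<^bsub>B4\<^esub> (?x m \<otimes>\<^bsub>B4\<^esub> u) = ?x m \<otimes>\<^bsub>B4\<^esub> (?y n \<otimes>\<^bsub>B4\<^esub> u)"
    if "u \<in> carrier B4" for m n u
    using that by (simp only: B4.m_assoc[symmetric] B4.int_pow_closed atoms_carrier swap)
  show ?thesis
    by (simp add: flat_elt_def B4.int_pow_mult B4.m_assoc comm)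
qed

lemma flat_elt_simps: "flat_elt (0, 0) = \<one>\<^bsub>B4\<^esub>" "flat_elt (1, 0) = s1" "flat_elt (0, 1) = s3"
  "flat_elt (1, 1) = s1 \<otimes>\<^bsub>B4\<^esub> s3"
  by (simp_all add: flat_elt_def B4.int_pow_1)

definition flat :: "int \<times> int \<Rightarrow> brady_vertex" where
  "flat z = vtx (flat_elt z)"

lemma flat_add: "vtx (flat_elt z \<otimes>\<^bsub>B4\<^esub> flat_elt w) = flat (z + w)"
  by (simp add: flat_def flat_elt_add)

lemma flat_step: "vtx (flat_elt (i, j) \<otimes>\<^bsub>B4\<^esub> s1) = flat (i + 1, j)"
  "vtx (flat_elt (i, j) \<otimes>\<^bsub>B4\<^esub> s3) = flat (i, j + 1)"
  "vtx (flat_elt (i, j) \<otimes>\<^bsub>B4\<^esub> (s1 \<otimes>\<^bsub>B4\<^esub> s3)) = flat (i + 1, j + 1)"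
  using flat_add[of "(i, j)" "(1, 0)"] flat_add[of "(i, j)" "(0, 1)"] flat_add[of "(i, j)" "(1, 1)"]
  by (simp_all add: flat_elt_simps)

lemma lozenge_flat: "lozenge (flat_elt (i, j)) =
    {flat (i, j), flat (i + 1, j), flat (i + 1, j + 1), flat (i, j + 1)}"
  unfolding lozenge_def flat_step by (simp add: flat_def)

lemma flat_edges: "{flat (i, j), flat (i + 1, j)} \<in> edges brady_complex"
  "{flat (i, j), flat (i, j + 1)} \<in> edges brady_complex"
  using lozenge_edge[of "flat_elt (i, j)" s1] lozenge_edge[of "flat_elt (i, j)" s3]
  by (simp_all add: flat_step) (simp_all add: flat_def)

lemma flat_plane:
  assumes "\<And>z. lozenge (flat_elt z) \<notin> \<Union>\<A>"
  shows "plane (remove_faces brady_complex \<A>) flat"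
proof
  let ?K = "remove_faces brady_complex \<A>"
  have K: "verts ?K = brady_verts" "edges ?K = edges brady_complex"
    "faces ?K = faces brady_complex - \<Union>\<A>"
    by (simp_all add: remove_faces_def brady_complex_def)
  show verts: "flat z \<in> verts ?K" for z by (simp add: K flat_def vtx_verts)
  fix i j
  show "{flat (i, j), flat (i + 1, j)} \<in> edges ?K" "{flat (i, j), flat (i, j + 1)} \<in> edges ?K"
    by (simp_all add: K flat_edges)
  let ?c = "[flat (i, j), flat (i + 1, j), flat (i + 1, j + 1), flat (i, j + 1), flat (i, j)]"
  have "distinct [flat (i, j), flat (i + 1, j), flat (i + 1, j + 1), flat (i, j + 1)]"
    using lozenge_distinct[of "flat_elt (i, j)"] unfolding flat_step by (simp add: flat_def)
  moreover have "edge_path ?K ?c"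
    using verts flat_edges[of i j] flat_edges(1)[of i "j + 1"] flat_edges(2)[of "i + 1" j]
    by (simp add: edge_path_def K insert_commute)
  moreover have "lozenge (flat_elt (i, j)) \<in> faces ?K"
    using assms lozenge_face by (simp add: K)
  ultimately have "boundary_cycle ?K (lozenge (flat_elt (i, j))) ?c"
    unfolding boundary_cycle_def lozenge_flat by auto
  then show "\<exists>C. boundary_cycle ?K C ?c" ..
qed

section \<open>Flat subgroups of the semidirect products\<close>

lemma flat_elt_pow: "flat_elt (i, j) [^]\<^bsub>B4\<^esub> (n::int) = flat_elt (n * i, n * j)"
proof (induction n rule: int_induct[where k = 0])
  case base then show ?case by (simp add: flat_elt_simps)
next
  case (step1 n)
  have "flat_elt (i, j) [^]\<^bsub>B4\<^esub> (n + 1) = flat_elt (n * i, n * j) \<otimes>\<^bsub>B4\<^esub> flat_elt (i, j)"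
    by (simp add: B4.int_pow_mult step1 B4.int_pow_1)
  then show ?case by (simp add: flat_elt_add[symmetric] algebra_simps)
next
  case (step2 n)
  have "inv\<^bsub>B4\<^esub> (flat_elt (i, j)) = flat_elt (- i, - j)"
    by (rule B4.inv_equality) (simp_all add: flat_elt_add[symmetric] flat_elt_simps zero_prod_def)
  then have "flat_elt (i, j) [^]\<^bsub>B4\<^esub> (n - 1) = flat_elt (n * i, n * j) \<otimes>\<^bsub>B4\<^esub> flat_elt (- i, - j)"
    by (simp add: B4.int_pow_diff step2 B4.int_pow_1)
  then show ?case by (simp add: flat_elt_add[symmetric] algebra_simps)
qed

abbreviation x_pow :: "int \<Rightarrow> F2_elt" where "x_pow n \<equiv> F2_x [^]\<^bsub>F2\<^esub> n"

text \<open>Conjugation by x has coordinates (1, -1) in the flat and \<open>alpha\<close> has (0,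
  -2). These vectors span a sublattice of index 2, the source of the factor 2 in
  \<open>2 * k * m\<close>.\<close>

lemma sd_braid_x_pow: "sd_braid (x_pow a) (x_pow b) = flat_elt (a, - a - 2 * b)"
proof -
  have 1: "flat_elt (1, -1) = braid_x" "flat_elt (0, -2) = braid_alpha"
  proof -
    have "flat_elt (0, -1) = inv\<^bsub>B4\<^esub> s3"
      by (simp add: flat_elt_def B4.int_pow_neg B4.int_pow_1)
    moreover have "flat_elt (1, -1) = flat_elt (1, 0) \<otimes>\<^bsub>B4\<^esub> flat_elt (0, -1)"
      "flat_elt (0, -2) = flat_elt (0, -1) \<otimes>\<^bsub>B4\<^esub> flat_elt (0, -1)"
      by (simp_all add: flat_elt_add[symmetric])
    ultimately show "flat_elt (1, -1) = braid_x" "flat_elt (0, -2) = braid_alpha"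
      by (simp_all add: flat_elt_simps)
  qed
  have "sd_braid (x_pow a) (x_pow b) = braid_x [^]\<^bsub>B4\<^esub> a \<otimes>\<^bsub>B4\<^esub> braid_alpha [^]\<^bsub>B4\<^esub> b"
    by (simp add: sd_braid_def F2_in_B4.hom_int_pow twist_braid.hom_int_pow F2_in_B4_x twist_braid_x)
  also have "\<dots> = flat_elt (a, - a) \<otimes>\<^bsub>B4\<^esub> flat_elt (0, - 2 * b)"
    unfolding 1[symmetric] flat_elt_pow by (simp add: mult.commute)
  finally show ?thesis by (simp add: flat_elt_add[symmetric])
qed

lemma twist_x_pow_x: "twist (x_pow n) F2_x = F2_x"
proof (induction n rule: int_induct[where k = 0])
  case base then show ?case by (simp add: AutoGroup_one)
next
  case (step1 n)
  have "twist (x_pow (n + 1)) = twist (x_pow n) \<otimes>\<^bsub>AutF2\<^esub> alpha"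
    by (simp add: F2.int_pow_mult F2.int_pow_1 twist_x)
  then show ?case
    using step1 AutoGroup_mult_apply[OF twist_auto alpha_auto, of "x_pow n" F2_x]
    by (simp add: alpha_def F2.F2_hom_gen)
next
  case (step2 n)
  have "twist (x_pow n) = twist (x_pow (n - 1)) \<otimes>\<^bsub>AutF2\<^esub> alpha"
    using F2.int_pow_mult[of F2_x "n - 1" 1] twist.hom_mult[of "x_pow (n - 1)" F2_x]
    by (simp add: F2.int_pow_1 twist_x)
  then show ?case
    using step2 AutoGroup_mult_apply[OF twist_auto alpha_auto, of "x_pow (n - 1)" F2_x]
    by (simp add: alpha_def F2.F2_hom_gen)
qed

lemma twist_hom: "u \<in> carrier F2 \<Longrightarrow> group_hom F2 F2 (twist u)"
  using auto_hom[OF twist_auto] by (simp add: group_hom_def group_hom_axioms_def group_F2)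

lemma twist_x_pow_x_pow: "twist (x_pow n) (x_pow m) = x_pow m"
  using group_hom.hom_int_pow[OF twist_hom, of "x_pow n" F2_x m] by (simp add: twist_x_pow_x)

text \<open>Since \<open>alpha\<close> fixes x, the twisting in \<open>sd_mult\<close> disappears
  and exponents simply add.\<close>

lemma sd_x_pow_mult:
  "sd (x_pow a) (x_pow b) \<otimes>\<^bsub>AutF2\<^esub> sd (x_pow a') (x_pow b') = sd (x_pow (a + a')) (x_pow (b + b'))"
  by (simp add: sd_mult twist_x_pow_x_pow F2.int_pow_mult)

lemma sanov_x_pow: "sanov (x_pow n) = (1, 2 * n, 0, 1)"
proof (induction n rule: int_induct[where k = 0])
  case base then show ?case by (simp add: SL2Z_one)
next
  case (step1 n)
  then show ?case
    using sanov.hom_mult[of "x_pow n" F2_x]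
    by (simp add: F2.int_pow_mult F2.int_pow_1 sanov_x SL2Z_mult)
next
  case (step2 n)
  have "sanov (x_pow (n - 1)) = sanov (x_pow n) \<otimes>\<^bsub>SL2Z\<^esub> inv\<^bsub>SL2Z\<^esub> sanov_x"
    using sanov.hom_mult[of "x_pow n" "inv\<^bsub>F2\<^esub> F2_x"]
    by (simp add: F2.int_pow_diff F2.int_pow_1 sanov_x)
  then show ?case using step2 by (simp add: SL2Z_mult SL2Z_inv)
qed

lemma twist_x_pow_y: "twist (x_pow n) F2_y = x_pow (2 * n) \<otimes>\<^bsub>F2\<^esub> F2_y"
proof -
  have step: "twist (x_pow (n + 1)) F2_y = x_pow 2 \<otimes>\<^bsub>F2\<^esub> twist (x_pow n) F2_y" for n
  proof -
    interpret t: group_hom F2 F2 "twist (x_pow n)" by (rule twist_hom) simp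
    have "twist (x_pow (n + 1)) F2_y = twist (x_pow n) (alpha F2_y)"
      using AutoGroup_mult_apply[OF twist_auto alpha_auto, of "x_pow n" F2_y]
      by (simp add: F2.int_pow_mult F2.int_pow_1 twist_x)
    also have "\<dots> = x_pow 2 \<otimes>\<^bsub>F2\<^esub> twist (x_pow n) F2_y"
      using F2.int_pow_mult[of F2_x 1 1]
      by (simp add: alpha_def F2.F2_hom_gen twist_x_pow_x F2.int_pow_1 F2.m_assoc)
    finally show ?thesis .
  qed
  show ?thesis
  proof (induction n rule: int_induct[where k = 0])
    case base then show ?case by (simp add: AutoGroup_one)
  next
    case (step1 n)
    then show ?case
      using step[of n] F2.int_pow_mult[of F2_x 2 "2 * n"] by (simp add: F2.m_assoc[symmetric] algebra_simps)
  next
    case (step2 n)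
    let ?t = "twist (x_pow (n - 1)) F2_y"
    have t: "?t \<in> carrier F2" by (rule auto_closed[OF twist_auto]) simp_all
    have "x_pow 2 \<otimes>\<^bsub>F2\<^esub> ?t = x_pow 2 \<otimes>\<^bsub>F2\<^esub> (x_pow (2 * (n - 1)) \<otimes>\<^bsub>F2\<^esub> F2_y)"
      using step[of "n - 1"] step2 F2.int_pow_mult[of F2_x 2 "2 * (n - 1)"]
      by (simp add: F2.m_assoc[symmetric] algebra_simps)
    then show ?case by (rule F2.l_cancel) (simp_all add: t)
  qed
qed

text \<open>The pair of exponents is recovered from the Sanov matrix of the image of \<open>y\<close>.\<close>

lemma sd_x_pow_inj:
  assumes "sd (x_pow a) (x_pow b) = sd (x_pow a') (x_pow b')"
  shows "a = a' \<and> b = b'"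
proof -
  have "sd (x_pow a) (x_pow b) F2_y =
      x_pow a \<otimes>\<^bsub>F2\<^esub> (x_pow (2 * b) \<otimes>\<^bsub>F2\<^esub> F2_y) \<otimes>\<^bsub>F2\<^esub> x_pow (- a)" for a b
    unfolding sd_def
    by (subst AutoGroup_mult_apply)
      (simp_all add: F2.inner_aut_auto twist_auto twist_x_pow_y F2.inner_aut_apply F2.int_pow_neg)
  \<comment> \<open>In the matrix of x^(a + 2 b) y x^(-a) the lower right entry determines a, and
    the upper left entry then determines b.\<close>
  then have val: "sanov (sd (x_pow a) (x_pow b) F2_y) =
      (1 + 4 * (a + 2 * b), (1 + 4 * (a + 2 * b)) * - 2 * a + 2 * (a + 2 * b), 2, 1 - 4 * a)" for a b
    by (simp add: sanov_x_pow sanov_y SL2Z_mult algebra_simps)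
  show ?thesis using val[of a b] val[of a' b'] assms by simp
qed


section \<open>Orbits of faces\<close>

definition face_orbit where
  "face_orbit act H C = {act h ` C | h. h \<in> H}"

lemma face_orbits_eq: "face_orbits act H = face_orbit act H ` faces brady_complex"
  by (auto simp: face_orbits_def face_orbit_def)

locale brady =
  fixes act :: "(F2_elt \<Rightarrow> F2_elt) \<Rightarrow> brady_vertex \<Rightarrow> brady_vertex"
  assumes action: "brady_action act"
begin

lemma act_hom: "group_hom AutF2 (BijGroup brady_verts) act"
  using action by (simp add: brady_action_def group_action_def)

lemma act_verts: "g \<in> carrier AutF2 \<Longrightarrow> v \<in> brady_verts \<Longrightarrow> act g v \<in> brady_verts"
  using group_hom.hom_closed[OF act_hom] by (auto simp: BijGroup_def dest: Bij_imp_funcset)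

lemma act_mult:
  assumes "g \<in> carrier AutF2" "h \<in> carrier AutF2" "v \<in> brady_verts"
  shows "act (g \<otimes>\<^bsub>AutF2\<^esub> h) v = act g (act h v)"
  using group_hom.hom_mult[OF act_hom assms(1,2)] group_hom.hom_closed[OF act_hom] assms
  by (simp add: BijGroup_def compose_def)

lemma act_one: "v \<in> brady_verts \<Longrightarrow> act \<one>\<^bsub>AutF2\<^esub> v = v"
  using group_hom.hom_one[OF act_hom] by (simp add: BijGroup_def)

lemma act_mult_image:
  assumes "g \<in> carrier AutF2" "h \<in> carrier AutF2" "C \<subseteq> brady_verts"
  shows "act (g \<otimes>\<^bsub>AutF2\<^esub> h) ` C = act g ` act h ` C"
  unfolding image_image using assms act_mult by (intro image_cong HOL.refl) blast

lemma act_inv_image: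
  assumes "g \<in> carrier AutF2" "C \<subseteq> brady_verts"
  shows "act (inv\<^bsub>AutF2\<^esub> g) ` act g ` C = C"
proof -
  have "act (inv\<^bsub>AutF2\<^esub> g) ` act g ` C = act \<one>\<^bsub>AutF2\<^esub> ` C"
    using act_mult_image[of "inv\<^bsub>AutF2\<^esub> g" g C] assms by simp
  also have "\<dots> = (\<lambda>v. v) ` C"
    using assms(2) act_one by (intro image_cong HOL.refl) blast
  finally show ?thesis by simp
qed

lemma act_inj: "g \<in> carrier AutF2 \<Longrightarrow> inj_on (act g) brady_verts"
  using group_hom.hom_closed[OF act_hom] by (auto simp: BijGroup_def Bij_def bij_betw_def)

lemma act_cells:
  assumes "g \<in> carrier AutF2"
  shows "C \<in> faces brady_complex \<Longrightarrow> act g ` C \<in> faces brady_complex"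
    and "e \<in> edges brady_complex \<Longrightarrow> act g ` e \<in> edges brady_complex"
proof -
  have "cell_auto brady_complex (act g)"
    using action assms by (simp add: brady_action_def brady_isometry_def)
  then have "(\<lambda>C. act g ` C) ` faces brady_complex = faces brady_complex"
    "(\<lambda>C. act g ` C) ` edges brady_complex = edges brady_complex"
    by (simp_all add: cell_auto_def)
  then show "C \<in> faces brady_complex \<Longrightarrow> act g ` C \<in> faces brady_complex"
    "e \<in> edges brady_complex \<Longrightarrow> act g ` e \<in> edges brady_complex"
    by (metis imageI)+
qed

lemma act_sd_vtx:
  assumes "w \<in> carrier F2" "u \<in> carrier F2" "g \<in> carrier B4"
  shows "act (sd w u) (vtx g) = vtx (sd_braid w u \<otimes>\<^bsub>B4\<^esub> g)"
  using brady_action_sd[OF action assms(1,2) vtx_verts[OF assms(3)]] vtx_mult sd_braid_carrier assms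
  by simp

lemma act_sd_lozenge:
  assumes "w \<in> carrier F2" "u \<in> carrier F2" "g \<in> carrier B4"
  shows "act (sd w u) ` lozenge g = lozenge (sd_braid w u \<otimes>\<^bsub>B4\<^esub> g)"
  using assms sd_braid_carrier[OF assms(1,2)] by (simp add: lozenge_def act_sd_vtx B4.m_assoc)

lemma lozenge_verts: "g \<in> carrier B4 \<Longrightarrow> lozenge g \<subseteq> brady_verts"
  by (simp add: lozenge_def vtx_verts)

end

locale brady_subgroup = brady +
  fixes H
  assumes H: "subgroup H AutF2"
begin

lemma H_carrier: "h \<in> H \<Longrightarrow> h \<in> carrier AutF2"
  using subgroup.subset[OF H] by blast

lemma face_orbit_act:
  assumes "g \<in> H" "C \<subseteq> brady_verts"
  shows "face_orbit act H (act g ` C) = face_orbit act H C"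
proof -
  have sub: "face_orbit act H (act g ` C) \<subseteq> face_orbit act H C" if "g \<in> H" "C \<subseteq> brady_verts" for g C
  proof
    fix D assume "D \<in> face_orbit act H (act g ` C)"
    then obtain h where "h \<in> H" "D = act h ` act g ` C" by (auto simp: face_orbit_def)
    then have "D = act (h \<otimes>\<^bsub>AutF2\<^esub> g) ` C" "h \<otimes>\<^bsub>AutF2\<^esub> g \<in> H"
      using that by (simp_all add: act_mult_image H_carrier subgroup.m_closed[OF H])
    then show "D \<in> face_orbit act H C" by (auto simp: face_orbit_def)
  qed
  have "act g ` C \<subseteq> brady_verts" using assms act_verts H_carrier by blast
  from sub[OF subgroup.m_inv_closed[OF H assms(1)] this]
  have "face_orbit act H C \<subseteq> face_orbit act H (act g ` C)"
    using assms by (simp add: act_inv_image H_carrier)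
  with sub[OF assms] show ?thesis by blast
qed

lemma face_orbit_self: "C \<subseteq> brady_verts \<Longrightarrow> C \<in> face_orbit act H C"
proof -
  assume "C \<subseteq> brady_verts"
  then have "act \<one>\<^bsub>AutF2\<^esub> ` C = (\<lambda>v. v) ` C"
    using act_one by (intro image_cong HOL.refl) blast
  then show ?thesis
    unfolding face_orbit_def mem_Collect_eq
    using subgroup.one_closed[OF H] by (intro exI[of _ "\<one>\<^bsub>AutF2\<^esub>"]) simp
qed

lemma face_orbits_act_mem:
  assumes "O' \<in> face_orbits act H" "act g ` C \<in> O'" "g \<in> H" "C \<subseteq> brady_verts"
  shows "O' = face_orbit act H C"
proof -
  obtain D where D: "O' = face_orbit act H D" "D \<in> faces brady_complex"
    using assms(1) by (auto simp: face_orbits_eq)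
  then obtain h where h: "h \<in> H" "act g ` C = act h ` D" using assms(2) by (auto simp: face_orbit_def)
  have "face_orbit act H D = face_orbit act H (act h ` D)"
    using face_orbit_act[OF h(1) brady_faces_verts[OF D(2)]] by simp
  also have "\<dots> = face_orbit act H C"
    unfolding h(2)[symmetric] by (rule face_orbit_act[OF assms(3,4)])
  finally show ?thesis using D by simp
qed

lemma face_orbits_mem:
  assumes "O' \<in> face_orbits act H" "C \<in> O'" "C \<subseteq> brady_verts"
  shows "O' = face_orbit act H C"
proof -
  have "act \<one>\<^bsub>AutF2\<^esub> ` C = (\<lambda>v. v) ` C"
    using assms(3) act_one by (intro image_cong HOL.refl) blast
  then show ?thesis
    using assms by (intro face_orbits_act_mem[of _ "\<one>\<^bsub>AutF2\<^esub>"] subgroup.one_closed[OF H]) simp_all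
qed

end

text \<open>In the application x^k lies in \<open>A p\<close> and x^m in \<open>B p\<close>, so the
  subgroup contains all products of powers of conjugation by x^k with powers of the m-th power of
  \<open>alpha\<close>.\<close>

locale brady_flat = brady_subgroup +
  fixes k m :: nat
  assumes km: "k > 0" "m > 0"
    and flat_H: "\<And>i j. sd (x_pow (int k * i)) (x_pow (int m * j)) \<in> H"
begin

definition flat_trans :: "int \<times> int \<Rightarrow> F2_elt \<Rightarrow> F2_elt" where
  "flat_trans z = sd (x_pow (int k * fst z)) (x_pow (int m * snd z))"

text \<open>The coordinates of the braid by which \<open>flat_trans z\<close> acts, taken from
  \<open>sd_braid_x_pow\<close>.\<close>

definition flat_shift :: "int \<times> int \<Rightarrow> int \<times> int" where
  "flat_shift z = (int k * fst z, - int k * fst z - 2 * int m * snd z)"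

lemma flat_trans_H: "flat_trans z \<in> H"
  by (simp add: flat_trans_def flat_H)

lemma flat_trans_add: "flat_trans (z + w) = flat_trans z \<otimes>\<^bsub>AutF2\<^esub> flat_trans w"
  by (simp add: flat_trans_def sd_x_pow_mult distrib_left)

lemma flat_trans_0: "flat_trans (0, 0) = \<one>\<^bsub>AutF2\<^esub>"
proof -
  have "flat_trans (0, 0) \<otimes>\<^bsub>AutF2\<^esub> flat_trans (0, 0) = flat_trans (0, 0)"
    by (simp add: flat_trans_add[symmetric])
  then show ?thesis using H_carrier[OF flat_trans_H] by (metis AutF2.l_cancel_one')
qed

lemma inj_flat_trans: "inj flat_trans"
proof (rule injI)
  fix z w assume "flat_trans z = flat_trans w"
  then have "int k * fst z = int k * fst w \<and> int m * snd z = int m * snd w"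
    unfolding flat_trans_def by (rule sd_x_pow_inj)
  then show "z = w" using km by (simp add: prod_eq_iff)
qed

lemma flat_shift_add: "flat_shift (z + w) = flat_shift z + flat_shift w"
  by (simp add: flat_shift_def algebra_simps)

lemma act_flat_trans_flat: "act (flat_trans z) (flat w) = flat (w + flat_shift z)"
proof -
  have "act (flat_trans z) (flat w) = vtx (flat_elt (flat_shift z) \<otimes>\<^bsub>B4\<^esub> flat_elt w)"
    by (simp add: flat_trans_def flat_def act_sd_vtx sd_braid_x_pow flat_shift_def algebra_simps)
  then show ?thesis by (simp add: flat_add add.commute)
qed

lemma act_flat_trans_lozenge:
  "act (flat_trans z) ` lozenge (flat_elt w) = lozenge (flat_elt (w + flat_shift z))"
proof -
  have "act (flat_trans z) ` lozenge (flat_elt w) = lozenge (flat_elt (flat_shift z) \<otimes>\<^bsub>B4\<^esub> flat_elt w)"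
    by (simp add: flat_trans_def act_sd_lozenge sd_braid_x_pow flat_shift_def algebra_simps)
  then show ?thesis by (simp add: flat_elt_add[symmetric] add.commute)
qed

definition flat_orbits :: "brady_vertex set set set" where
  "flat_orbits = range (\<lambda>z. face_orbit act H (lozenge (flat_elt z)))"

text \<open>The shifts form the lattice spanned by (k, -k) and (0, -2 m), and a rectangle of k times
  2 m points meets every class modulo this lattice.\<close>

lemma flat_orbits_bound: "finite flat_orbits \<and> card flat_orbits \<le> 2 * k * m"
proof -
  let ?D = "{0..<int k} \<times> {0..<2 * int m}"
  let ?f = "\<lambda>z. face_orbit act H (lozenge (flat_elt z))"
  have "flat_orbits \<subseteq> ?f ` ?D"
  proof
    fix O' assume "O' \<in> flat_orbits"
    then obtain a b where O': "O' = ?f (a, b)" by (auto simp: flat_orbits_def)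
    \<comment> \<open>The shift by \<open>i\<close> also lowers the second coordinate by
      \<open>int k * i\<close>, which is added back before the division by \<open>2 * int m\<close>.
      The minus sign in \<open>j\<close> matches the one in \<open>flat_shift\<close>.\<close>
    define i r j s where d: "i = a div int k" "r = a mod int k"
      "j = - ((b + int k * i) div (2 * int m))" "s = (b + int k * i) mod (2 * int m)"
    have "int k * i + r = a" "- (2 * int m * j) + s = b + int k * i"
      unfolding d by (simp_all only: mult_div_mod_eq minus_mult_right[symmetric] minus_minus)
    then have "(a, b) = (r, s) + flat_shift (i, j)"
      by (simp add: flat_shift_def)
    then have "O' = ?f (r, s)"
      using face_orbit_act[OF flat_trans_H lozenge_verts, of "flat_elt (r, s)" "(i, j)"]
      by (simp add: O' act_flat_trans_lozenge)
    moreover have "(r, s) \<in> ?D" using km by (simp add: d)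
    ultimately show "O' \<in> ?f ` ?D" by blast
  qed
  moreover have "card (?f ` ?D) \<le> card ?D" by (rule card_image_le) simp
  ultimately show ?thesis
    using card_mono[of "?f ` ?D" flat_orbits] finite_subset[of flat_orbits "?f ` ?D"]
    by (simp add: card_cartesian_product nat_mult_distrib mult.assoc mult.left_commute)
qed

text \<open>As no lozenge of the flat is removed, the flat lifts to the universal cover, and the
  translations of the flat lift to transformations that preserve this lift.\<close>

lemma Z2_embeds_density_group:
  assumes sub: "\<A> \<subseteq> face_orbits act H" and disj: "\<A> \<inter> flat_orbits = {}"
  shows "Z2_embeds (density_group act H \<A>)"
proof -
  let ?K = "remove_faces brady_complex \<A>"
  have K: "verts ?K = brady_verts" "edges ?K = edges brady_complex"
    "faces ?K = faces brady_complex - \<Union>\<A>"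
    by (simp_all add: remove_faces_def brady_complex_def)
  have "lozenge (flat_elt z) \<notin> \<Union>\<A>" for z
  proof
    assume "lozenge (flat_elt z) \<in> \<Union>\<A>"
    then obtain O' where O': "O' \<in> \<A>" "lozenge (flat_elt z) \<in> O'" by blast
    then have "O' = face_orbit act H (lozenge (flat_elt z))"
      using sub by (intro face_orbits_mem lozenge_verts) auto
    then show False using disj O' by (auto simp: flat_orbits_def)
  qed
  then interpret plane ?K flat by (rule flat_plane)
  have g: "flat_trans z \<in> carrier AutF2" for z by (rule H_carrier[OF flat_trans_H])
  interpret plane_action ?K flat "\<lambda>z. act (flat_trans z)" flat_shift
  proof
    fix z w v
    show "act (flat_trans z) (flat w) = flat (w + flat_shift z)" by (rule act_flat_trans_flat)
    show "flat_shift (z + w) = flat_shift z + flat_shift w" by (rule flat_shift_add)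
    assume "v \<in> verts ?K"
    then have v: "v \<in> brady_verts" by (simp add: K)
    show "act (flat_trans z) v \<in> verts ?K" using act_verts[OF g v] by (simp add: K)
    show "act (flat_trans (z + w)) v = act (flat_trans z) (act (flat_trans w) v)"
      by (simp only: flat_trans_add act_mult[OF g g v])
    show "act (flat_trans (0, 0)) v = v" by (simp only: flat_trans_0 act_one[OF v])
  next
    fix z e assume "e \<in> edges ?K"
    then show "act (flat_trans z) ` e \<in> edges ?K" using act_cells(2)[OF g] by (simp add: K)
  next
    fix e assume "e \<in> edges ?K"
    then show "e \<subseteq> verts ?K" using brady_edges_verts by (simp add: K)
  next
    fix z C c assume bc: "boundary_cycle ?K C c"
    let ?g = "act (flat_trans z)"
    have c: "c \<noteq> []" "set c \<subseteq> brady_verts" "successively (\<lambda>a b. {a, b} \<in> edges ?K) c"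
      "hd c = last c" "distinct (tl c)" "set (tl c) = C" "C \<in> faces brady_complex" "C \<notin> \<Union>\<A>"
      using bc by (auto simp: boundary_cycle_def edge_path_def K)
    have C: "C \<subseteq> brady_verts" by (rule brady_faces_verts[OF c(7)])
    \<comment> \<open>The removed faces form a union of orbits, so no surviving face can be moved
      into it.\<close>
    have "?g ` C \<notin> \<Union>\<A>"
    proof
      assume "?g ` C \<in> \<Union>\<A>"
      then obtain O' where O': "O' \<in> \<A>" "?g ` C \<in> O'" by blast
      then have "O' = face_orbit act H C"
        using sub by (intro face_orbits_act_mem[OF _ _ flat_trans_H C]) auto
      then show False using face_orbit_self[OF C] O' c(8) by blast
    qed
    moreover have "successively (\<lambda>a b. {?g a, ?g b} \<in> edges ?K) c"
      by (rule successively_mono[OF c(3)]) (use act_cells(2)[OF g] in \<open>fastforce simp: K\<close>)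
    moreover have "?g ` set c \<subseteq> brady_verts" using c(2) act_verts[OF g] by blast
    moreover have "distinct (map ?g (tl c))"
      using c(5,6) C inj_on_subset[OF act_inj[OF g]] by (simp add: distinct_map)
    ultimately show "boundary_cycle ?K (?g ` C) (map ?g c)"
      using c act_cells(1)[OF g c(7)]
      by (simp add: boundary_cycle_def edge_path_def K successively_map hd_map last_map map_tl[symmetric])
  qed
  have "Z2_embeds (lift_group ?K (flat (0, 0)) (AutF2\<lparr>carrier := H\<rparr>) act)"
  proof (rule Z2_embeds_lift_group)
    show "flat_trans z \<in> carrier (AutF2\<lparr>carrier := H\<rparr>)" for z by (simp add: flat_trans_H)
    show "flat_trans (z + w) = flat_trans z \<otimes>\<^bsub>AutF2\<lparr>carrier := H\<rparr>\<^esub> flat_trans w" for z w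
      by (simp add: flat_trans_add)
  qed (simp_all add: inj_flat_trans)
  then show ?thesis by (simp add: density_group_def flat_def flat_elt_simps vtx_one)
qed

end

section \<open>Lower bound for the number of orbits\<close>

lemma mu_delta_powers:
  "v \<in> Delta_B \<Longrightarrow> mu v \<in> {(1, 0, 0, 1), (-1, -2, 1, 1), (-1, 0, 0, -1), (1, 2, -1, -1)}"
  unfolding Delta_B_def
proof (induction rule: generate.induct)
  case (inv h) then show ?case by (simp add: mu_values SL2Z_inv)
next
  case (eng h1 h2)
  have "h1 \<in> carrier B4" "h2 \<in> carrier B4"
    using eng B4.generate_in_carrier[of "{delta_B}"] by simp_all
  with eng.IH show ?case
    unfolding insert_iff empty_iff simp_thms
    by (elim disjE) (simp_all add: SL2Z_mult)
qed (simp_all add: mu_values SL2Z_one)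

text \<open>Products of the matrices of \<open>1\<close>, \<open>\<sigma>1\<close>, \<open>\<sigma>1 \<sigma>3\<close>, \<open>\<sigma>3\<close> with those of the powers of the dual Garside
  element; they contain the matrices of the stabilizer of the lozenge at the base vertex.\<close>

definition lozenge_matrices :: "(int \<times> int \<times> int \<times> int) set" where
  "lozenge_matrices = (\<lambda>(M, M'). M \<otimes>\<^bsub>SL2Z\<^esub> M') `
     ({(1, 0, 0, 1), (1, -1, 0, 1), (1, -2, 0, 1)} \<times>
      {(1, 0, 0, 1), (-1, -2, 1, 1), (-1, 0, 0, -1), (1, 2, -1, -1)})"

text \<open>Four corners give three matrices, because \<open>s1\<close> and \<open>s3\<close> have
  the same image. The other factor consists of the four powers of \<open>mu delta_B\<close>, whose
  square is minus the identity. This is the origin of the constant 12.\<close>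

lemma card_lozenge_matrices: "finite lozenge_matrices" "card lozenge_matrices \<le> 12"
proof -
  let ?S = "{(1, 0, 0, 1), (1, -1, 0, 1), (1, -2, 0, 1)} \<times>
      {(1, 0, 0, 1), (-1, -2, 1, 1), (-1, 0, 0, -1), (1, 2, -1, -1)} ::
      ((int \<times> int \<times> int \<times> int) \<times> int \<times> int \<times> int \<times> int) set"
  show "finite lozenge_matrices" by (simp add: lozenge_matrices_def)
  have "card lozenge_matrices \<le> card ?S"
    unfolding lozenge_matrices_def by (rule card_image_le) simp
  also have "\<dots> = 12" by (simp add: card_cartesian_product)
  finally show "card lozenge_matrices \<le> 12" .
qed

lemma mu_lozenge:
  assumes "h \<in> carrier B4" "vtx h \<in> lozenge \<one>\<^bsub>B4\<^esub>"
  shows "mu h \<in> lozenge_matrices"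
proof -
  have "\<exists>s\<in>{\<one>\<^bsub>B4\<^esub>, s1, s1 \<otimes>\<^bsub>B4\<^esub> s3, s3}. vtx s = vtx h"
    using assms(2) by (auto simp: lozenge_def)
  then obtain s where s: "s \<in> {\<one>\<^bsub>B4\<^esub>, s1, s1 \<otimes>\<^bsub>B4\<^esub> s3, s3}" "vtx s = vtx h" by blast
  have sc: "s \<in> carrier B4" using s(1) by auto
  obtain v where v: "v \<in> Delta_B" "h = s \<otimes>\<^bsub>B4\<^esub> v"
    using vtx_eqD[OF s(2) sc assms(1)] by blast
  have "mu h = mu s \<otimes>\<^bsub>SL2Z\<^esub> mu v"
    unfolding v(2) by (rule mu.hom_mult[OF sc Delta_carrier[OF v(1)]])
  moreover have "mu s \<in> {(1, 0, 0, 1), (1, -1, 0, 1), (1, -2, 0, 1)}"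
    using s(1) by (auto simp: mu_values SL2Z_one SL2Z_mult)
  ultimately show ?thesis
    unfolding lozenge_matrices_def using mu_delta_powers[OF v(1)]
    by (intro image_eqI[of _ _ "(mu s, mu v)"] SigmaI) simp_all
qed

text \<open>Each \<open>u\<close> moves the lozenge at the base vertex into some orbit. If
  \<open>u\<close> and \<open>u'\<close> lead to the same orbit, then u' = b u v^-1 with b in
  \<open>B\<close> and v the twist part of an element that preserves the lozenge. Its matrix lies in
  \<open>lozenge_matrices\<close>, and \<open>sanov\<close> is injective, so an orbit receives at
  most 12 cosets of \<open>B\<close>.\<close>

lemma (in brady) card_cosets_le_orbits:
  assumes A: "characteristic_subgroup A F2" and B: "subgroup B F2"
    and fin: "finite (face_orbits act (semidirect_Aut A B))"
  shows "card (rcosets\<^bsub>F2\<^esub> B) \<le> 12 * card (face_orbits act (semidirect_Aut A B))"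
proof -
  let ?H = "semidirect_Aut A B" and ?C = "lozenge \<one>\<^bsub>B4\<^esub>"
  interpret brady_subgroup act ?H
    by (intro brady_subgroup.intro brady_axioms brady_subgroup_axioms.intro semidirect_Aut_subgroup A B)
  define \<Phi> where "\<Phi> u = face_orbit act ?H (act (sd \<one>\<^bsub>F2\<^esub> u) ` ?C)" for u
  define Z where "Z = {v \<in> carrier F2. sanov v \<in> lozenge_matrices}"
  have C: "?C \<subseteq> brady_verts" by (rule lozenge_verts) simp
  have cardZ: "finite Z" "card Z \<le> 12"
  proof -
    have inj: "inj_on sanov Z" using sanov_inj by (rule inj_on_subset) (auto simp: Z_def)
    have sub: "sanov ` Z \<subseteq> lozenge_matrices" by (auto simp: Z_def)
    show "finite Z" by (rule inj_on_finite[OF inj sub card_lozenge_matrices(1)])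
    show "card Z \<le> 12"
      using card_inj_on_le[OF inj sub card_lozenge_matrices(1)] card_lozenge_matrices(2) by simp
  qed
  have fibre: "\<exists>v\<in>Z. B #>\<^bsub>F2\<^esub> u' = B #>\<^bsub>F2\<^esub> (u \<otimes>\<^bsub>F2\<^esub> inv\<^bsub>F2\<^esub> v)"
    if u: "u \<in> carrier F2" "u' \<in> carrier F2" and eq: "\<Phi> u = \<Phi> u'" for u u'
  proof -
    let ?g = "sd \<one>\<^bsub>F2\<^esub> u" and ?g' = "sd \<one>\<^bsub>F2\<^esub> u'"
    have g: "?g \<in> carrier AutF2" "?g' \<in> carrier AutF2" using u by (simp_all add: sd_carrier)
    have Cg: "act ?g ` ?C \<subseteq> brady_verts" "act ?g' ` ?C \<subseteq> brady_verts"
      using C act_verts g by blast+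
    have "act ?g' ` ?C \<in> \<Phi> u" unfolding eq unfolding \<Phi>_def by (rule face_orbit_self[OF Cg(2)])
    then obtain h where h: "h \<in> ?H" "act ?g' ` ?C = act h ` act ?g ` ?C"
      by (auto simp: \<Phi>_def face_orbit_def)
    then obtain w b where wb: "h = sd w b" "w \<in> A" "b \<in> B" by (auto simp: semidirect_Aut_eq)
    have wb': "w \<in> carrier F2" "b \<in> carrier F2"
      using wb A B by (auto simp: characteristic_subgroup_def dest: subgroup.mem_carrier)
    \<comment> \<open>The twist part of g'^-1 h g, which maps the base lozenge to itself.\<close>
    define v where "v = inv\<^bsub>F2\<^esub> u' \<otimes>\<^bsub>F2\<^esub> (b \<otimes>\<^bsub>F2\<^esub> u)"
    have v: "v \<in> carrier F2" using u wb' by (simp add: v_def)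
    have tw: "twist a w' \<in> carrier F2" if "a \<in> carrier F2" "w' \<in> carrier F2" for a w'
      using auto_closed[OF twist_auto[OF that(1)] that(2)] .
    \<comment> \<open>The inner part of the same product, expanded by \<open>sd_inv\<close> and
      \<open>sd_mult\<close>. Only its membership in \<open>F2\<close> is used, as
      \<open>mu_sd_braid\<close> forgets it.\<close>
    define w' where "w' = twist (inv\<^bsub>F2\<^esub> u') \<one>\<^bsub>F2\<^esub> \<otimes>\<^bsub>F2\<^esub>
      twist (inv\<^bsub>F2\<^esub> u') (w \<otimes>\<^bsub>F2\<^esub> twist b \<one>\<^bsub>F2\<^esub>)"
    have w': "w' \<in> carrier F2"
      "inv\<^bsub>AutF2\<^esub> ?g' \<otimes>\<^bsub>AutF2\<^esub> (h \<otimes>\<^bsub>AutF2\<^esub> ?g) = sd w' v"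
      using u wb' tw by (simp_all add: wb(1) sd_inv sd_mult v_def w'_def)
    have "act (sd w' v) ` ?C = act (inv\<^bsub>AutF2\<^esub> ?g') ` act h ` act ?g ` ?C"
      unfolding w'(2)[symmetric] using g C Cg H_carrier[OF h(1)] by (simp add: act_mult_image)
    also have "\<dots> = ?C"
      unfolding h(2)[symmetric] by (rule act_inv_image[OF g(2) C])
    finally have "lozenge (sd_braid w' v) = ?C"
      using act_sd_lozenge[OF w'(1) v B4.one_closed] sd_braid_carrier[OF w'(1) v] by simp
    then have "vtx (sd_braid w' v) \<in> ?C" by (auto simp: lozenge_def)
    from mu_lozenge[OF sd_braid_carrier[OF w'(1) v] this] have "v \<in> Z"
      using v by (simp add: Z_def mu_sd_braid[OF w'(1) v])
    moreover have "u' = b \<otimes>\<^bsub>F2\<^esub> (u \<otimes>\<^bsub>F2\<^esub> inv\<^bsub>F2\<^esub> v)"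
      using u wb' by (simp add: v_def F2.inv_mult_group F2.m_assoc F2.mult_inv_cancel)
    then have "B #>\<^bsub>F2\<^esub> u' = B #>\<^bsub>F2\<^esub> b #>\<^bsub>F2\<^esub> (u \<otimes>\<^bsub>F2\<^esub> inv\<^bsub>F2\<^esub> v)"
      using u wb' v by (simp add: F2.coset_mult_assoc subgroup.subset[OF B])
    then have "B #>\<^bsub>F2\<^esub> u' = B #>\<^bsub>F2\<^esub> (u \<otimes>\<^bsub>F2\<^esub> inv\<^bsub>F2\<^esub> v)"
      using F2.coset_join2[OF wb'(2) B wb(3)] by simp
    ultimately show ?thesis by blast
  qed
  let ?O = "face_orbits act ?H"
  have \<Phi>_mem: "\<Phi> u \<in> ?O" if "u \<in> carrier F2" for u
    unfolding \<Phi>_def face_orbits_eq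
    using that by (intro imageI act_cells(1) lozenge_face sd_carrier) simp_all
  define R where "R o' = (\<lambda>u. B #>\<^bsub>F2\<^esub> u) ` {u \<in> carrier F2. \<Phi> u = o'}" for o'
  have R: "finite (R o') \<and> card (R o') \<le> 12" for o'
  proof (cases "{u \<in> carrier F2. \<Phi> u = o'} = {}")
    case True
    then have "R o' = {}" unfolding R_def by (simp only: image_empty)
    then show ?thesis by simp
  next
    case False
    then obtain u where u: "u \<in> carrier F2" "\<Phi> u = o'" by blast
    let ?f = "\<lambda>v. B #>\<^bsub>F2\<^esub> (u \<otimes>\<^bsub>F2\<^esub> inv\<^bsub>F2\<^esub> v)"
    have "R o' \<subseteq> ?f ` Z"
    proof
      fix D assume "D \<in> (R o')"
      then obtain u' where u': "u' \<in> carrier F2" "\<Phi> u' = o'" "D = B #>\<^bsub>F2\<^esub> u'"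
        by (auto simp: R_def)
      then obtain v where "v \<in> Z" "D = ?f v" using fibre[of u u'] u by auto
      then show "D \<in> ?f ` Z" by blast
    qed
    moreover have "card (?f ` Z) \<le> 12" using card_image_le[OF cardZ(1), of ?f] cardZ(2) by simp
    ultimately show ?thesis
      using card_mono[of "?f ` Z" "R o'"] finite_subset[of "R o'" "?f ` Z"] cardZ(1) by simp
  qed
  have "rcosets\<^bsub>F2\<^esub> B \<subseteq> (\<Union>o'\<in>?O. R o')"
  proof
    fix D assume "D \<in> rcosets\<^bsub>F2\<^esub> B"
    then obtain u where "u \<in> carrier F2" "D = B #>\<^bsub>F2\<^esub> u" by (auto simp: RCOSETS_def)
    then show "D \<in> (\<Union>o'\<in>?O. R o')" using \<Phi>_mem[of u] by (auto simp: R_def)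
  qed
  then have "card (rcosets\<^bsub>F2\<^esub> B) \<le> card (\<Union>o'\<in>?O. R o')"
    using R fin by (intro card_mono) auto
  also have "\<dots> \<le> (\<Sum>o'\<in>?O. card (R o'))" by (rule card_UN_le[OF fin])
  also have "\<dots> \<le> (\<Sum>o'\<in>?O. 12)" by (rule sum_mono) (use R in blast)
  finally show ?thesis by (simp add: mult.commute)
qed

section \<open>Exponents\<close>

text \<open>Rotating a list by its full length restores it, so listed points return; all other
  points are never moved.\<close>

lemma cycle_of_list_pow_length:
  assumes "distinct cs"
  shows "cycle_of_list cs ^^ length cs = id"
proof
  fix x
  show "(cycle_of_list cs ^^ length cs) x = id x"
  proof (cases "x \<in> set cs")
    case True
    have "map (cycle_of_list cs ^^ length cs) cs = cs"
      using cyclic_rotation[OF assms, of "length cs"] by simp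
    then have "map (cycle_of_list cs ^^ length cs) cs = map id cs" by simp
    with True show ?thesis by (simp only: map_eq_conv)
  next
    case False
    have "(cycle_of_list cs ^^ n) x = x" for n
      by (induction n) (simp_all add: id_outside_supp[OF False])
    then show ?thesis by simp
  qed
qed

lemma funpow_mult_id: "f ^^ m = id \<Longrightarrow> f ^^ (m * n) = id"
  by (induction n) (simp_all add: funpow_add)

text \<open>The product of the cycle lengths; a cycle of length \<open>d\<close> contributes \<open>d \<le> 2 ^ d\<close>.\<close>

lemma cycle_decomp_exponent:
  "cycle_decomp I p \<Longrightarrow> finite I \<and> p permutes I \<and> (\<exists>m>0. m \<le> 2 ^ card I \<and> p ^^ m = id)"
proof (induction rule: cycle_decomp.induct)
  case empty then show ?case by (intro conjI exI[of _ 1]) auto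
next
  case (comp I p cs)
  then obtain m where m: "m > 0" "m \<le> 2 ^ card I" "p ^^ m = id" and I: "finite I" "p permutes I"
    by blast
  let ?c = "cycle_of_list cs"
  have c: "?c permutes set cs" by (rule cycle_permutes)
  \<comment> \<open>The supports are disjoint: whatever one factor moves, the other fixes together
    with its image.\<close>
  have "?c (p x) = p (?c x)" for x
  proof (cases "x \<in> set cs")
    case True
    then have "?c x \<in> set cs" using permutes_in_image[OF c] by simp
    then have "p (?c x) = ?c x" "p x = x"
      using True comp.hyps I(2) by (auto intro!: permutes_not_in)
    then show ?thesis by simp
  next
    case False
    then have "?c x = x" by (rule permutes_not_in[OF c])
    moreover have "p x \<notin> set cs"
    proof (cases "x \<in> I")
      case True
      then have "p x \<in> I" using permutes_in_image[OF I(2)] by simp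
      then show ?thesis using comp.hyps by auto
    next
      case f: False
      then show ?thesis using False permutes_not_in[OF I(2) f] by simp
    qed
    then have "?c (p x) = p x" by (rule permutes_not_in[OF c])
    ultimately show ?thesis by simp
  qed
  then have comm: "?c \<circ> p = p \<circ> ?c" by (simp add: fun_eq_iff)
  have pow: "(?c \<circ> p) ^^ n = ?c ^^ n \<circ> p ^^ n" for n
  proof (induction n)
    case (Suc n)
    have swap: "p \<circ> ?c ^^ n = ?c ^^ n \<circ> p"
      by (induction n) (simp_all add: comm[symmetric] fun_eq_iff, metis comm comp_apply)
    have "(?c \<circ> p) ^^ Suc n = ?c \<circ> (p \<circ> ?c ^^ n) \<circ> p ^^ n"
      by (simp only: funpow.simps Suc.IH comp_assoc)
    also have "\<dots> = ?c ^^ Suc n \<circ> p ^^ Suc n"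
      by (simp only: swap funpow.simps comp_assoc)
    finally show ?case .
  qed simp
  \<comment> \<open>An empty cycle has length 0 and would make the exponent 0. The value 1 is taken
    instead and still respects the bound 2 ^ 0.\<close>
  define l where "l = max 1 (length cs)"
  have l: "?c ^^ l = id"
    using cycle_of_list_pow_length[OF comp.hyps(2)] by (cases cs) (auto simp: l_def max_def)
  have "l \<le> 2 ^ length cs"
    using less_exp[of "length cs"] by (simp add: l_def)
  then have "l * m \<le> 2 ^ length cs * 2 ^ card I" using m(2) by (rule mult_le_mono)
  also have "\<dots> = 2 ^ card (set cs \<union> I)"
    using comp.hyps I by (simp add: card_Un_disjoint distinct_card power_add)
  finally have "l * m \<le> 2 ^ card (set cs \<union> I)" .
  moreover have "(?c \<circ> p) ^^ (l * m) = id"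
    using funpow_mult_id[OF l, of m] funpow_mult_id[OF m(3), of l] by (simp add: pow mult.commute)
  moreover have "l * m > 0" using m by (simp add: l_def)
  moreover have "(?c \<circ> p) permutes (set cs \<union> I)"
    by (rule permutes_compose) (auto intro: permutes_subset[OF c] permutes_subset[OF I(2)])
  ultimately show ?case using I by blast
qed

lemma sym_group_nat_pow: "f [^]\<^bsub>sym_group n\<^esub> (m::nat) = f ^^ m"
proof (induction m)
  case (Suc m)
  then show ?case by (simp add: sym_group_mult funpow_swap1 fun_eq_iff)
qed (simp add: sym_group_one)

lemma (in normal) pow_mem_iff:
  assumes "x \<in> carrier G"
  shows "x [^] (n::nat) \<in> H \<longleftrightarrow> (H #> x) [^]\<^bsub>G Mod H\<^esub> n = \<one>\<^bsub>G Mod H\<^esub>"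
proof -
  interpret q: group_hom G "G Mod H" "\<lambda>a. H #> a"
    using r_coset_hom_Mod factorgroup_is_group
    by (simp add: group_hom_def group_hom_axioms_def is_group)
  have "(H #> x) [^]\<^bsub>G Mod H\<^esub> n = H #> x [^] n"
    using q.hom_nat_pow[OF assms, of n] by simp
  moreover have "H #> x [^] n = H \<longleftrightarrow> x [^] n \<in> H"
    using coset_join1[of H "x [^] n"] coset_join2[of "x [^] n" H] assms subset subgroup_axioms by auto
  ultimately show ?thesis by (simp add: FactGroup_def)
qed

lemma characteristic_subgroup_normal:
  assumes "group G" "characteristic_subgroup A G"
  shows "A \<lhd> G"
proof -
  interpret group G by fact
  have A: "subgroup A G" "\<And>\<phi>. \<phi> \<in> auto G \<Longrightarrow> \<phi> ` A = A"
    using assms(2) by (auto simp: characteristic_subgroup_def)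
  have "w \<otimes>\<^bsub>G\<^esub> u \<otimes>\<^bsub>G\<^esub> inv\<^bsub>G\<^esub> w \<in> A" if "w \<in> carrier G" "u \<in> A" for w u
    using A(2)[OF inner_aut_auto[OF that(1)]] that(2) subgroup.mem_carrier[OF A(1) that(2)]
    by (metis imageI inner_aut_apply)
  then show ?thesis using A(1) by (simp add: normal_inv_iff)
qed

text \<open>By Lagrange in the quotient the index itself is such an exponent, which suffices because
  the index of \<open>A p\<close> is at most exponential.\<close>

lemma exponent_finite_index:
  assumes "A \<lhd> F2" "finite (rcosets\<^bsub>F2\<^esub> A)"
  shows "\<exists>k. (k::nat) > 0 \<and> k \<le> card (rcosets\<^bsub>F2\<^esub> A) \<and> F2_x [^]\<^bsub>F2\<^esub> k \<in> A"
proof -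
  interpret normal A F2 by fact
  interpret Q: group "F2 Mod A" by (rule factorgroup_is_group)
  let ?k = "card (rcosets\<^bsub>F2\<^esub> A)"
  have mem: "A #>\<^bsub>F2\<^esub> F2_x \<in> carrier (F2 Mod A)"
    by (auto simp: FactGroup_def RCOSETS_def)
  have "Coset.order (F2 Mod A) = ?k" by (simp add: Coset.order_def FactGroup_def)
  then have "(A #>\<^bsub>F2\<^esub> F2_x) [^]\<^bsub>F2 Mod A\<^esub> ?k = \<one>\<^bsub>F2 Mod A\<^esub>"
    using Q.pow_order_eq_1[OF mem] by simp
  then have "F2_x [^]\<^bsub>F2\<^esub> ?k \<in> A" by (simp add: pow_mem_iff)
  moreover have "?k > 0" using assms(2) mem by (auto simp: card_gt_0_iff FactGroup_def)
  ultimately show ?thesis by blast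
qed

text \<open>Lagrange would give only \<open>fact p\<close>, which the union bound cannot absorb. The
  cycle lengths of the image of x give the exponential bound instead.\<close>

lemma exponent_sym_group:
  assumes "B \<lhd> F2" "F2 Mod B \<cong> sym_group p"
  shows "\<exists>m. (m::nat) > 0 \<and> m \<le> 2 ^ p \<and> F2_x [^]\<^bsub>F2\<^esub> m \<in> B"
    and "card (rcosets\<^bsub>F2\<^esub> B) = fact p"
proof -
  interpret normal B F2 by fact
  interpret Q: group "F2 Mod B" by (rule factorgroup_is_group)
  obtain \<psi> where \<psi>: "\<psi> \<in> iso (F2 Mod B) (sym_group p)" using assms(2) by (auto simp: is_iso_def)
  then have bij: "bij_betw \<psi> (carrier (F2 Mod B)) (carrier (sym_group p))"
    and hom: "\<psi> \<in> hom (F2 Mod B) (sym_group p)"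
    by (auto simp: iso_def)
  interpret \<psi>: group_hom "F2 Mod B" "sym_group p" \<psi>
    using hom by (simp add: group_hom_def group_hom_axioms_def Q.is_group sym_group_is_group)
  have "card (rcosets\<^bsub>F2\<^esub> B) = card (carrier (F2 Mod B))" by (simp add: FactGroup_def)
  also have "\<dots> = card {f. f permutes {1..p}}"
    using bij_betw_same_card[OF bij] by (simp add: sym_group_def)
  also have "\<dots> = fact p" by (rule card_permutations) simp_all
  finally show "card (rcosets\<^bsub>F2\<^esub> B) = fact p" .
  let ?q = "B #>\<^bsub>F2\<^esub> F2_x"
  have mem: "?q \<in> carrier (F2 Mod B)"
    by (auto simp: FactGroup_def RCOSETS_def)
  have "\<psi> ?q permutes {1..p}" using \<psi>.hom_closed[OF mem] by (simp add: sym_group_carrier)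
  then obtain m where m: "m > 0" "m \<le> 2 ^ p" "\<psi> ?q ^^ m = id"
    using cycle_decomp_exponent[OF cycle_decomposition, of "\<psi> ?q" "{1..p}"] by auto
  have "\<psi> (?q [^]\<^bsub>F2 Mod B\<^esub> m) = \<psi> \<one>\<^bsub>F2 Mod B\<^esub>"
    using m(3) \<psi>.hom_nat_pow[OF mem, of m] \<psi>.hom_one by (simp add: sym_group_nat_pow sym_group_one)
  then have "?q [^]\<^bsub>F2 Mod B\<^esub> m = \<one>\<^bsub>F2 Mod B\<^esub>"
    by (rule inj_onD[OF bij_betw_imp_inj_on[OF bij]]) (simp_all only: Q.nat_pow_closed[OF mem] Q.one_closed)
  then have "F2_x [^]\<^bsub>F2\<^esub> m \<in> B" by (simp add: pow_mem_iff)
  with m show "\<exists>m. (m::nat) > 0 \<and> m \<le> 2 ^ p \<and> F2_x [^]\<^bsub>F2\<^esub> m \<in> B" by blast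
qed


section \<open>The density model\<close>

text \<open>The union bound over the draws, with the first draw split off as a factor of a product
  distribution.\<close>

lemma prob_replicate_pmf_hits:
  "measure_pmf.prob (replicate_pmf n q) {xs. set xs \<inter> D \<noteq> {}} \<le> real n * measure_pmf.prob q D"
proof (induction n)
  case 0 then show ?case by (simp add: indicator_def)
next
  case (Suc n)
  let ?E = "{xs. set xs \<inter> D \<noteq> {}}"
  let ?P = "pair_pmf q (replicate_pmf n q)"
  have "replicate_pmf (Suc n) q = map_pmf (\<lambda>(x, xs). x # xs) ?P"
    by (simp add: pair_pmf_def map_bind_pmf)
  moreover have "(\<lambda>(x, xs). x # xs) -` ?E = fst -` D \<union> snd -` ?E" by auto
  ultimately have "measure_pmf.prob (replicate_pmf (Suc n) q) ?E = measure_pmf.prob ?P (fst -` D \<union> snd -` ?E)"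
    by simp
  also have "\<dots> \<le> measure_pmf.prob ?P (fst -` D) + measure_pmf.prob ?P (snd -` ?E)"
    by (rule measure_Un_le) simp_all
  also have "\<dots> = measure_pmf.prob q D + measure_pmf.prob (replicate_pmf n q) ?E"
    using measure_map_pmf[of fst ?P D] measure_map_pmf[of snd ?P ?E]
    by (simp add: map_fst_pair_pmf map_snd_pair_pmf)
  finally show ?case using Suc by (simp add: algebra_simps)
qed

lemma real_power_over_fact_tendsto: "(\<lambda>n. K ^ n / fact n :: real) \<longlonglongrightarrow> 0"
  using summable_LIMSEQ_zero[OF summable_exp[of K]] by (simp add: field_simps)

text \<open>Failure requires one of n draws among M orbits to hit one of at most 2 k m. With n at
  most 2 M^\<delta> this has probability at most 4 k m M^(\<delta> - 1). The bound decreases in M,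
  so p! / 12 may be put in place of M.\<close>

lemma (in brady) prob_Z2_embeds:
  assumes A: "characteristic_subgroup A F2" and A_fin: "finite (rcosets\<^bsub>F2\<^esub> A)"
    and B: "B \<lhd> F2" "F2 Mod B \<cong> sym_group p"
    and \<Gamma>: "\<Gamma> = semidirect_Aut A B" and \<delta>: "0 < \<delta>" "\<delta> < 1"
    and n: "\<bar>real n - real (card (face_orbits act \<Gamma>)) powr \<delta>\<bar> < 1"
  shows "measure_pmf.prob (random_orbits act \<Gamma> n) {As. Z2_embeds (density_group act \<Gamma> (set As))}
    \<ge> 1 - 4 * real (card (rcosets\<^bsub>F2\<^esub> A)) * 2 ^ p * (fact p / 12) powr (\<delta> - 1)"
proof -
  let ?good = "{As. Z2_embeds (density_group act \<Gamma> (set As))}" and ?O = "face_orbits act \<Gamma>"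
  have B': "subgroup B F2" using B(1) by (rule normal_imp_subgroup)
  obtain k where k: "k > 0" "k \<le> card (rcosets\<^bsub>F2\<^esub> A)" "F2_x [^]\<^bsub>F2\<^esub> k \<in> A"
    using exponent_finite_index[OF characteristic_subgroup_normal[OF group_F2 A] A_fin] by blast
  obtain m :: nat where m: "m > 0" "m \<le> 2 ^ p" "F2_x [^]\<^bsub>F2\<^esub> m \<in> B"
    using exponent_sym_group(1)[OF B] by blast
  have pow: "x_pow (int j * i) \<in> S" if "subgroup S F2" "F2_x [^]\<^bsub>F2\<^esub> j \<in> S" for S i and j :: nat
  proof -
    have "x_pow (int j * i) = (F2_x [^]\<^bsub>F2\<^esub> j) [^]\<^bsub>F2\<^esub> i"
      by (simp add: F2.int_pow_pow int_pow_int[symmetric])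
    then show ?thesis using F2.subgroup_int_pow_closed[OF that] by simp
  qed
  have sub: "subgroup \<Gamma> AutF2" unfolding \<Gamma> by (rule semidirect_Aut_subgroup[OF A B'])
  have mem: "sd (x_pow (int k * i)) (x_pow (int m * j)) \<in> \<Gamma>" for i j
    unfolding \<Gamma> semidirect_Aut_eq using pow[OF _ k(3)] pow[OF B' m(3)] A
    by (auto simp: characteristic_subgroup_def)
  interpret brady_flat act \<Gamma> k m
    by (intro brady_flat.intro brady_subgroup.intro brady_axioms brady_subgroup_axioms.intro
        brady_flat_axioms.intro sub mem k(1) m(1))
  have good: "As \<in> ?good" if "set As \<subseteq> ?O" "set As \<inter> flat_orbits = {}" for As
    using Z2_embeds_density_group[OF that] by simp
  show ?thesis
  proof (cases "finite ?O")
    case False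
    \<comment> \<open>The cardinality of an infinite set is 0 by convention, and so is its power;
      rounding then leaves no draws, and the empty list is good.\<close>
    then have "n = 0" using n by simp
    then have "random_orbits act \<Gamma> n = return_pmf []" by (simp add: random_orbits_def)
    then have "measure_pmf.prob (random_orbits act \<Gamma> n) ?good = 1"
      using good[of "[]"] by simp
    then show ?thesis by simp
  next
    case True
    let ?M = "real (card ?O)"
    have nonempty: "?O \<noteq> {}" using lozenge_face[OF B4.one_closed] by (auto simp: face_orbits_eq)
    then have M1: "?M \<ge> 1" using True by (simp add: Suc_leI card_gt_0_iff)
    have "fact p \<le> 12 * card ?O"
      using card_cosets_le_orbits[OF A B'] True exponent_sym_group(2)[OF B] unfolding \<Gamma> by simp
    then have "(fact p :: real) \<le> 12 * ?M" by (metis of_nat_fact of_nat_le_iff of_nat_mult of_nat_numeral)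
    \<comment> \<open>The exponent is negative, so the lower bound for the number of orbits turns
      into an upper bound.\<close>
    then have Mp: "?M powr (\<delta> - 1) \<le> (fact p / 12) powr (\<delta> - 1)"
      using \<delta> by (intro powr_mono2') simp_all
    \<comment> \<open>Rounding up costs less than 1, which a second copy of the power absorbs as
      there is at least one orbit.\<close>
    have "real n \<le> ?M powr \<delta> + 1" using n by linarith
    also have "1 \<le> ?M powr \<delta>" using M1 \<delta> by (simp add: ge_one_powr_ge_zero)
    finally have n2: "real n \<le> 2 * ?M powr \<delta>" by simp
    let ?q = "pmf_of_set ?O"
    have "measure_pmf.prob ?q flat_orbits = card (?O \<inter> flat_orbits) / ?M"
      by (rule measure_pmf_of_set[OF nonempty True])
    also have "\<dots> \<le> real (2 * k * m) / ?M"
    proof (intro divide_right_mono)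
      have "card (?O \<inter> flat_orbits) \<le> card flat_orbits"
        using flat_orbits_bound by (intro card_mono) auto
      then show "real (card (?O \<inter> flat_orbits)) \<le> real (2 * k * m)"
        using flat_orbits_bound by linarith
    qed simp
    finally have q: "measure_pmf.prob ?q flat_orbits \<le> real (2 * k * m) / ?M" .
    have km: "real (2 * k * m) \<le> 2 * real (card (rcosets\<^bsub>F2\<^esub> A)) * 2 ^ p"
    proof -
      have "real k * real m \<le> real (card (rcosets\<^bsub>F2\<^esub> A)) * 2 ^ p"
        using k(2) m(2) by (intro mult_mono) (simp_all add: numeral_power_le_of_nat_cancel_iff[symmetric])
      then show ?thesis by simp
    qed
    have "1 - measure_pmf.prob (replicate_pmf n ?q) {As. set As \<inter> flat_orbits \<noteq> {}} =
        measure_pmf.prob (replicate_pmf n ?q) (UNIV - {As. set As \<inter> flat_orbits \<noteq> {}})"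
      using measure_pmf.prob_compl[of "{As. set As \<inter> flat_orbits \<noteq> {}}" "replicate_pmf n ?q"] by simp
    also have "\<dots> \<le> measure_pmf.prob (replicate_pmf n ?q) ?good"
    \<comment> \<open>\<open>good\<close> applies only to lists of actual orbits, so the inclusion
      holds on the support and not for all lists.\<close>
    proof (rule measure_pmf.finite_measure_mono_AE)
      show "AE As in replicate_pmf n ?q. As \<in> UNIV - {As. set As \<inter> flat_orbits \<noteq> {}} \<longrightarrow> As \<in> ?good"
        using good True nonempty by (auto simp: AE_measure_pmf_iff set_replicate_pmf)
    qed simp
    finally have "measure_pmf.prob (random_orbits act \<Gamma> n) ?good \<ge>
        1 - measure_pmf.prob (replicate_pmf n ?q) {As. set As \<inter> flat_orbits \<noteq> {}}"
      by (simp add: random_orbits_def)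
    moreover have "measure_pmf.prob (replicate_pmf n ?q) {As. set As \<inter> flat_orbits \<noteq> {}} \<le>
        4 * real (card (rcosets\<^bsub>F2\<^esub> A)) * 2 ^ p * (fact p / 12) powr (\<delta> - 1)"
    proof -
      have "measure_pmf.prob (replicate_pmf n ?q) {As. set As \<inter> flat_orbits \<noteq> {}} \<le>
          real n * measure_pmf.prob ?q flat_orbits" by (rule prob_replicate_pmf_hits)
      also have "\<dots> \<le> (2 * ?M powr \<delta>) * (2 * real (card (rcosets\<^bsub>F2\<^esub> A)) * 2 ^ p / ?M)"
        using n2 q km M1 by (intro mult_mono order_trans[OF q] divide_right_mono) simp_all
      also have "\<dots> = 4 * real (card (rcosets\<^bsub>F2\<^esub> A)) * 2 ^ p * (?M powr \<delta> / ?M)"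
        by simp
      also have "?M powr \<delta> / ?M = ?M powr (\<delta> - 1)"
        using M1 by (simp add: powr_diff)
      also have "4 * real (card (rcosets\<^bsub>F2\<^esub> A)) * 2 ^ p * ?M powr (\<delta> - 1) \<le>
          4 * real (card (rcosets\<^bsub>F2\<^esub> A)) * 2 ^ p * (fact p / 12) powr (\<delta> - 1)"
        using Mp by (intro mult_left_mono) simp_all
      finally show ?thesis .
    qed
    ultimately show ?thesis by linarith
  qed
qed

theorem theorem35:
  fixes act :: "(F2_elt \<Rightarrow> F2_elt) \<Rightarrow> brady_vertex \<Rightarrow> brady_vertex"
    and A B :: "nat \<Rightarrow> F2_elt set"
    and \<Gamma> :: "nat \<Rightarrow> (F2_elt \<Rightarrow> F2_elt) set"
    and h :: "nat \<Rightarrow> real"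
    and \<delta> :: real
    and N :: "nat \<Rightarrow> nat"
  assumes action: "brady_action act"
    and A_char: "\<And>p. p \<ge> 2 \<Longrightarrow> characteristic_subgroup (A p) F2"
    and B_normal: "\<And>p. p \<ge> 2 \<Longrightarrow> B p \<lhd> F2"
    and B_quotient: "\<And>p. p \<ge> 2 \<Longrightarrow> F2 Mod B p \<cong> sym_group p"
    and A_index: "h \<in> O(\<lambda>p. real p)"
      "\<And>p. p \<ge> 2 \<Longrightarrow> finite (rcosets\<^bsub>F2\<^esub> (A p)) \<and> real (card (rcosets\<^bsub>F2\<^esub> (A p))) \<le> exp (h p)"
    and \<Gamma>_def: "\<And>p. p \<ge> 2 \<Longrightarrow> \<Gamma> p = semidirect_Aut (A p) (B p)"
    and density: "0 < \<delta>" "\<delta> < 1"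
    and N_rounding: "\<And>p. p \<ge> 2 \<Longrightarrow>
      \<bar>real (N p) - real (card (face_orbits act (\<Gamma> p))) powr \<delta>\<bar> < 1"
  shows "(\<lambda>p. measure_pmf.prob (random_orbits act (\<Gamma> p) (N p))
            {As. Z2_embeds (density_group act (\<Gamma> p) (set As))}) \<longlonglongrightarrow> 1"
proof -
  let ?P = "\<lambda>p. measure_pmf.prob (random_orbits act (\<Gamma> p) (N p))
            {As. Z2_embeds (density_group act (\<Gamma> p) (set As))}"
  interpret brady act by unfold_locales (rule action)
  obtain c where c: "\<forall>\<^sub>F p in sequentially. norm (h p) \<le> c * norm (real p)"
    using A_index(1) by (auto elim: landau_o.bigE)
  \<comment> \<open>The value for which \<open>K powr (1 - \<delta>)\<close> equals
    \<open>2 * exp c\<close>. The exponential factors then combine with the factorial into the power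
    1 - \<delta> of K^p / p!, a general term of the exponential series; the 12 in \<open>E\<close>
    comes from \<open>fact p / 12\<close>.\<close>
  define K where "K = (2 * exp c) powr (1 / (1 - \<delta>))"
  define E where "E p = 4 * 12 powr (1 - \<delta>) * (K ^ p / fact p) powr (1 - \<delta>)" for p :: nat
  have K: "K > 0" by (simp add: K_def)
  have "(\<lambda>p. (K ^ p / fact p) powr (1 - \<delta>)) \<longlonglongrightarrow> 0"
    using real_power_over_fact_tendsto[of K] density K
    by (intro tendsto_zero_powrI[where b = "1 - \<delta>"]) (simp_all add: always_eventually)
  then have "E \<longlonglongrightarrow> 0" unfolding E_def by (rule tendsto_mult_right_zero)
  then have lim: "(\<lambda>p. 1 - E p) \<longlonglongrightarrow> 1" using tendsto_diff[OF tendsto_const, of E 0 _ 1] by simp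
  have lower: "\<forall>\<^sub>F p in sequentially. 1 - E p \<le> ?P p"
    using c eventually_ge_at_top[of 2]
  proof eventually_elim
    case (elim p)
    have "real (card (rcosets\<^bsub>F2\<^esub> (A p))) \<le> exp c ^ p"
    proof -
      have "h p \<le> real p * c" using elim(1) by (simp add: mult.commute abs_le_iff)
      then have "exp (h p) \<le> exp c ^ p" by (simp add: exp_of_nat_mult[symmetric])
      then show ?thesis using A_index(2)[OF elim(2)] by linarith
    qed
    then have "4 * real (card (rcosets\<^bsub>F2\<^esub> (A p))) * 2 ^ p * (fact p / 12) powr (\<delta> - 1) \<le>
        4 * exp c ^ p * 2 ^ p * (fact p / 12) powr (\<delta> - 1)"
      by (intro mult_right_mono mult_left_mono) simp_all
    also have "\<dots> = E p"
    proof -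
      have "K powr (1 - \<delta>) = 2 * exp c"
        using density by (simp add: K_def powr_powr)
      then have "(K ^ p) powr (1 - \<delta>) = exp c ^ p * 2 ^ p"
        using K by (simp add: powr_power[symmetric] powr_realpow[symmetric] powr_powr mult.commute)
      moreover have "(fact p / 12) powr (\<delta> - 1) = 12 powr (1 - \<delta>) / (fact p :: real) powr (1 - \<delta>)"
        using powr_minus_divide[of "fact p / 12 :: real" "1 - \<delta>"] by (simp add: powr_divide)
      ultimately show ?thesis using K by (simp add: E_def powr_divide)
    qed
    finally show ?case
      using prob_Z2_embeds[of "A p" "B p" p "\<Gamma> p" \<delta> "N p"] A_char B_normal B_quotient \<Gamma>_def
        density N_rounding A_index(2) elim(2) by fastforce
  qed
  show ?thesis
    by (rule tendsto_sandwich[OF lower _ lim tendsto_const]) (simp add: always_eventually)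
qed

end
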